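(* Let $W$ be a finite Coxeter group. For each standard Coxeter element $c$ of $W$ and each point $\mathfrak{y}\in\mathbb{B}$, the collection of simplices $\mathrm{SBDW}_\mathfrak{y}(W,c)$ is a triangulation of the $W$-permutahedron $\mathrm{Perm}_\mathfrak{y}(W)$.
   Context: Let $W$ be a finite Coxeter group of rank $r$ acting faithfully via its reflection representation on an $r$-dimensional real Euclidean space $V$. Let $\mathcal H$ be the set of reflecting hyperplanes, fix a connected component $\mathbb{B}$ of $V\setminus\bigcup\mathcal H$ (the base region), let $S$ be the set of reflections through the walls of $\mathbb{B}$ (simple reflections) and $T$ the set of all reflections of $W$. Let $\ell_S$ denote length with respect to $S$. The Bruhat order $\leq_{\mathrm B}$ on $W$ has cover relations $u\lessdot_{\mathrm B} v$ iff $v=ut$ for some $t\in T$ and $\ell_S(v)=\ell_S(u)+1$; $[u,v]_{\mathrm B}$ denotes a Bruhat interval. A standard Coxeter element is a product of all elements of $S$, each used exactly once, in some order. Let $W_c^+=\{u\in W:\ell_S(uc)=\ell_S(u)+r\}$. For $\mathfrak y\in\mathbb B$, $\mathrm{Perm}_\mathfrak{y}(W)=\mathrm{conv}(W\mathfrak y)$. Define $\mathrm{SBDW}_\mathfrak{y}(W,c)$ to be the collection of polytopes $\mathrm{conv}(\{u_0\mathfrak{y},u_1\mathfrak{y},\ldots,u_r\mathfrak{y}\})$ where $u\in W_c^+$ and $u=u_0\lessdot_{\mathrm B}u_1\lessdot_{\mathrm B}\cdots\lessdot_{\mathrm B}u_r=uc$ is a maximal chain of the Bruhat interval $[u,uc]_{\mathrm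 B}$. A triangulation of an $r$-dimensional polytope $P$ is a collection of $r$-dimensional simplices whose union is $P$ and such that any two of them intersect in a (possibly empty) common face of both. *)

theory Defs
  imports "HOL-Analysis.Analysis" "HOL-Algebra.Group_Action" "HOL-Algebra.Multiplicative_Group"
begin

definition word_prod :: "('w, 'm) monoid_scheme \<Rightarrow> 'w list \<Rightarrow> 'w" where
  "word_prod W xs = foldr (\<otimes>\<^bsub>W\<^esub>) xs \<one>\<^bsub>W\<^esub>"

(* Deletion of one relator (s t)^m(s,t), where m(s,t) is the order of s t.  For s = t this is the
   relator s s, so words over R already represent the inverses of generators. If s t has infinite
   order, group.ord is 0 and the relator is the empty word. *)
definition coxeter_step :: "('w, 'm) monoid_scheme \<Rightarrow> 'w set \<Rightarrow> 'w list \<Rightarrow> 'w list \<Rightarrow> bool" where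
  "coxeter_step W R us vs \<longleftrightarrow>
     (\<exists>xs\<in>lists R. \<exists>ys\<in>lists R. \<exists>s\<in>R. \<exists>t\<in>R.
        us = xs @ concat (replicate (group.ord W (s \<otimes>\<^bsub>W\<^esub> t)) [s, t]) @ ys \<and> vs = xs @ ys)"

(* The last conjunct says that the relations (s t)^m(s,t) = 1 present W on the generators R. *)
definition coxeter_system :: "('w, 'm) monoid_scheme \<Rightarrow> 'w set \<Rightarrow> bool" where
  "coxeter_system W R \<longleftrightarrow>
     group W \<and> R \<subseteq> carrier W \<and> generate W R = carrier W \<and>
     (\<forall>s\<in>R. s \<noteq> \<one>\<^bsub>W\<^esub> \<and> s \<otimes>\<^bsub>W\<^esub> s = \<one>\<^bsub>W\<^esub>) \<and>
     (\<forall>xs\<in>lists R. word_prod W xs = \<one>\<^bsub>W\<^esub> \<longrightarrow> equivclp (coxeter_step W R) xs [])"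

definition reflect :: "'v::euclidean_space \<Rightarrow> 'v \<Rightarrow> 'v" where
  "reflect a x = x - (2 * (a \<bullet> x) / (a \<bullet> a)) *\<^sub>R a"

definition is_reflection :: "('v::euclidean_space \<Rightarrow> 'v) \<Rightarrow> bool" where
  "is_reflection f \<longleftrightarrow> (\<exists>a. a \<noteq> 0 \<and> f = reflect a)"

(* The simple roots \<alpha> s are unit vectors: taking t = s in the last line gives
   \<alpha> s \<bullet> \<alpha> s = - cos pi = 1.  They form a basis indexed by R, so the rank card R of W is DIM('v). *)
definition reflection_representation ::
    "('w, 'm) monoid_scheme \<Rightarrow> 'w set \<Rightarrow> ('w \<Rightarrow> 'v::euclidean_space \<Rightarrow> 'v) \<Rightarrow> bool" where
  "reflection_representation W R \<rho> \<longleftrightarrow>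
     faithful_action W UNIV \<rho> \<and>
     (\<exists>\<alpha>. inj_on \<alpha> R \<and> independent (\<alpha> ` R) \<and> span (\<alpha> ` R) = UNIV \<and>
        (\<forall>s\<in>R. \<rho> s = reflect (\<alpha> s)) \<and>
        (\<forall>s\<in>R. \<forall>t\<in>R. \<alpha> s \<bullet> \<alpha> t = - cos (pi / real (group.ord W (s \<otimes>\<^bsub>W\<^esub> t)))))"

definition reflections :: "('w, 'm) monoid_scheme \<Rightarrow> ('w \<Rightarrow> 'v::euclidean_space \<Rightarrow> 'v) \<Rightarrow> 'w set" where
  "reflections W \<rho> = {t \<in> carrier W. is_reflection (\<rho> t)}"

definition reflecting_hyperplane :: "('w \<Rightarrow> 'v::euclidean_space \<Rightarrow> 'v) \<Rightarrow> 'w \<Rightarrow> 'v set" where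
  "reflecting_hyperplane \<rho> t = {x. \<rho> t x = x}"

definition hyperplanes :: "('w, 'm) monoid_scheme \<Rightarrow> ('w \<Rightarrow> 'v::euclidean_space \<Rightarrow> 'v) \<Rightarrow> 'v set set" where
  "hyperplanes W \<rho> = reflecting_hyperplane \<rho> ` reflections W \<rho>"

definition regions :: "('w, 'm) monoid_scheme \<Rightarrow> ('w \<Rightarrow> 'v::euclidean_space \<Rightarrow> 'v) \<Rightarrow> 'v set set" where
  "regions W \<rho> = components (UNIV - \<Union> (hyperplanes W \<rho>))"

definition walls ::
    "('w, 'm) monoid_scheme \<Rightarrow> ('w \<Rightarrow> 'v::euclidean_space \<Rightarrow> 'v) \<Rightarrow> 'v set \<Rightarrow> 'v set set" where
  "walls W \<rho> B = {H \<in> hyperplanes W \<rho>. (H \<inter> closure B) facet_of (closure B)}"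

definition simple_reflections ::
    "('w, 'm) monoid_scheme \<Rightarrow> ('w \<Rightarrow> 'v::euclidean_space \<Rightarrow> 'v) \<Rightarrow> 'v set \<Rightarrow> 'w set" where
  "simple_reflections W \<rho> B =
     {s \<in> reflections W \<rho>. reflecting_hyperplane \<rho> s \<in> walls W \<rho> B}"

definition word_length :: "('w, 'm) monoid_scheme \<Rightarrow> 'w set \<Rightarrow> 'w \<Rightarrow> nat" where
  "word_length W S w = (LEAST n. \<exists>xs\<in>lists S. length xs = n \<and> word_prod W xs = w)"

definition bruhat_cover ::
    "('w, 'm) monoid_scheme \<Rightarrow> ('w \<Rightarrow> 'v::euclidean_space \<Rightarrow> 'v) \<Rightarrow> 'v set \<Rightarrow> 'w \<Rightarrow> 'w \<Rightarrow> bool" where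
  "bruhat_cover W \<rho> B u v \<longleftrightarrow>
     u \<in> carrier W \<and> (\<exists>t\<in>reflections W \<rho>. v = u \<otimes>\<^bsub>W\<^esub> t) \<and>
     word_length W (simple_reflections W \<rho> B) v = word_length W (simple_reflections W \<rho> B) u + 1"

definition standard_coxeter_elements ::
    "('w, 'm) monoid_scheme \<Rightarrow> ('w \<Rightarrow> 'v::euclidean_space \<Rightarrow> 'v) \<Rightarrow> 'v set \<Rightarrow> 'w set" where
  "standard_coxeter_elements W \<rho> B =
     {word_prod W xs | xs. distinct xs \<and> set xs = simple_reflections W \<rho> B}"

(* The set written W with superscript + and subscript c. *)
definition W_plus ::
    "('w, 'm) monoid_scheme \<Rightarrow> ('w \<Rightarrow> 'v::euclidean_space \<Rightarrow> 'v) \<Rightarrow> 'v set \<Rightarrow> 'w \<Rightarrow> 'w set" where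
  "W_plus W \<rho> B c =
     {u \<in> carrier W. word_length W (simple_reflections W \<rho> B) (u \<otimes>\<^bsub>W\<^esub> c)
                   = word_length W (simple_reflections W \<rho> B) u + DIM('v)}"

definition Perm ::
    "('w, 'm) monoid_scheme \<Rightarrow> ('w \<Rightarrow> 'v::euclidean_space \<Rightarrow> 'v) \<Rightarrow> 'v \<Rightarrow> 'v set" where
  "Perm W \<rho> y = convex hull ((\<lambda>w. \<rho> w y) ` carrier W)"

(* A chain of Bruhat covers from u to u c is the same as a maximal chain of the interval [u, u c]. *)
definition SBDW ::
    "('w, 'm) monoid_scheme \<Rightarrow> ('w \<Rightarrow> 'v::euclidean_space \<Rightarrow> 'v) \<Rightarrow> 'v set \<Rightarrow> 'w \<Rightarrow> 'v \<Rightarrow> 'v set set" where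
  "SBDW W \<rho> B c y =
     {convex hull ((\<lambda>i. \<rho> (f i) y) ` {0..DIM('v)}) | f :: nat \<Rightarrow> 'w.
        f 0 \<in> W_plus W \<rho> B c \<and> f DIM('v) = f 0 \<otimes>\<^bsub>W\<^esub> c \<and>
        (\<forall>i<DIM('v). bruhat_cover W \<rho> B (f i) (f (Suc i)))}"

(* The library predicate triangulation requires finitely many simplices, of any dimensions, any two
   of which meet in a common (possibly empty) face, but does not fix their union. *)
definition triangulation_of :: "nat \<Rightarrow> 'v::euclidean_space set set \<Rightarrow> 'v set \<Rightarrow> bool" where
  "triangulation_of r \<T> P \<longleftrightarrow>
     polytope P \<and> aff_dim P = int r \<and>
     triangulation \<T> \<and> (\<forall>T\<in>\<T>. int r simplex T) \<and> \<Union>\<T> = P"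

end

theory Submission
  imports Defs
begin

text \<open>
  Write \<open>u\<^sub>0 < \<dots> < u\<^sub>r = u\<^sub>0 c\<close> for a chain. Its simplex is nondegenerate because the product of the \<open>r\<close>
  reflections along the chain is conjugate to \<open>c\<close>, which has no nonzero fixed vector. Every facet of
  such a simplex either lies on the boundary of the permutahedron or has exactly one neighbour, on the
  other side. Replacing an interior vertex is the diamond property of Bruhat intervals of length two,
  which can be checked in the plane of a dihedral reflection subgroup. Dropping \<open>u\<^sub>r = u\<^sub>r\<^sub>-\<^sub>1 t\<close> leads to
  the new vertex \<open>u\<^sub>r\<^sub>-\<^sub>1 c\<^sup>-\<^sup>1\<close>, whose edge to \<open>u\<^sub>0\<close> is parallel to the dropped one;
  that edge fails to increase the length only when \<open>t\<close> is an inversion of \<open>c\<close>. By strong exchange \<open>c t\<close> is then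
  \<open>c\<close> with one letter deleted, it fixes a fundamental coweight, and the facet lies in a
  supporting hyperplane. Dropping \<open>u\<^sub>0\<close> is symmetric.

  Counting how a generic segment enters and leaves the simplices shows that generic interior points all
  lie in the same number of simplices. Near \<open>y\<close> this number is one: the chains starting at the
  identity are nested families of subwords of \<open>c\<close>, and their simplices subdivide the simplicial cone at
  \<open>y\<close>. The same count, applied near a point to the simplices in which it has a given carrier, shows
  that the simplices meet face to face.
\<close>

section \<open>Matched families of simplices\<close>

text \<open>One vector \<open>y\<close> plays two roles: it generates the orbit, and its inner
  product with a root decides whether the root is positive. Thus a Bruhat relation u < v is visible
  in the picture: \<open>\<rho> v y\<close> is \<open>\<rho> u y\<close> minus a positive multiple
  of a positive root. A chain is a window of r + 1 places in a two-sided sequence with w(i + r) =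
  w(i) c. Replacing an end vertex shifts this window by one place, which is where u_(r-1) c^-1 comes
  from. The shift fails exactly when the new step would not increase the length. Multiplicity one at
  generic points yields a covering with disjoint interiors, but two simplices could still meet in a
  set that is not a common face. The remedy is that matching is local: the barycentric coordinates
  of a point q on a shared facet are the same in both simplices, so the simplices giving q one fixed
  carrier are again matched near q. If two simplices gave q different carriers, generic points near
  q would tell them apart, against the constant count within one such class.\<close>

definition nondegenerate :: "'a::euclidean_space set \<Rightarrow> bool" where
  "nondegenerate X \<longleftrightarrow> \<not> affine_dependent X \<and> card X = Suc DIM('a)"

text \<open>Affine coordinates of every point of the space, negative ones included, so that crossing
  a facet is a change of sign. For nondegenerate \<open>X\<close> the values on \<open>X\<close> are
  determined; elsewhere the choice leaves them open.\<close>

definition bary :: "'a::euclidean_space set \<Rightarrow> 'a \<Rightarrow> 'a \<Rightarrow> real" where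
  "bary X z = (SOME u. sum u X = 1 \<and> (\<Sum>x\<in>X. u x *\<^sub>R x) = z)"

lemma nondegenerate_finite: "nondegenerate X \<Longrightarrow> finite X"
  by (simp add: nondegenerate_def aff_independent_finite)

lemma nondegenerate_affine_hull:
  fixes X :: "'a::euclidean_space set"
  assumes "nondegenerate X"
  shows "affine hull X = UNIV"
proof -
  have "aff_dim X = int DIM('a)"
    using assms aff_dim_affine_independent[of X] by (simp add: nondegenerate_def)
  then show ?thesis using aff_dim_eq_full by blast
qed

lemma
  assumes "nondegenerate X"
  shows bary_sum: "sum (bary X z) X = 1"
    and bary_combination: "(\<Sum>x\<in>X. bary X z x *\<^sub>R x) = z"
proof -
  have "z \<in> affine hull X" using nondegenerate_affine_hull[OF assms] by simp
  then have "\<exists>u. sum u X = 1 \<and> (\<Sum>x\<in>X. u x *\<^sub>R x) = z"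
    by (simp add: affine_hull_finite nondegenerate_finite[OF assms])
  then have "sum (bary X z) X = 1 \<and> (\<Sum>x\<in>X. bary X z x *\<^sub>R x) = z"
    unfolding bary_def by (rule someI_ex)
  then show "sum (bary X z) X = 1" "(\<Sum>x\<in>X. bary X z x *\<^sub>R x) = z" by auto
qed

lemma bary_unique:
  assumes X: "nondegenerate X" and u: "sum u X = 1" "(\<Sum>x\<in>X. u x *\<^sub>R x) = z" and x: "x \<in> X"
  shows "bary X z x = u x"
proof (rule ccontr)
  assume ne: "bary X z x \<noteq> u x"
  let ?U = "\<lambda>v. bary X z v - u v"
  have "sum ?U X = 0" using bary_sum[OF X] u by (simp add: sum_subtractf)
  moreover have "(\<Sum>v\<in>X. ?U v *\<^sub>R v) = 0"
    using bary_combination[OF X] u by (simp add: scaleR_left_diff_distrib sum_subtractf)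
  moreover have "\<exists>v\<in>X. ?U v \<noteq> 0" using ne x by force
  ultimately have "affine_dependent X"
    using affine_dependent_explicit_finite[OF nondegenerate_finite[OF X]] by blast
  then show False using X by (simp add: nondegenerate_def)
qed

lemma bary_vertex:
  assumes "nondegenerate X" "v \<in> X" "x \<in> X"
  shows "bary X v x = (if x = v then 1 else 0)"
proof -
  have f: "finite X" using assms nondegenerate_finite by blast
  have "(\<Sum>x\<in>X. (if x = v then 1 else 0) *\<^sub>R x) = (\<Sum>x\<in>X. (if x = v then x else 0))"
    by (rule sum.cong) auto
  then have "(\<Sum>x\<in>X. (if x = v then 1 else 0) *\<^sub>R x) = v"
    using assms f by (simp add: sum.delta')
  then show ?thesis
    using assms f bary_unique[of X "\<lambda>x. if x = v then 1 else 0" v x] by (simp add: sum.delta')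
qed

lemma bary_affine_combination:
  assumes X: "nondegenerate X" and A: "sum u A = 1" and x: "x \<in> X"
  shows "bary X (\<Sum>a\<in>A. u a *\<^sub>R f a) x = (\<Sum>a\<in>A. u a * bary X (f a) x)"
proof (rule bary_unique[OF X _ _ x])
  show "(\<Sum>x\<in>X. \<Sum>a\<in>A. u a * bary X (f a) x) = 1"
    by (subst sum.swap) (simp add: sum_distrib_left[symmetric] bary_sum[OF X] A)
  have "(\<Sum>x\<in>X. (\<Sum>a\<in>A. u a * bary X (f a) x) *\<^sub>R x)
      = (\<Sum>x\<in>X. \<Sum>a\<in>A. u a *\<^sub>R (bary X (f a) x *\<^sub>R x))"
    by (simp add: scaleR_sum_left)
  also have "\<dots> = (\<Sum>a\<in>A. u a *\<^sub>R (\<Sum>x\<in>X. bary X (f a) x *\<^sub>R x))"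
    by (subst sum.swap) (simp add: scaleR_sum_right)
  also have "\<dots> = (\<Sum>a\<in>A. u a *\<^sub>R f a)" by (simp add: bary_combination[OF X])
  finally show "(\<Sum>x\<in>X. (\<Sum>a\<in>A. u a * bary X (f a) x) *\<^sub>R x) = (\<Sum>a\<in>A. u a *\<^sub>R f a)" .
qed

lemma bary_segment:
  assumes X: "nondegenerate X" and x: "x \<in> X"
  shows "bary X ((1 - t) *\<^sub>R p + t *\<^sub>R q) x = (1 - t) * bary X p x + t * bary X q x"
  using bary_affine_combination[OF X _ x, of "\<lambda>b. if b then t else 1 - t" UNIV "\<lambda>b. if b then q else p"]
  by (simp add: UNIV_bool add.commute)

lemma in_affine_hull_bary:
  assumes X: "nondegenerate X" and Y: "Y \<subseteq> X"
  shows "z \<in> affine hull Y \<longleftrightarrow> (\<forall>x\<in>X - Y. bary X z x = 0)"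
proof
  have fX: "finite X" and fY: "finite Y" using nondegenerate_finite[OF X] Y finite_subset by auto
  {
    assume "z \<in> affine hull Y"
    then obtain u where u: "sum u Y = 1" "(\<Sum>x\<in>Y. u x *\<^sub>R x) = z"
      using affine_hull_finite[OF fY] by auto
    show "\<forall>x\<in>X - Y. bary X z x = 0"
    proof
      fix x assume x: "x \<in> X - Y"
      let ?u = "\<lambda>x. if x \<in> Y then u x else 0"
      have "sum ?u X = 1" using u(1) Y fX by (simp add: sum.If_cases Int_absorb1)
      moreover have "(\<Sum>x\<in>X. ?u x *\<^sub>R x) = z"
        using u(2) by (subst sum.mono_neutral_cong_right[OF fX Y]) auto
      ultimately show "bary X z x = 0" using bary_unique[OF X, of ?u z x] x by simp
    qed
  }
  assume 0: "\<forall>x\<in>X - Y. bary X z x = 0"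
  have "sum (bary X z) Y = 1"
    using bary_sum[OF X, of z] 0 by (subst sum.mono_neutral_left[OF fX Y]) auto
  moreover have "(\<Sum>x\<in>Y. bary X z x *\<^sub>R x) = z"
    using bary_combination[OF X, of z] 0 by (subst sum.mono_neutral_left[OF fX Y]) auto
  ultimately show "z \<in> affine hull Y" using affine_hull_finite[OF fY] by auto
qed

lemma in_convex_hull_bary:
  assumes X: "nondegenerate X" and Y: "Y \<subseteq> X"
  shows "z \<in> convex hull Y \<longleftrightarrow> (\<forall>x\<in>X. 0 \<le> bary X z x) \<and> (\<forall>x\<in>X - Y. bary X z x = 0)"
proof
  have fX: "finite X" and fY: "finite Y" using nondegenerate_finite[OF X] Y finite_subset by auto
  {
    assume "z \<in> convex hull Y"
    then obtain u where u: "\<forall>x\<in>Y. 0 \<le> u x" "sum u Y = 1" "(\<Sum>x\<in>Y. u x *\<^sub>R x) = z"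
      using convex_hull_finite[OF fY] by auto
    let ?u = "\<lambda>x. if x \<in> Y then u x else 0"
    have "sum ?u X = 1" using u(2) Y fX by (simp add: sum.If_cases Int_absorb1)
    moreover have "(\<Sum>x\<in>X. ?u x *\<^sub>R x) = z"
      using u(3) by (subst sum.mono_neutral_cong_right[OF fX Y]) auto
    ultimately have "bary X z x = ?u x" if "x \<in> X" for x using bary_unique[OF X] that by blast
    then show "(\<forall>x\<in>X. 0 \<le> bary X z x) \<and> (\<forall>x\<in>X - Y. bary X z x = 0)"
      using u(1) by auto
  }
  assume 0: "(\<forall>x\<in>X. 0 \<le> bary X z x) \<and> (\<forall>x\<in>X - Y. bary X z x = 0)"
  have "sum (bary X z) Y = 1"
    using bary_sum[OF X, of z] 0 by (subst sum.mono_neutral_left[OF fX Y]) auto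
  moreover have "(\<Sum>x\<in>Y. bary X z x *\<^sub>R x) = z"
    using bary_combination[OF X, of z] 0 by (subst sum.mono_neutral_left[OF fX Y]) auto
  moreover have "\<forall>x\<in>Y. 0 \<le> bary X z x" using 0 Y by blast
  ultimately show "z \<in> convex hull Y" using convex_hull_finite[OF fY] by blast
qed

text \<open>The coordinate at \<open>x\<close> is an affine function vanishing on all vertices
  common to the two simplices, so only the new vertex contributes when \<open>z\<close> is expanded
  in the new simplex. A negative factor \<open>bary X x' x\<close> means that the simplices lie on
  opposite sides of the shared facet.\<close>

lemma bary_change_vertex:
  assumes X: "nondegenerate X" and X': "nondegenerate (insert x' (X - {x}))"
    and x: "x \<in> X" and x': "x' \<notin> X - {x}"
  shows "bary X z x = bary (insert x' (X - {x})) z x' * bary X x' x"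
proof -
  let ?X' = "insert x' (X - {x})"
  have "bary X z x = bary X (\<Sum>v\<in>?X'. bary ?X' z v *\<^sub>R v) x"
    by (simp only: bary_combination[OF X'])
  also have "\<dots> = (\<Sum>v\<in>?X'. bary ?X' z v * bary X v x)"
    by (rule bary_affine_combination[OF X bary_sum[OF X'] x])
  also have "\<dots> = (\<Sum>v\<in>{x'}. bary ?X' z v * bary X v x)"
    using nondegenerate_finite[OF X] x
    by (intro sum.mono_neutral_right) (auto simp: bary_vertex[OF X])
  finally show ?thesis by simp
qed

section \<open>Generic points and generic segments\<close>

definition generic_for :: "'a::euclidean_space set set \<Rightarrow> 'a \<Rightarrow> bool" where
  "generic_for \<S> p \<longleftrightarrow> (\<forall>X\<in>\<S>. \<forall>x\<in>X. bary X p x \<noteq> 0)"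

text \<open>General position with respect to faces of codimension two: at every time at most one
  coordinate of each simplex vanishes, so a facet is crossed only in its relative interior.\<close>

definition generic_segment :: "'a::euclidean_space set set \<Rightarrow> 'a \<Rightarrow> 'a \<Rightarrow> bool" where
  "generic_segment \<S> p q \<longleftrightarrow> (\<forall>X\<in>\<S>. \<forall>x\<in>X. \<forall>x'\<in>X. \<forall>t\<in>{0..1}. x \<noteq> x' \<longrightarrow>
     bary X ((1 - t) *\<^sub>R p + t *\<^sub>R q) x = 0 \<longrightarrow> bary X ((1 - t) *\<^sub>R p + t *\<^sub>R q) x' \<noteq> 0)"

lemma generic_segment_sym: "generic_segment \<S> p q \<Longrightarrow> generic_segment \<S> q p"
  unfolding generic_segment_def
proof (intro ballI impI)
  fix X x x' and t :: real
  assume g: "\<forall>X\<in>\<S>. \<forall>x\<in>X. \<forall>x'\<in>X. \<forall>t\<in>{0..1}. x \<noteq> x' \<longrightarrow>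
     bary X ((1 - t) *\<^sub>R p + t *\<^sub>R q) x = 0 \<longrightarrow> bary X ((1 - t) *\<^sub>R p + t *\<^sub>R q) x' \<noteq> 0"
    and h: "X \<in> \<S>" "x \<in> X" "x' \<in> X" "t \<in> {0..1}" "x \<noteq> x'"
      "bary X ((1 - t) *\<^sub>R q + t *\<^sub>R p) x = 0"
  have t: "1 - t \<in> {0..1}" using h by auto
  have "(1 - t) *\<^sub>R q + t *\<^sub>R p = (1 - (1 - t)) *\<^sub>R p + (1 - t) *\<^sub>R q" by simp
  with g[rule_format, OF h(1,2,3) t h(5)] h(6)
  show "bary X ((1 - t) *\<^sub>R q + t *\<^sub>R p) x' \<noteq> 0" by metis
qed

lemma negligible_affine_hull_card:
  fixes S :: "'a::euclidean_space set"
  assumes "finite S" "card S \<le> DIM('a)"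
  shows "negligible (affine hull S)"
  using assms empty_interior_affine_hull[of S]
  by (simp add: negligible_convex_interior affine_imp_convex)

lemma negligible_nongeneric:
  fixes \<S> :: "'a::euclidean_space set set"
  assumes fin: "finite \<S>" and nds: "\<forall>X\<in>\<S>. nondegenerate X"
  shows "negligible {q. \<not> generic_for \<S> q}"
proof -
  note nd = nds[THEN bspec]
  have "negligible (\<Union>X\<in>\<S>. \<Union>x\<in>X. affine hull (X - {x}))"
    using nd by (intro negligible_Union ballI finite_imageI fin) 
      (auto simp: nondegenerate_def nondegenerate_finite intro!: negligible_Union negligible_affine_hull_card)
  moreover have "q \<in> (\<Union>X\<in>\<S>. \<Union>x\<in>X. affine hull (X - {x}))" if "\<not> generic_for \<S> q" for q
  proof -
    from that obtain X x where h: "X \<in> \<S>" "x \<in> X" "bary X q x = 0"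
      by (auto simp: generic_for_def)
    then have "q \<in> affine hull (X - {x})"
      using in_affine_hull_bary[OF nd[OF h(1)], of "X - {x}" q] by auto
    then show ?thesis using h by blast
  qed
  ultimately show ?thesis by (auto elim: negligible_subset)
qed

lemma generic_exists:
  assumes "finite \<S>" "\<forall>X\<in>\<S>. nondegenerate X" "open U" "U \<noteq> {}"
  obtains q where "q \<in> U" "generic_for \<S> q"
  using negligible_nongeneric[OF assms(1,2)] open_not_negligible[OF assms(3,4)] negligible_subset
  by blast

text \<open>A bad endpoint lies in the affine span of \<open>p\<close> and a face of codimension
  two. Such a span is generated by at most \<open>DIM('a)\<close> points, so it has measure zero,
  and there are finitely many.\<close>

lemma generic_segment_exists:
  fixes \<S> :: "'a::euclidean_space set set"
  assumes fin: "finite \<S>" and nds: "\<forall>X\<in>\<S>. nondegenerate X"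
    and p: "generic_for \<S> p" and U: "open U" "U \<noteq> {}"
  obtains q where "q \<in> U" "generic_for \<S> q" "generic_segment \<S> p q"
proof -
  note nd = nds[THEN bspec]
  let ?B1 = "{q. \<not> generic_for \<S> q}"
  let ?B2 = "\<Union>X\<in>\<S>. \<Union>x\<in>X. \<Union>x'\<in>X - {x}. affine hull (insert p (X - {x, x'}))"
  have fX: "finite X" and cX: "card X = Suc DIM('a)" if "X \<in> \<S>" for X
    using nd[OF that] by (auto simp: nondegenerate_finite nondegenerate_def)
  have "negligible ?B1" by (rule negligible_nongeneric[OF fin nds])
  moreover have "negligible ?B2"
  proof -
    have "negligible (affine hull (insert p (X - {x, x'})))"
      if "X \<in> \<S>" "x \<in> X" "x' \<in> X - {x}" for X x x'
    proof (rule negligible_affine_hull_card)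
      show "finite (insert p (X - {x, x'}))" using fX that by auto
      have "card (X - {x, x'}) = card X - 2" using that fX[of X] by (subst card_Diff_subset) auto
      moreover have "card (insert p (X - {x, x'})) \<le> Suc (card (X - {x, x'}))"
        using fX[OF that(1)] by (simp add: card_insert_if)
      ultimately show "card (insert p (X - {x, x'})) \<le> DIM('a)"
        using cX[OF that(1)] DIM_positive[where 'a='a] by linarith
    qed
    then show ?thesis
      using fX by (auto intro!: negligible_Union fin)
  qed
  ultimately have "negligible (?B1 \<union> ?B2)" by (rule negligible_Un)
  then have "\<not> U \<subseteq> ?B1 \<union> ?B2"
    using U open_not_negligible negligible_subset by blast
  then obtain q where q: "q \<in> U" "q \<notin> ?B1" "q \<notin> ?B2" by blast
  have gq: "generic_for \<S> q" using q by simp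
  have "generic_segment \<S> p q"
    unfolding generic_segment_def
  proof (intro ballI impI notI)
    fix X x x' and t :: real
    let ?z = "(1 - t) *\<^sub>R p + t *\<^sub>R q"
    assume h: "X \<in> \<S>" "x \<in> X" "x' \<in> X" "t \<in> {0..1}" "x \<noteq> x'" "bary X ?z x = 0" "bary X ?z x' = 0"
    \<comment> \<open>At \<open>t = 0\<close> the point would be the generic \<open>p\<close>. For
      any other \<open>t\<close> the endpoint \<open>q\<close> lies on the line through
      \<open>p\<close> and \<open>?z\<close>.\<close>
    have "t \<noteq> 0" using h p by (auto simp: generic_for_def)
    have "X - (X - {x, x'}) = {x, x'}" using h by auto
    then have "?z \<in> affine hull (X - {x, x'})"
      using h by (subst in_affine_hull_bary[OF nd[OF h(1)]]) auto
    then have z: "?z \<in> affine hull (insert p (X - {x, x'}))"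
      by (meson hull_mono subset_insertI subsetD)
    have pp: "p \<in> affine hull (insert p (X - {x, x'}))" by (simp add: hull_inc)
    have "q = (1 / t) *\<^sub>R ?z + (1 - 1 / t) *\<^sub>R p"
      using \<open>t \<noteq> 0\<close> by (simp add: scaleR_add_right scaleR_left_diff_distrib diff_divide_distrib scaleR_diff_right)
    then have "q \<in> affine hull (insert p (X - {x, x'}))"
      using mem_affine[OF affine_affine_hull z pp, of "1 / t" "1 - 1 / t"] by simp
    then show False using q h by blast
  qed
  with q(1) gq that show ?thesis by blast
qed


section \<open>Leaving a simplex, and counting simplices along a segment\<close>

lemma exit_facet:
  fixes X :: "'a::euclidean_space set"
  assumes nds: "\<forall>X\<in>\<S>. nondegenerate X" and XS: "X \<in> \<S>"
    and p: "generic_for \<S> p" and q: "generic_for \<S> q" and g: "generic_segment \<S> p q"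
    and s: "s \<in> {0..1}" "(1 - s) *\<^sub>R p + s *\<^sub>R q \<in> convex hull X" and out: "q \<notin> convex hull X"
  obtains b x where "0 < b" "b < 1" "x \<in> X" "bary X q x < 0" "0 < bary X p x"
    "(1 - b) *\<^sub>R p + b *\<^sub>R q \<in> convex hull (X - {x})"
proof -
  note nd = nds[THEN bspec]
  have X: "nondegenerate X" by (rule nd[OF XS])
  have fX: "finite X" by (rule nondegenerate_finite[OF X])
  let ?\<alpha> = "bary X p" and ?\<beta> = "bary X q"
  let ?A = "{x \<in> X. ?\<beta> x < 0}"
  let ?\<tau> = "\<lambda>x. ?\<alpha> x / (?\<alpha> x - ?\<beta> x)"
  have s0: "0 \<le> (1 - s) * ?\<alpha> x + s * ?\<beta> x" if "x \<in> X" for x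
    using s(2) in_convex_hull_bary[OF X order_refl] bary_segment[OF X] that by simp
  have "?A \<noteq> {}" using out in_convex_hull_bary[OF X order_refl, of q] by force
  \<comment> \<open>A coordinate negative at both ends would also be negative at time
    \<open>s\<close>.\<close>
  have \<alpha>: "?\<alpha> x > 0" if "x \<in> ?A" for x
  proof (rule ccontr)
    assume "\<not> 0 < ?\<alpha> x"
    moreover have "?\<alpha> x \<noteq> 0" using p XS that by (auto simp: generic_for_def)
    ultimately have neg: "?\<alpha> x < 0" by simp
    have "(1 - s) * ?\<alpha> x \<le> 0" "s * ?\<beta> x \<le> 0"
      using neg that s(1) by (auto simp: mult_nonneg_nonpos)
    moreover have "(1 - s) * ?\<alpha> x < 0 \<or> s * ?\<beta> x < 0"
      using neg that s(1) by (cases "s = 1") (auto simp: mult_pos_neg)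
    ultimately show False using s0[of x] that by auto
  qed
  \<comment> \<open>The first time at which a coordinate that ends negative reaches zero, hence the
    last time inside the simplex; the facet of exit is opposite to \<open>x\<close>.\<close>
  define b where "b = Min (?\<tau> ` ?A)"
  have "b \<in> ?\<tau> ` ?A" unfolding b_def using \<open>?A \<noteq> {}\<close> fX by (intro Min_in) auto
  then obtain x where x: "x \<in> ?A" "b = ?\<tau> x" by blast
  have ble: "b \<le> ?\<tau> z" if "z \<in> ?A" for z unfolding b_def using fX that by (intro Min_le) auto
  have b01: "0 < b" "b < 1" using x \<alpha>[OF x(1)] by (auto simp: zero_less_divide_iff divide_less_eq)
  \<comment> \<open>Coordinates that start negative and end nonnegative are increasing and already
    nonnegative at time \<open>s\<close>, so this inequality settles them at time
    \<open>b\<close>.\<close>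
  have sb: "s \<le> b"
  proof -
    have d: "?\<alpha> x - ?\<beta> x > 0" using x \<alpha>[OF x(1)] by simp
    have "s * (?\<alpha> x - ?\<beta> x) \<le> ?\<alpha> x" using s0[of x] x(1) by (simp add: algebra_simps)
    then show ?thesis using x(2) d by (simp add: pos_le_divide_eq)
  qed
  have nonneg: "0 \<le> (1 - b) * ?\<alpha> z + b * ?\<beta> z" if z: "z \<in> X" for z
  proof (cases "z \<in> ?A")
    case True
    then show ?thesis using ble[OF True] \<alpha>[OF True] by (simp add: field_simps)
  next
    case False
    then have "?\<beta> z \<ge> 0" using z by simp
    show ?thesis
    proof (cases "?\<alpha> z \<ge> 0")
      case True
      then show ?thesis using \<open>?\<beta> z \<ge> 0\<close> b01 by simp
    next
      case False
      then have "b * (?\<beta> z - ?\<alpha> z) \<ge> s * (?\<beta> z - ?\<alpha> z)"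
        using sb \<open>?\<beta> z \<ge> 0\<close> by (intro mult_right_mono) auto
      then show ?thesis using s0[OF z] by (simp add: algebra_simps)
    qed
  qed
  have zero: "(1 - b) * ?\<alpha> x + b * ?\<beta> x = 0"
    using x \<alpha>[OF x(1)] by (simp add: field_simps)
  have "(1 - b) *\<^sub>R p + b *\<^sub>R q \<in> convex hull (X - {x})"
    using nonneg zero x by (subst in_convex_hull_bary[OF X]) (auto simp: bary_segment[OF X])
  moreover have "x \<in> X" "bary X q x < 0" using x by auto
  ultimately show ?thesis using that[OF b01] \<alpha>[OF x(1)] by blast
qed

text \<open>A pseudomanifold condition inside \<open>U\<close>: behind each facet that reaches
  \<open>U\<close> there is exactly one other simplex. The strict convex combination puts
  \<open>x\<close> and \<open>x'\<close> on opposite sides of the hyperplane of the facet.\<close>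

definition matched :: "'a::euclidean_space set set \<Rightarrow> 'a set \<Rightarrow> bool" where
  "matched \<S> U \<longleftrightarrow> (\<forall>X\<in>\<S>. \<forall>x\<in>X. convex hull (X - {x}) \<inter> U \<noteq> {} \<longrightarrow>
     (\<exists>x'. insert x' (X - {x}) \<in> \<S> \<and>
        (\<exists>l\<in>{0<..<1}. (1 - l) *\<^sub>R x + l *\<^sub>R x' \<in> affine hull (X - {x})) \<and>
        (\<forall>x''. insert x'' (X - {x}) \<in> \<S> \<longrightarrow> x'' = x \<or> x'' = x')))"

text \<open>The coordinate at \<open>x\<close> is affine, equal to 1 at \<open>x\<close> and to 0 at
  a point strictly between \<open>x\<close> and \<open>x'\<close>, hence negative at
  \<open>x'\<close>.\<close>

lemma matchedD:
  assumes m: "matched \<S> U" and nds: "\<forall>X\<in>\<S>. nondegenerate X"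
    and X: "X \<in> \<S>" "x \<in> X" "z \<in> convex hull (X - {x})" "z \<in> U"
  obtains x' where "insert x' (X - {x}) \<in> \<S>" "x' \<notin> X" "bary X x' x < 0"
    "\<And>x''. insert x'' (X - {x}) \<in> \<S> \<Longrightarrow> x'' = x \<or> x'' = x'"
proof -
  note nd = nds[THEN bspec]
  have "convex hull (X - {x}) \<inter> U \<noteq> {}" using X by blast
  from m[unfolded matched_def, rule_format, OF X(1,2) this]
  obtain x' l where x': "insert x' (X - {x}) \<in> \<S>" "\<And>x''. insert x'' (X - {x}) \<in> \<S> \<Longrightarrow> x'' = x \<or> x'' = x'"
    and l: "0 < l" "l < 1" "(1 - l) *\<^sub>R x + l *\<^sub>R x' \<in> affine hull (X - {x})"
    by auto
  note ndX = nd[OF X(1)]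
  have "bary X ((1 - l) *\<^sub>R x + l *\<^sub>R x') x = 0"
    using l(3) X(2) in_affine_hull_bary[OF ndX, of "X - {x}"] by auto
  then have e: "(1 - l) + l * bary X x' x = 0"
    using bary_segment[OF ndX X(2)] bary_vertex[OF ndX X(2) X(2)] by simp
  then have neg: "bary X x' x < 0"
  proof -
    have "l * bary X x' x < 0" using e l by linarith
    then show ?thesis using l by (simp add: mult_less_0_iff)
  qed
  have "x' \<notin> X" 
    using neg bary_vertex[OF ndX _ X(2), of x'] by (auto split: if_splits)
  with x' neg that show ?thesis by blast
qed

definition containing :: "'a::euclidean_space set set \<Rightarrow> 'a \<Rightarrow> 'a set set" where
  "containing \<S> z = {X \<in> \<S>. z \<in> convex hull X}"

text \<open>Among the simplices \<open>H\<close> met by the segment, each one without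
  \<open>q\<close> is left through a facet, and the neighbour there is entered at that moment, so it
  misses \<open>p\<close>. This assignment is injective. Hence at most as many members of
  \<open>H\<close> miss \<open>q\<close> as miss \<open>p\<close>, and complements in
  \<open>H\<close> give the claim.\<close>

lemma card_containing_le:
  fixes \<S> :: "'a::euclidean_space set set"
  assumes fin: "finite \<S>" and nds: "\<forall>X\<in>\<S>. nondegenerate X"
    and m: "matched \<S> U" and U: "convex U" "p \<in> U" "q \<in> U"
    and p: "generic_for \<S> p" and q: "generic_for \<S> q" and g: "generic_segment \<S> p q"
  shows "card (containing \<S> p) \<le> card (containing \<S> q)"
proof -
  note nd = nds[THEN bspec]
  let ?z = "\<lambda>t. (1 - t) *\<^sub>R p + t *\<^sub>R q"
  define H where "H = {X \<in> \<S>. \<exists>t\<in>{0..1}. ?z t \<in> convex hull X}"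
  \<comment> \<open>\<open>x\<close> is the vertex opposite to the facet through which the segment
    enters \<open>X\<close>.\<close>
  define ent where "ent X x \<longleftrightarrow> X \<in> \<S> \<and> x \<in> X \<and> bary X q x > 0 \<and> bary X p x < 0 \<and>
     (\<exists>t\<in>{0<..<1}. ?z t \<in> convex hull (X - {x}))" for X x
  have zU: "?z t \<in> U" if "t \<in> {0..1}" for t
    using that U by (simp add: convexD_alt)
  \<comment> \<open>Both coordinates increase along the segment and each is nonnegative when the
    other vanishes, so the two entry times agree. Then two coordinates vanish together, against
    genericity.\<close>
  have ent_unique: "x = x'" if "ent X x" "ent X x'" for X x x'
  proof (rule ccontr)
    assume "x \<noteq> x'"
    obtain t where t: "t \<in> {0<..<1}" "?z t \<in> convex hull (X - {x})" using \<open>ent X x\<close> ent_def by auto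
    obtain t' where t': "t' \<in> {0<..<1}" "?z t' \<in> convex hull (X - {x'})" using \<open>ent X x'\<close> ent_def by auto
    have X: "nondegenerate X" "x \<in> X" "x' \<in> X" "X \<in> \<S>" using that nd by (auto simp: ent_def)
    have 1: "(1 - t) * bary X p x + t * bary X q x = 0" "0 \<le> (1 - t) * bary X p x' + t * bary X q x'"
      using t(2) X in_convex_hull_bary[OF X(1), of "X - {x}"] bary_segment[OF X(1)] by auto
    have 2: "(1 - t') * bary X p x' + t' * bary X q x' = 0" "0 \<le> (1 - t') * bary X p x + t' * bary X q x"
      using t'(2) X in_convex_hull_bary[OF X(1), of "X - {x'}"] bary_segment[OF X(1)] by auto
    have s: "bary X q x - bary X p x > 0" "bary X q x' - bary X p x' > 0"
      using that by (auto simp: ent_def)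
    have "(t - t') * (bary X q x - bary X p x) \<le> 0" using 1(1) 2(2) by (simp add: algebra_simps)
    then have "t \<le> t'" using s(1) by (simp add: mult_le_0_iff)
    have "(t' - t) * (bary X q x' - bary X p x') \<le> 0" using 1(2) 2(1) by (simp add: algebra_simps)
    then have "t' \<le> t" using s(2) by (simp add: mult_le_0_iff)
    with \<open>t \<le> t'\<close> have "t = t'" by simp
    then have "bary X (?z t) x = 0" "bary X (?z t) x' = 0"
      using 1(1) 2(1) X bary_segment[OF X(1)] by auto
    moreover have "t \<in> {0..1}" using t(1) by auto
    ultimately show False
      using g[unfolded generic_segment_def, rule_format, OF X(4,2,3) _ \<open>x \<noteq> x'\<close>] by blast
  qed
  have step: "\<exists>X'. \<exists>x\<in>X. \<exists>x'. X' = insert x' (X - {x}) \<and> ent X' x' \<and> bary X' x x' < 0"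
    if X: "X \<in> H" "q \<notin> convex hull X" for X
  proof -
    obtain s where s: "X \<in> \<S>" "s \<in> {0..1}" "?z s \<in> convex hull X" using X by (auto simp: H_def)
    obtain b x where b: "0 < b" "b < 1" "x \<in> X" "bary X q x < 0" "0 < bary X p x"
        "?z b \<in> convex hull (X - {x})"
      by (rule exit_facet[OF nds s(1) p q g s(2,3) X(2)])
    have zb: "?z b \<in> U" using zU b by auto
    obtain x' where x': "insert x' (X - {x}) \<in> \<S>" "x' \<notin> X" "bary X x' x < 0"
      by (rule matchedD[OF m nds s(1) b(3,6) zb])
    let ?X' = "insert x' (X - {x})"
    have bc: "bary X z x = bary ?X' z x' * bary X x' x" for z
      by (rule bary_change_vertex[OF nd[OF s(1)] nd[OF x'(1)] b(3)]) (use x'(2) in auto)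
    have "bary ?X' q x' > 0" "bary ?X' p x' < 0"
      using bc[of q] bc[of p] b(4,5) x'(3) by (auto simp: mult_less_0_iff zero_less_mult_iff)
    moreover have "?X' - {x'} = X - {x}" using x' by auto
    ultimately have "ent ?X' x'" using x' b unfolding ent_def by auto
    moreover have "bary ?X' x x' < 0"
    proof -
      have "0 < bary ?X' x x' * bary X x' x"
        using bc[of x] bary_vertex[OF nd[OF s(1)] b(3) b(3)] by simp
      then show ?thesis using x'(3) by (simp add: zero_less_mult_iff)
    qed
    ultimately show ?thesis using b by blast
  qed
  define f where "f X = (SOME X'. \<exists>x\<in>X. \<exists>x'. X' = insert x' (X - {x}) \<and> ent X' x' \<and> bary X' x x' < 0)" for X
  have f: "\<exists>x\<in>X. \<exists>x'. f X = insert x' (X - {x}) \<and> ent (f X) x' \<and> bary (f X) x x' < 0"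
    if "X \<in> H" "q \<notin> convex hull X" for X
    unfolding f_def by (rule someI_ex[OF step[OF that]])
  \<comment> \<open>The image simplex has a single entry facet, and matching allows only one other
    simplex on that facet.\<close>
  have "inj_on f {X \<in> H. q \<notin> convex hull X}"
  proof (rule inj_onI, clarsimp)
    fix X Y assume h: "X \<in> H" "Y \<in> H" "f X = f Y" "q \<notin> convex hull X" "q \<notin> convex hull Y"
    obtain x x' where x: "x \<in> X" "f X = insert x' (X - {x})" "ent (f X) x'" "bary (f X) x x' < 0"
      using f[OF h(1,4)] by blast
    obtain w w' where w: "w \<in> Y" "f Y = insert w' (Y - {w})" "ent (f Y) w'" "bary (f Y) w w' < 0"
      using f[OF h(2,5)] by blast
    have wx: "w' = x'" using ent_unique x(3) w(3) h(3) by auto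
    have fS: "f X \<in> \<S>" "x' \<in> f X" using x(3) by (auto simp: ent_def)
    have nf: "nondegenerate (f X)" using nd fS by blast
    have xn: "x' \<noteq> x" "x' \<noteq> w" using x(4) w(4) wx h(3) bary_vertex[OF nf fS(2) fS(2)] by auto
    have xnX: "x' \<notin> X - {x}"
    proof
      assume "x' \<in> X - {x}"
      then have "f X = X - {x}" using x(2) by auto
      then have "card (f X) < card X" 
        using x(1) h(1) nondegenerate_finite[OF nd] card_Diff1_less[of X x] by (auto simp: H_def)
      then show False using nf nd[of X] h(1) by (auto simp: H_def nondegenerate_def)
    qed
    have xnY: "x' \<notin> Y - {w}"
    proof
      assume "x' \<in> Y - {w}"
      then have "f Y = Y - {w}" using w(2) wx by auto
      then have "card (f Y) < card Y" 
        using w(1) h(2) nondegenerate_finite[OF nd] card_Diff1_less[of Y w] by (auto simp: H_def)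
      then show False using nf nd[of Y] h(2,3) by (auto simp: H_def nondegenerate_def)
    qed
    have F: "f X - {x'} = X - {x}" "f X - {x'} = Y - {w}" using x(2) w(2) wx h(3) xnX xnY by auto
    obtain t where t: "t \<in> {0<..<1}" "?z t \<in> convex hull (f X - {x'})" using x(3) by (auto simp: ent_def)
    have zt: "?z t \<in> U" using zU t(1) by auto
    obtain v where v: "\<And>x''. insert x'' (f X - {x'}) \<in> \<S> \<Longrightarrow> x'' = x' \<or> x'' = v"
      by (rule matchedD[OF m nds fS t(2) zt]) blast
    have X1: "insert x (f X - {x'}) = X" using F x(1) by auto
    have Y1: "insert w (f X - {x'}) = Y" using F w(1) by auto
    have "X \<in> \<S>" "Y \<in> \<S>" using h(1,2) by (auto simp: H_def)
    then have "x = v" "w = v" using v[of x] v[of w] X1 Y1 xn by argo+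
    then show "X = Y" using X1 Y1 by simp
  qed
  moreover have "f ` {X \<in> H. q \<notin> convex hull X} \<subseteq> {X \<in> H. p \<notin> convex hull X}"
  proof clarsimp
    fix X assume h: "X \<in> H" "q \<notin> convex hull X"
    then obtain x' where e: "ent (f X) x'" using f by blast
    then obtain t where t: "f X \<in> \<S>" "t \<in> {0<..<1}" "?z t \<in> convex hull (f X - {x'})"
      by (auto simp: ent_def)
    then have "?z t \<in> convex hull (f X)" using hull_mono[of "f X - {x'}" "f X"] by auto
    then have "f X \<in> H" using t by (auto simp: H_def intro!: bexI[of _ t])
    moreover have "p \<notin> convex hull (f X)"
      using e in_convex_hull_bary[OF nd[OF t(1)] order_refl, of p] by (fastforce simp: ent_def)
    ultimately show "f X \<in> H \<and> p \<notin> convex hull (f X)" by blast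
  qed
  moreover have fH: "finite H" using fin by (simp add: H_def)
  ultimately have le: "card {X \<in> H. q \<notin> convex hull X} \<le> card {X \<in> H. p \<notin> convex hull X}"
    by (intro card_inj_on_le) auto
  have "X \<in> H" if "X \<in> \<S>" "?z t \<in> convex hull X" "t \<in> {0..1}" for X t
    using that by (auto simp: H_def)
  from this[of _ 0] this[of _ 1] 
  have eqp: "containing \<S> p = H - {X \<in> H. p \<notin> convex hull X}"
    and eqq: "containing \<S> q = H - {X \<in> H. q \<notin> convex hull X}"
    by (auto simp: containing_def) (auto simp: H_def)
  have "card (containing \<S> p) = card H - card {X \<in> H. p \<notin> convex hull X}"
    unfolding eqp using fH by (intro card_Diff_subset) auto
  moreover have "card (containing \<S> q) = card H - card {X \<in> H. q \<notin> convex hull X}"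
    unfolding eqq using fH by (intro card_Diff_subset) auto
  ultimately show ?thesis using le by simp
qed

lemma bary_pos_interior:
  fixes X :: "'a::euclidean_space set"
  assumes X: "nondegenerate X" and pos: "\<And>x. x \<in> X \<Longrightarrow> 0 < bary X z x"
  shows "z \<in> interior (convex hull X)"
proof -
  have "z \<in> convex hull X"
    using in_convex_hull_bary[OF X order_refl, of z] pos by (simp add: less_imp_le)
  moreover have "z \<notin> convex hull (X - {a})" if "a \<in> X" for a
    using in_convex_hull_bary[OF X, of "X - {a}" z] pos[OF that] that by auto
  then have "z \<notin> frontier (convex hull X)"
    using frontier_of_convex_hull[of X] X by (auto simp: nondegenerate_def)
  ultimately show ?thesis using closure_subset by (auto simp: frontier_def)
qed

text \<open>Genericity keeps \<open>q\<close> off all facet hyperplanes, so \<open>q\<close> is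
  interior to every simplex that contains it; the remaining simplices are closed and miss
  it.\<close>

lemma containing_nhd:
  fixes \<S> :: "'a::euclidean_space set set"
  assumes fin: "finite \<S>" and nds: "\<forall>X\<in>\<S>. nondegenerate X" and q: "generic_for \<S> q"
  obtains V where "open V" "q \<in> V" "\<And>z. z \<in> V \<Longrightarrow> containing \<S> z = containing \<S> q"
proof -
  note nd = nds[THEN bspec]
  let ?V = "(\<Inter>X\<in>containing \<S> q. interior (convex hull X)) \<inter> (\<Inter>X\<in>\<S> - containing \<S> q. - (convex hull X))"
  have fX: "finite X" if "X \<in> \<S>" for X using nd that nondegenerate_finite by blast
  have "open ?V"
    using fin fX by (intro open_Int open_INT finite_Diff ballI open_Compl)
      (auto simp: containing_def intro: compact_imp_closed finite_imp_compact_convex_hull)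
  moreover have "q \<in> interior (convex hull X)" if "X \<in> containing \<S> q" for X
  proof -
    have X: "X \<in> \<S>" "nondegenerate X" "q \<in> convex hull X" using that nd by (auto simp: containing_def)
    have "0 < bary X q x" if "x \<in> X" for x
      using q that X in_convex_hull_bary[OF X(2) order_refl, of q]
      by (auto simp: generic_for_def less_le)
    then show ?thesis by (rule bary_pos_interior[OF X(2)])
  qed
  then have "q \<in> ?V" by (auto simp: containing_def)
  moreover have "containing \<S> z = containing \<S> q" if "z \<in> ?V" for z
    using that interior_subset by (auto simp: containing_def)
  ultimately show ?thesis using that by blast
qed

text \<open>The segment from \<open>p\<close> to \<open>q\<close> itself may fail to be generic, so
  it is aimed at a point \<open>q'\<close> close to \<open>q\<close> with the same count. Reversing
  the segment gives the opposite inequality.\<close>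

lemma card_containing_const:
  fixes \<S> :: "'a::euclidean_space set set"
  assumes fin: "finite \<S>" and nds: "\<forall>X\<in>\<S>. nondegenerate X"
    and m: "matched \<S> U" and U: "convex U" "open U" "p \<in> U" "q \<in> U"
    and p: "generic_for \<S> p" and q: "generic_for \<S> q"
  shows "card (containing \<S> p) = card (containing \<S> q)"
proof -
  note nd = nds[THEN bspec]
  obtain V where V: "open V" "q \<in> V" "\<And>z. z \<in> V \<Longrightarrow> containing \<S> z = containing \<S> q"
    using containing_nhd[OF fin nds q] by blast
  have UV: "open (U \<inter> V)" "U \<inter> V \<noteq> {}" using U V by auto
  obtain q' where q': "q' \<in> U \<inter> V" "generic_for \<S> q'" "generic_segment \<S> p q'"
    by (rule generic_segment_exists[OF fin nds p UV])
  have "card (containing \<S> p) = card (containing \<S> q')"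
    using card_containing_le[OF fin nds m U(1,3) _ p q'(2,3)]
      card_containing_le[OF fin nds m U(1) _ U(3) q'(2) p generic_segment_sym[OF q'(3)]] q'(1)
    by force
  then show ?thesis using V(3) q'(1) by auto
qed


section \<open>Carriers, covering and common faces\<close>

lemma bary_common_face:
  assumes X: "nondegenerate X" and X': "nondegenerate X'" and Y: "Y \<subseteq> X" "Y \<subseteq> X'"
    and q: "q \<in> convex hull Y" and v: "v \<in> Y"
  shows "bary X q v = bary X' q v"
proof -
  have fX: "finite X" "finite Y" using nondegenerate_finite[OF X] Y finite_subset by auto
  have 0: "\<forall>x\<in>X' - Y. bary X' q x = 0" using in_convex_hull_bary[OF X' Y(2)] q by blast
  let ?u = "\<lambda>x. if x \<in> Y then bary X' q x else 0"
  have "sum (bary X' q) Y = 1"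
    using bary_sum[OF X', of q] 0 nondegenerate_finite[OF X']
    by (subst sum.mono_neutral_left[OF _ Y(2)]) auto
  then have "sum ?u X = 1" using Y fX by (simp add: sum.If_cases Int_absorb1)
  moreover have "(\<Sum>x\<in>Y. bary X' q x *\<^sub>R x) = q"
    using bary_combination[OF X', of q] 0 nondegenerate_finite[OF X']
    by (subst sum.mono_neutral_left[OF _ Y(2)]) auto
  then have "(\<Sum>x\<in>X. ?u x *\<^sub>R x) = q"
    by (subst sum.mono_neutral_cong_right[OF fX(1) Y(1)]) auto
  ultimately show ?thesis using bary_unique[OF X, of ?u q v] v Y by auto
qed

text \<open>For \<open>q\<close> in the hull of \<open>X\<close>, the vertex set of the smallest
  face containing \<open>q\<close>.\<close>

definition carrier_of :: "'a::euclidean_space set \<Rightarrow> 'a \<Rightarrow> 'a set" where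
  "carrier_of X q = {x \<in> X. bary X q x \<noteq> 0}"

lemma interior_simplex_dense:
  fixes X :: "'a::euclidean_space set"
  assumes X: "nondegenerate X" and q: "q \<in> convex hull X" and e: "0 < e"
  shows "ball q e \<inter> interior (convex hull X) \<noteq> {}"
proof -
  have "aff_dim (convex hull X) = int DIM('a)"
    using X aff_dim_affine_independent[of X] by (simp add: nondegenerate_def aff_dim_convex_hull)
  then have "interior (convex hull X) \<noteq> {}"
    using rel_interior_eq_empty[of "convex hull X"] q interior_rel_interior_gen[of "convex hull X"] by auto
  then have "closure (interior (convex hull X)) = closure (convex hull X)"
    by (intro convex_closure_interior) auto
  then have "q \<in> closure (interior (convex hull X))" using q closure_subset by auto
  then obtain z where "z \<in> interior (convex hull X)" "dist z q < e"
    using e by (auto simp: closure_approachable)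
  then show ?thesis by (auto simp: dist_commute)
qed

text \<open>The point \<open>z\<^sub>0\<close> calibrates the count: it lies inside one simplex and
  outside all other closed ones, so generic points near it have multiplicity one.\<close>

locale matched_simplices =
  fixes \<S> :: "'a::euclidean_space set set" and P :: "'a set" and X\<^sub>0 :: "'a set" and z\<^sub>0 :: 'a
  assumes fin: "finite \<S>" and nds: "\<forall>X\<in>\<S>. nondegenerate X"
    and P: "compact P" "convex P" and sub: "\<And>X. X \<in> \<S> \<Longrightarrow> convex hull X \<subseteq> P"
    and m: "matched \<S> (interior P)"
    and X0: "X\<^sub>0 \<in> \<S>" and z0: "z\<^sub>0 \<in> interior (convex hull X\<^sub>0)"
    and z0_unique: "\<And>X. X \<in> \<S> \<Longrightarrow> z\<^sub>0 \<in> convex hull X \<Longrightarrow> X = X\<^sub>0"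
begin

lemma closed_hull: "X \<in> \<S> \<Longrightarrow> Y \<subseteq> X \<Longrightarrow> closed (convex hull Y)"
  using nds nondegenerate_finite finite_subset
  by (blast intro: compact_imp_closed finite_imp_compact_convex_hull)

lemma card_containing:
  assumes q: "generic_for \<S> q" "q \<in> interior P"
  shows "card (containing \<S> q) = 1"
proof -
  let ?W = "interior (convex hull X\<^sub>0) \<inter> (\<Inter>X\<in>\<S> - {X\<^sub>0}. - (convex hull X))"
  have W: "open ?W" using fin closed_hull by (intro open_Int open_INT ballI open_Compl) auto
  have "z\<^sub>0 \<in> ?W" using z0 z0_unique by blast
  then have Wn: "?W \<noteq> {}" by blast
  obtain p where p: "p \<in> ?W" "generic_for \<S> p" by (rule generic_exists[OF fin nds W Wn])
  have "containing \<S> p = {X\<^sub>0}" using p X0 interior_subset by (auto simp: containing_def)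
  moreover have "p \<in> interior P" using p(1) interior_mono[OF sub[OF X0]] by blast
  moreover have "convex (interior P)" using P(2) by (rule convex_interior)
  ultimately show ?thesis
    using card_containing_const[OF fin nds m _ open_interior q(2) _ q(1) p(2)] by simp
qed

lemma covers: "(\<Union>X\<in>\<S>. convex hull X) = P"
proof
  show "(\<Union>X\<in>\<S>. convex hull X) \<subseteq> P" using sub by blast
  have cl: "closed (\<Union>X\<in>\<S>. convex hull X)" using fin closed_hull by (intro closed_UN) auto
  have int: "interior P \<subseteq> (\<Union>X\<in>\<S>. convex hull X)"
  proof (rule ccontr)
    assume n: "\<not> ?thesis"
    have o: "open (interior P - (\<Union>X\<in>\<S>. convex hull X))" using cl by (intro open_Diff) auto
    have ne: "interior P - (\<Union>X\<in>\<S>. convex hull X) \<noteq> {}" using n by blast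
    obtain q where q: "q \<in> interior P - (\<Union>X\<in>\<S>. convex hull X)" "generic_for \<S> q"
      by (rule generic_exists[OF fin nds o ne])
    then have "containing \<S> q = {}" by (auto simp: containing_def)
    then show False using card_containing[OF q(2)] q(1) by simp
  qed
  have "interior P \<noteq> {}" using z0 interior_mono[OF sub[OF X0]] by blast
  then have "P = closure (interior P)"
    using P convex_closure_interior closure_closed compact_imp_closed by metis
  also have "\<dots> \<subseteq> (\<Union>X\<in>\<S>. convex hull X)" using int cl by (rule closure_minimal)
  finally show "P \<subseteq> (\<Union>X\<in>\<S>. convex hull X)" .
qed

text \<open>In a small ball around \<open>q\<close> the family \<open>\<C>\<close> of simplices
  giving \<open>q\<close> the same carrier as \<open>X\<close> is matched by itself, so its
  multiplicity is constant there. It is positive at points of \<open>X\<close> near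
  \<open>q\<close>, hence also at a generic point of \<open>Y\<close> near \<open>q\<close>. Only
  one simplex of \<open>\<S>\<close> contains that point, so it is \<open>Y\<close>, and
  \<open>Y\<close> belongs to \<open>\<C>\<close>.\<close>

lemma carrier_of_eq:
  assumes X: "X \<in> \<S>" "q \<in> convex hull X" and Y: "Y \<in> \<S>" "q \<in> convex hull Y"
  shows "carrier_of Y q = carrier_of X q"
proof -
  define \<C> where "\<C> = {Z \<in> \<S>. q \<in> convex hull Z \<and> carrier_of Z q = carrier_of X q}"
  have CS: "\<C> \<subseteq> \<S>" by (auto simp: \<C>_def)
  \<comment> \<open>All faces missing \<open>q\<close>; the ball chosen below avoids them.\<close>
  define \<F> where "\<F> = {Y. \<exists>Z\<in>\<S>. Y \<subseteq> Z \<and> q \<notin> convex hull Y}"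
  have "finite (\<Union>Z\<in>\<S>. Pow Z)" using fin nds nondegenerate_finite by auto
  then have fF: "finite \<F>" by (rule rev_finite_subset) (auto simp: \<F>_def)
  have "open (\<Inter>Y\<in>\<F>. - (convex hull Y))"
    using fF closed_hull by (intro open_INT ballI open_Compl) (auto simp: \<F>_def)
  moreover have "q \<in> (\<Inter>Y\<in>\<F>. - (convex hull Y))" by (auto simp: \<F>_def)
  ultimately obtain e where e: "e > 0" "ball q e \<subseteq> (\<Inter>Y\<in>\<F>. - (convex hull Y))"
    using open_contains_ball by blast
  let ?U = "ball q e \<inter> interior P"
  have U: "convex ?U" "open ?U" using P(2) by (auto intro: convex_Int convex_interior)
  have near: "\<exists>p\<in>?U \<inter> convex hull Z. generic_for \<S> p" if Z: "Z \<in> \<S>" "q \<in> convex hull Z" for Z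
  proof -
    have ne: "ball q e \<inter> interior (convex hull Z) \<noteq> {}"
      using interior_simplex_dense[of Z q e] Z nds e by blast
    obtain p where "p \<in> ball q e \<inter> interior (convex hull Z)" "generic_for \<S> p"
      by (rule generic_exists[OF fin nds _ ne]) auto
    then show ?thesis using interior_mono[OF sub[OF Z(1)]] interior_subset by blast
  qed
  have mC: "matched \<C> ?U"
    unfolding matched_def
  proof (intro ballI impI)
    fix Z z assume Z: "Z \<in> \<C>" "z \<in> Z" "convex hull (Z - {z}) \<inter> ?U \<noteq> {}"
    then have ZS: "Z \<in> \<S>" and ne: "convex hull (Z - {z}) \<inter> interior P \<noteq> {}" using CS by blast+
    from m[unfolded matched_def, rule_format, OF ZS Z(2) ne]
    obtain z' where z': "insert z' (Z - {z}) \<in> \<S>"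
       "\<exists>l\<in>{0<..<1}. (1 - l) *\<^sub>R z + l *\<^sub>R z' \<in> affine hull (Z - {z})"
       "\<forall>z''. insert z'' (Z - {z}) \<in> \<S> \<longrightarrow> z'' = z \<or> z'' = z'" by blast
    \<comment> \<open>A facet that reaches the ball must contain \<open>q\<close>, so the carrier of
      \<open>q\<close> lies in the facet and is inherited by the neighbour.\<close>
    have "Z - {z} \<notin> \<F>" using Z(3) e(2) by blast
    then have q: "q \<in> convex hull (Z - {z})" using ZS by (auto simp: \<F>_def)
    let ?Z' = "insert z' (Z - {z})"
    have nZ: "nondegenerate Z" "nondegenerate ?Z'" using ZS z'(1) nds by blast+
    have sub: "Z - {z} \<subseteq> Z" "Z - {z} \<subseteq> ?Z'" by auto
    have "z' \<notin> Z - {z}"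
    proof
      assume "z' \<in> Z - {z}"
      then have "?Z' = Z - {z}" by auto
      moreover have "card (Z - {z}) < card Z"
        using nondegenerate_finite[OF nZ(1)] Z(2) by (rule card_Diff1_less)
      ultimately show False using nZ by (simp add: nondegenerate_def)
    qed
    then have "bary ?Z' q z' = 0" "bary Z q z = 0"
      using in_convex_hull_bary[OF nZ(1) sub(1), of q] in_convex_hull_bary[OF nZ(2) sub(2), of q] q Z(2)
      by blast+
    then have "carrier_of ?Z' q = {v \<in> Z - {z}. bary ?Z' q v \<noteq> 0}"
       "carrier_of Z q = {v \<in> Z - {z}. bary Z q v \<noteq> 0}" by (auto simp: carrier_of_def)
    then have "carrier_of ?Z' q = carrier_of Z q" 
      using bary_common_face[OF nZ sub q] by auto
    moreover have "q \<in> convex hull ?Z'" using q hull_mono[OF sub(2)] by blast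
    ultimately have "?Z' \<in> \<C>" using Z(1) z'(1) by (auto simp: \<C>_def)
    then show "\<exists>x'. insert x' (Z - {z}) \<in> \<C> \<and>
        (\<exists>l\<in>{0<..<1}. (1 - l) *\<^sub>R z + l *\<^sub>R x' \<in> affine hull (Z - {z})) \<and>
        (\<forall>x''. insert x'' (Z - {z}) \<in> \<C> \<longrightarrow> x'' = z \<or> x'' = x')"
      using z' CS by blast
  qed
  obtain p where p: "p \<in> ?U" "p \<in> convex hull X" "generic_for \<S> p" using near[OF X] by blast
  obtain p' where p': "p' \<in> ?U" "p' \<in> convex hull Y" "generic_for \<S> p'" using near[OF Y] by blast
  have gC: "generic_for \<C> p" "generic_for \<C> p'" using p(3) p'(3) CS by (auto simp: generic_for_def)
  have fC: "finite \<C>" "\<forall>X\<in>\<C>. nondegenerate X" using CS fin nds finite_subset by blast+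
  have "X \<in> containing \<C> p" using X p by (auto simp: containing_def \<C>_def)
  then have "card (containing \<C> p) > 0" using fC(1) by (auto simp: card_gt_0_iff containing_def)
  then have "card (containing \<C> p') > 0"
    using card_containing_const[OF fC mC U p(1) p'(1) gC] by simp
  then obtain Z where Z: "Z \<in> \<C>" "p' \<in> convex hull Z"
    by (auto simp: card_gt_0_iff containing_def)
  have "card (containing \<S> p') = 1" using card_containing[OF p'(3)] p'(1) by simp
  moreover have "Y \<in> containing \<S> p'" "Z \<in> containing \<S> p'"
    using Y Z CS p' by (auto simp: containing_def)
  ultimately have "Y = Z" by (auto simp: card_1_singleton_iff)
  then show ?thesis using Z(1) by (simp add: \<C>_def)
qed

text \<open>The carrier of a common point is the same in both simplices, hence contained in both
  vertex sets.\<close>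

lemma hull_Int: 
  assumes X: "X \<in> \<S>" and Y: "Y \<in> \<S>"
  shows "convex hull X \<inter> convex hull Y = convex hull (X \<inter> Y)"
proof
  show "convex hull (X \<inter> Y) \<subseteq> convex hull X \<inter> convex hull Y" by (simp add: hull_mono)
  show "convex hull X \<inter> convex hull Y \<subseteq> convex hull (X \<inter> Y)"
  proof
    fix q assume q: "q \<in> convex hull X \<inter> convex hull Y"
    then have "carrier_of X q \<subseteq> Y" using carrier_of_eq[OF X _ Y] by (auto simp: carrier_of_def)
    then have "\<forall>x\<in>X - X \<inter> Y. bary X q x = 0" by (auto simp: carrier_of_def)
    moreover have "nondegenerate X" using X nds by blast
    ultimately show "q \<in> convex hull (X \<inter> Y)"
      using q in_convex_hull_bary[of X X q] in_convex_hull_bary[of X "X \<inter> Y" q] by auto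
  qed
qed

lemma triangulates: "triangulation ((hull) convex ` \<S>)"
  unfolding triangulation_def
proof (intro conjI ballI allI impI)
  show "finite ((hull) convex ` \<S>)" using fin by simp
  show "\<exists>n. n simplex T" if "T \<in> (hull) convex ` \<S>" for T
    using that nds by (auto simp: simplex_def nondegenerate_def intro!: exI[of _ "int DIM('a)"])
  fix T T' assume "T \<in> (hull) convex ` \<S> \<and> T' \<in> (hull) convex ` \<S>"
  then obtain X Y where X: "X \<in> \<S>" "T = convex hull X" and Y: "Y \<in> \<S>" "T' = convex hull Y" by blast
  have "\<not> affine_dependent X" using X nds by (simp add: nondegenerate_def)
  then show "T \<inter> T' face_of T"
    using X Y hull_Int[OF X(1) Y(1)] face_of_convex_hull_affine_independent[of X "convex hull (X \<inter> Y)"]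
    by auto
qed

end

section \<open>Reflections\<close>

lemma reflect_unit: "norm a = 1 \<Longrightarrow> reflect a x = x - (2 * (a \<bullet> x)) *\<^sub>R a"
  by (simp add: reflect_def dot_square_norm)

lemma reflect_scale: "k \<noteq> 0 \<Longrightarrow> reflect (k *\<^sub>R a) = reflect a"
  by (rule ext) (simp add: reflect_def field_simps)

lemma reflect_minus: "reflect (- a) = reflect a"
  by (rule ext) (simp add: reflect_def)

lemma reflect_self: "a \<noteq> 0 \<Longrightarrow> reflect a a = - a"
  by (simp add: reflect_def scaleR_2)

lemma reflect_fixed_iff: "a \<noteq> 0 \<Longrightarrow> reflect a x = x \<longleftrightarrow> a \<bullet> x = 0"
  by (simp add: reflect_def)

lemma linear_reflect: "linear (reflect a)"
  by (rule linearI) (simp_all add: reflect_def inner_add_right inner_scaleR_right algebra_simps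
      add_divide_distrib)

lemma reflect_reflect: "reflect a (reflect a x) = x"
  by (cases "a = 0") (simp_all add: reflect_def inner_diff_right)

lemma reflect_inner: "reflect a x \<bullet> z = x \<bullet> reflect a z"
  by (simp add: reflect_def inner_diff_left inner_diff_right inner_commute)

lemma orthogonal_transformation_reflect: "orthogonal_transformation (reflect a)"
  by (simp add: orthogonal_transformation_def linear_reflect reflect_inner reflect_reflect)

lemma orthogonal_reflect:
  assumes "orthogonal_transformation f"
  shows "f (reflect a x) = reflect (f a) (f x)"
  using assms orthogonal_transformation_linear[OF assms]
  by (simp add: reflect_def linear_diff linear_scale orthogonal_transformation_def)

lemma reflect_eq_iff:
  assumes "norm a = 1" "norm b = 1" "reflect a = reflect b"
  shows "a = b \<or> a = - b"
proof -
  have "a \<noteq> 0" using assms(1) by auto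
  then have "reflect b a = - a" using assms(3) reflect_self[of a] by simp
  then have "2 *\<^sub>R a = 2 *\<^sub>R ((b \<bullet> a) *\<^sub>R b)"
    using assms(2) by (simp add: reflect_unit algebra_simps scaleR_2)
  then have a: "a = (b \<bullet> a) *\<^sub>R b" by (simp only: scaleR_cancel_left) simp
  then have "\<bar>b \<bullet> a\<bar> = 1" using assms by (metis mult.right_neutral norm_scaleR)
  then have "b \<bullet> a = 1 \<or> b \<bullet> a = - 1" by linarith
  then show ?thesis
  proof
    assume "b \<bullet> a = 1"
    then show ?thesis using a by simp
  next
    assume "b \<bullet> a = - 1"
    then have "a = (- 1) *\<^sub>R b" using a by metis
    then show ?thesis by simp
  qed
qed

section \<open>Simple systems in a set of positive roots\<close>

definition nonneg_comb :: "'v::real_vector set \<Rightarrow> 'v \<Rightarrow> bool" where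
  "nonneg_comb D v \<longleftrightarrow> (\<exists>c. (\<forall>d\<in>D. 0 \<le> c d) \<and> v = (\<Sum>d\<in>D. c d *\<^sub>R d))"

lemma nonneg_comb_remove:
  assumes D: "finite D" "b \<in> D" and b: "nonneg_comb (D - {b}) b" and v: "nonneg_comb D v"
  shows "nonneg_comb (D - {b}) v"
proof -
  obtain e where e: "\<forall>d\<in>D - {b}. 0 \<le> e d" "b = (\<Sum>d\<in>D - {b}. e d *\<^sub>R d)"
    using b by (auto simp: nonneg_comb_def)
  obtain c where c: "\<forall>d\<in>D. 0 \<le> c d" "v = (\<Sum>d\<in>D. c d *\<^sub>R d)"
    using v by (auto simp: nonneg_comb_def)
  have "v = c b *\<^sub>R b + (\<Sum>d\<in>D - {b}. c d *\<^sub>R d)" using c D by (simp add: sum.remove)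
  also have "\<dots> = c b *\<^sub>R (\<Sum>d\<in>D - {b}. e d *\<^sub>R d) + (\<Sum>d\<in>D - {b}. c d *\<^sub>R d)" using e(2) by simp
  also have "\<dots> = (\<Sum>d\<in>D - {b}. (c b * e d + c d) *\<^sub>R d)"
    by (simp add: scaleR_sum_right sum.distrib scaleR_left_distrib)
  finally show ?thesis using c(1) e(1) D(2) unfolding nonneg_comb_def
    by (intro exI[of _ "\<lambda>d. c b * e d + c d"]) auto
qed

lemma dual_basis_exists:
  fixes D :: "'v::euclidean_space set"
  assumes "independent D" "span D = UNIV"
  shows "\<exists>\<omega>. (\<forall>d\<in>D. \<forall>e\<in>D. \<omega> d \<bullet> e = (if d = e then 1 else 0)) \<and>
    (\<forall>v. v = (\<Sum>d\<in>D. (\<omega> d \<bullet> v) *\<^sub>R d))"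
proof (intro exI conjI ballI allI)
  \<comment> \<open>The adjoint of a linear functional, evaluated at 1, is the vector representing
    it. For a basis of simple roots these vectors are the fundamental coweights.\<close>
  let ?\<omega> = "\<lambda>d. adjoint (\<lambda>v. representation D v d) 1"
  have lin: "linear (\<lambda>v. representation D v d)" for d
    using assms by (intro linearI) (simp_all add: representation_add representation_scale)
  have \<omega>: "?\<omega> d \<bullet> v = representation D v d" for d v
    using adjoint_works[OF lin, of v d 1] by (simp add: inner_commute)
  show "?\<omega> d \<bullet> e = (if d = e then 1 else 0)" if "d \<in> D" "e \<in> D" for d e
    using that assms by (simp add: \<omega> representation_basis)
  show "v = (\<Sum>d\<in>D. (?\<omega> d \<bullet> v) *\<^sub>R d)" for v
    unfolding \<omega> using assms by (simp add: sum_representation_eq independent_imp_finite)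
qed

text \<open>A smallest subset generating the same cone as \<open>\<Phi>\<close> works: minimality
  forces pairwise obtuse angles, and pairwise obtuse vectors on one side of a hyperplane are
  independent.\<close>

lemma simple_system_exists:
  fixes \<Phi> :: "'v::euclidean_space set"
  assumes fin: "finite \<Phi>" and pos: "\<And>a. a \<in> \<Phi> \<Longrightarrow> 0 < a \<bullet> y" and unit: "\<And>a. a \<in> \<Phi> \<Longrightarrow> norm a = 1"
    and refl: "\<And>a b. a \<in> \<Phi> \<Longrightarrow> b \<in> \<Phi> \<Longrightarrow> reflect a b \<in> \<Phi> \<or> - reflect a b \<in> \<Phi>"
    and ess: "\<And>x. (\<And>a. a \<in> \<Phi> \<Longrightarrow> a \<bullet> x = 0) \<Longrightarrow> x = 0"
  obtains \<Delta> \<omega> where "\<Delta> \<subseteq> \<Phi>" "card \<Delta> = DIM('v)"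
    "\<And>d e. d \<in> \<Delta> \<Longrightarrow> e \<in> \<Delta> \<Longrightarrow> \<omega> d \<bullet> e = (if d = e then 1 else 0)"
    "\<And>v. v = (\<Sum>d\<in>\<Delta>. (\<omega> d \<bullet> v) *\<^sub>R d)"
    "\<And>a d. a \<in> \<Phi> \<Longrightarrow> d \<in> \<Delta> \<Longrightarrow> 0 \<le> \<omega> d \<bullet> a"
proof -
  let ?P = "\<lambda>D. D \<subseteq> \<Phi> \<and> (\<forall>a\<in>\<Phi>. nonneg_comb D a)"
  have "nonneg_comb \<Phi> a" if "a \<in> \<Phi>" for a
  proof -
    have "a = (\<Sum>d\<in>\<Phi>. if d = a then d else 0)" using that fin by (simp add: sum.delta')
    also have "\<dots> = (\<Sum>d\<in>\<Phi>. (if d = a then 1 else 0) *\<^sub>R d)" by (rule sum.cong) auto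
    finally show ?thesis unfolding nonneg_comb_def
      by (intro exI[of _ "\<lambda>d. if d = a then 1 else 0"]) auto
  qed
  then have "?P \<Phi>" by blast
  then obtain \<Delta> where \<Delta>: "?P \<Delta>" and min: "\<And>D. ?P D \<Longrightarrow> card \<Delta> \<le> card D"
    using ex_has_least_nat[of ?P \<Phi> card] by blast
  have f\<Delta>: "finite \<Delta>" using \<Delta> fin finite_subset by blast
  have irred: "\<not> nonneg_comb (\<Delta> - {b}) b" if b: "b \<in> \<Delta>" for b
  proof
    assume "nonneg_comb (\<Delta> - {b}) b"
    then have "?P (\<Delta> - {b})" using \<Delta> nonneg_comb_remove[OF f\<Delta> b] by blast
    from min[OF this] card_Diff1_less[OF f\<Delta> b] show False by simp
  qed
  \<comment> \<open>Moving the \<open>b\<close> term to the left, either its coefficient is positive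
    and \<open>b\<close> is redundant in \<open>\<Delta>\<close>, or pairing with \<open>y\<close>
    equates a nonpositive number with a positive one.\<close>
  have contra: False
    if b: "b \<in> \<Delta>" and e: "\<And>d. d \<in> \<Delta> \<Longrightarrow> 0 \<le> e d" and d0: "d0 \<in> \<Delta>" "d0 \<noteq> b" "0 < e d0"
      and eq: "s *\<^sub>R b = (\<Sum>d\<in>\<Delta>. e d *\<^sub>R d)" for b e d0 and s :: real
  proof -
    have eq': "(s - e b) *\<^sub>R b = (\<Sum>d\<in>\<Delta> - {b}. e d *\<^sub>R d)"
      using eq sum.remove[OF f\<Delta> b, of "\<lambda>d. e d *\<^sub>R d"] by (simp add: algebra_simps)
    show False
    proof (cases "s - e b > 0")
      case True
      have "b = (1 / (s - e b)) *\<^sub>R ((s - e b) *\<^sub>R b)" using True by simp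
      also have "\<dots> = (\<Sum>d\<in>\<Delta> - {b}. (e d / (s - e b)) *\<^sub>R d)"
        unfolding eq' by (simp add: scaleR_sum_right)
      finally have "nonneg_comb (\<Delta> - {b}) b" unfolding nonneg_comb_def
        using e True by (intro exI[of _ "\<lambda>d. e d / (s - e b)"]) auto
      then show False using irred[OF b] by blast
    next
      case False
      have p: "0 < d \<bullet> y" if "d \<in> \<Delta>" for d using pos \<Delta> that by blast
      have "0 < (\<Sum>d\<in>\<Delta> - {b}. e d * (d \<bullet> y))"
        using d0 e p f\<Delta> by (intro sum_pos2[of _ d0] mult_nonneg_nonneg) (auto simp: less_imp_le)
      also have "\<dots> = (s - e b) * (b \<bullet> y)"
        using arg_cong[OF eq', of "\<lambda>v. v \<bullet> y"] by (simp add: inner_sum_left)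
      also have "\<dots> \<le> 0" using False pos b \<Delta> by (intro mult_nonpos_nonneg) (auto intro: less_imp_le)
      finally show False by simp
    qed
  qed
  \<comment> \<open>With a positive inner product, one of \<open>b - k a\<close> and
    \<open>k a - b\<close> would be a positive root; its expansion writes \<open>b\<close> or a
    multiple of \<open>a\<close> in the way excluded by \<open>contra\<close>.\<close>
  have obtuse: "a \<bullet> b \<le> 0" if ab: "a \<in> \<Delta>" "b \<in> \<Delta>" "a \<noteq> b" for a b
  proof (rule ccontr)
    assume "\<not> a \<bullet> b \<le> 0"
    define k where "k = 2 * (a \<bullet> b)"
    have k: "k > 0" using \<open>\<not> a \<bullet> b \<le> 0\<close> by (simp add: k_def)
    have r: "reflect a b = b - k *\<^sub>R a" using unit ab \<Delta> by (simp add: reflect_unit k_def subset_eq)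
    have delta: "(\<Sum>d\<in>\<Delta>. (if d = z then q else 0) *\<^sub>R d) = q *\<^sub>R z" if "z \<in> \<Delta>" for z q
    proof -
      have "(\<Sum>d\<in>\<Delta>. (if d = z then q else 0) *\<^sub>R d) = (\<Sum>d\<in>\<Delta>. if d = z then q *\<^sub>R d else 0)"
        by (rule sum.cong) auto
      then show ?thesis using that f\<Delta> by (simp add: sum.delta')
    qed
    consider "reflect a b \<in> \<Phi>" | "- reflect a b \<in> \<Phi>" using refl ab \<Delta> by blast
    then show False
    proof cases
      case 1
      then obtain c where c: "\<forall>d\<in>\<Delta>. 0 \<le> c d" "b - k *\<^sub>R a = (\<Sum>d\<in>\<Delta>. c d *\<^sub>R d)"
        using \<Delta> r unfolding nonneg_comb_def by metis
      have "1 *\<^sub>R b = (\<Sum>d\<in>\<Delta>. (c d + (if d = a then k else 0)) *\<^sub>R d)"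
        using c(2) delta[OF ab(1), of k] by (simp add: scaleR_left_distrib sum.distrib algebra_simps)
      then show False
        using contra[OF ab(2), of "\<lambda>d. c d + (if d = a then k else 0)" a 1] c(1) k ab
        by (auto simp: add_nonneg_pos)
    next
      case 2
      then obtain c where c: "\<forall>d\<in>\<Delta>. 0 \<le> c d" "k *\<^sub>R a - b = (\<Sum>d\<in>\<Delta>. c d *\<^sub>R d)"
        using \<Delta> r unfolding nonneg_comb_def by (metis minus_diff_eq)
      have "k *\<^sub>R a = (\<Sum>d\<in>\<Delta>. (c d + (if d = b then 1 else 0)) *\<^sub>R d)"
        using c(2) delta[OF ab(2), of 1] by (simp add: scaleR_left_distrib sum.distrib algebra_simps)
      then show False
        using contra[OF ab(1), of "\<lambda>d. c d + (if d = b then 1 else 0)" b k] c(1) k ab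
        by (auto simp: add_nonneg_pos)
    qed
  qed
  \<comment> \<open>The positive part \<open>v\<close> of a dependency is minus its remaining part.
    Obtuse angles make \<open>v \<bullet> v\<close> nonpositive, so \<open>v = 0\<close>, although
    \<open>v \<bullet> y\<close> is positive.\<close>
  have nopos: "c d \<le> 0" if c: "(\<Sum>d\<in>\<Delta>. c d *\<^sub>R d) = 0" and d: "d \<in> \<Delta>" for c d
  proof (rule ccontr)
    assume "\<not> c d \<le> 0"
    let ?p = "{d\<in>\<Delta>. c d > 0}" let ?n = "{d\<in>\<Delta>. \<not> c d > 0}"
    define v where "v = (\<Sum>d\<in>?p. c d *\<^sub>R d)"
    have v': "v = - (\<Sum>d\<in>?n. c d *\<^sub>R d)"
    proof -
      have "(\<Sum>d\<in>\<Delta>. c d *\<^sub>R d) = v + (\<Sum>d\<in>?n. c d *\<^sub>R d)"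
        unfolding v_def using f\<Delta> by (subst sum.union_disjoint[symmetric]) (auto intro: sum.cong)
      then show ?thesis using c by (simp add: eq_neg_iff_add_eq_0)
    qed
    have "v \<bullet> v = v \<bullet> (- (\<Sum>d\<in>?n. c d *\<^sub>R d))" using v' by simp
    also have "\<dots> = (\<Sum>e\<in>?p. c e * (e \<bullet> (- (\<Sum>d\<in>?n. c d *\<^sub>R d))))"
      unfolding v_def inner_sum_left inner_scaleR_left ..
    also have "\<dots> = (\<Sum>e\<in>?p. \<Sum>d\<in>?n. - (c e * c d) * (e \<bullet> d))"
      by (simp add: inner_sum_right sum_distrib_left sum_negf mult.assoc)
    also have "\<dots> \<le> 0"
    proof (intro sum_nonpos)
      fix e d assume "e \<in> ?p" "d \<in> ?n"
      then have "e \<bullet> d \<le> 0" "c e * c d \<le> 0" using obtuse by (auto simp: mult_nonneg_nonpos)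
      then show "- (c e * c d) * (e \<bullet> d) \<le> 0" by (simp add: mult_nonpos_nonpos)
    qed
    finally have "v = 0" using inner_gt_zero_iff[of v] by linarith
    have "0 < (\<Sum>d\<in>?p. c d * (d \<bullet> y))"
      using \<open>\<not> c d \<le> 0\<close> d f\<Delta> pos \<Delta> by (intro sum_pos) auto
    also have "\<dots> = v \<bullet> y" by (simp add: v_def inner_sum_left)
    finally show False using \<open>v = 0\<close> by simp
  qed
  have ind: "independent \<Delta>"
  proof (rule independent_if_scalars_zero[OF f\<Delta>])
    fix c d assume c: "(\<Sum>x\<in>\<Delta>. c x *\<^sub>R x) = 0" and d: "d \<in> \<Delta>"
    have "(\<Sum>x\<in>\<Delta>. (- c x) *\<^sub>R x) = 0" using c by (simp add: sum_negf)
    from nopos[OF c d] nopos[OF this d] show "c d = 0" by simp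
  qed
  have spn: "span \<Delta> = UNIV"
  proof (rule ccontr)
    assume "span \<Delta> \<noteq> UNIV"
    then obtain x where x: "x \<noteq> 0" "\<forall>z\<in>span \<Delta>. x \<bullet> z = 0"
      using span_not_UNIV_orthogonal by blast
    have "a \<bullet> x = 0" if "a \<in> \<Phi>" for a
    proof -
      from that have "nonneg_comb \<Delta> a" using \<Delta> by blast
      then obtain c where "a = (\<Sum>d\<in>\<Delta>. c d *\<^sub>R d)" by (auto simp: nonneg_comb_def)
      then have "a \<in> span \<Delta>" by (auto intro: span_sum span_scale span_base)
      then show ?thesis using x(2) by (simp add: inner_commute)
    qed
    then show False using ess x(1) by blast
  qed
  obtain \<omega> where \<omega>: "\<And>d e. d \<in> \<Delta> \<Longrightarrow> e \<in> \<Delta> \<Longrightarrow> \<omega> d \<bullet> e = (if d = e then 1 else 0)"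
    "\<And>v. v = (\<Sum>d\<in>\<Delta>. (\<omega> d \<bullet> v) *\<^sub>R d)" using dual_basis_exists[OF ind spn] by blast
  have "card \<Delta> = DIM('v)" using dim_eq_card_independent[OF ind] dim_span[of \<Delta>] spn by simp
  moreover have "0 \<le> \<omega> d \<bullet> a" if a: "a \<in> \<Phi>" and d: "d \<in> \<Delta>" for a d
  proof -
    obtain c where c: "\<forall>d\<in>\<Delta>. 0 \<le> c d" "a = (\<Sum>d\<in>\<Delta>. c d *\<^sub>R d)"
      using \<Delta> a by (auto simp: nonneg_comb_def)
    have "\<omega> d \<bullet> a = (\<Sum>e\<in>\<Delta>. if d = e then c e else 0)"
      unfolding c(2) inner_sum_right using \<omega>(1) d by (intro sum.cong) auto
    also have "\<dots> = c d" using d f\<Delta> by simp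
    finally show ?thesis using c(1) d by simp
  qed
  ultimately show ?thesis using that \<Delta> \<omega> by blast
qed


section \<open>Roots, words and the length function\<close>

text \<open>The point \<open>y\<close> lies off every reflecting hyperplane; it is the base point of
  the orbit and also the functional separating positive from negative roots.\<close>

locale reflection_group = group W for W :: "('w, 'm) monoid_scheme" (structure) +
  fixes \<rho> :: "'w \<Rightarrow> 'v::euclidean_space \<Rightarrow> 'v" and y :: 'v
  assumes finite_W: "finite (carrier W)"
    and act_mult: "u \<in> carrier W \<Longrightarrow> v \<in> carrier W \<Longrightarrow> \<rho> (u \<otimes> v) x = \<rho> u (\<rho> v x)"
    and faithful: "inj_on \<rho> (carrier W)"
    and orth: "u \<in> carrier W \<Longrightarrow> orthogonal_transformation (\<rho> u)"
    and generated: "generate W (reflections W \<rho>) = carrier W"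
    and essential: "(\<And>t. t \<in> reflections W \<rho> \<Longrightarrow> \<rho> t x = x) \<Longrightarrow> x = 0"
    and regular: "t \<in> reflections W \<rho> \<Longrightarrow> \<rho> t y \<noteq> y"
begin

definition roots :: "'v set" where
  "roots = {a. norm a = 1 \<and> (\<exists>t\<in>carrier W. \<rho> t = reflect a)}"

definition pos :: "'v set" where
  "pos = {a \<in> roots. 0 < a \<bullet> y}"

definition rfl :: "'v \<Rightarrow> 'w" where
  "rfl a = (THE t. t \<in> carrier W \<and> \<rho> t = reflect a)"

lemma act_one: "\<rho> \<one> x = x"
proof -
  have "\<rho> \<one> (\<rho> \<one> x) = \<rho> \<one> x" using act_mult[of \<one> \<one> x] by simp
  then show ?thesis using orth[of \<one>] orthogonal_transformation_inj[of "\<rho> \<one>"] by (auto dest: injD)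
qed

lemma act_eqI: "u \<in> carrier W \<Longrightarrow> v \<in> carrier W \<Longrightarrow> (\<And>x. \<rho> u x = \<rho> v x) \<Longrightarrow> u = v"
  using faithful by (auto simp: inj_on_def fun_eq_iff)

lemma act_linear: "u \<in> carrier W \<Longrightarrow> linear (\<rho> u)"
  using orth orthogonal_transformation_linear by blast

lemma act_inner: "u \<in> carrier W \<Longrightarrow> \<rho> u a \<bullet> \<rho> u b = a \<bullet> b"
  using orth by (auto simp: orthogonal_transformation_def)

lemma act_norm: "u \<in> carrier W \<Longrightarrow> norm (\<rho> u a) = norm a"
  using orth by (auto simp: orthogonal_transformation_norm)

lemma act_inv1: "u \<in> carrier W \<Longrightarrow> \<rho> (inv u) (\<rho> u x) = x"
  using act_mult[of "inv u" u x] act_one by simp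

lemma act_inv2: "u \<in> carrier W \<Longrightarrow> \<rho> u (\<rho> (inv u) x) = x"
  using act_mult[of u "inv u" x] act_one by simp

lemma norm_root: "a \<in> roots \<Longrightarrow> norm a = 1" by (simp add: roots_def)

lemma root_nonzero: "a \<in> roots \<Longrightarrow> a \<noteq> 0" using norm_root by fastforce

lemma rfl: assumes "a \<in> roots" shows "rfl a \<in> carrier W" "\<rho> (rfl a) = reflect a"
proof -
  obtain t where t: "t \<in> carrier W" "\<rho> t = reflect a" using assms by (auto simp: roots_def)
  have "rfl a = t" unfolding rfl_def using t faithful by (intro the_equality) (auto simp: inj_on_def)
  then show "rfl a \<in> carrier W" "\<rho> (rfl a) = reflect a" using t by auto
qed

lemma minus_root: "a \<in> roots \<Longrightarrow> - a \<in> roots"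
  by (simp add: roots_def reflect_minus)

lemma rfl_minus: "rfl (- a) = rfl a"
  by (simp add: rfl_def reflect_minus)

lemma rfl_in_reflections: "a \<in> roots \<Longrightarrow> rfl a \<in> reflections W \<rho>"
  using rfl root_nonzero by (auto simp: reflections_def is_reflection_def)

lemma root_inner_y: "a \<in> roots \<Longrightarrow> a \<bullet> y \<noteq> 0"
  using regular[OF rfl_in_reflections] rfl(2) reflect_fixed_iff[OF root_nonzero] by auto

lemma pos_root: "a \<in> pos \<Longrightarrow> a \<in> roots" and pos_inner: "a \<in> pos \<Longrightarrow> 0 < a \<bullet> y"
  by (auto simp: pos_def)

lemma pos_or_neg: "a \<in> roots \<Longrightarrow> a \<in> pos \<or> - a \<in> pos"
  using root_inner_y[of a] minus_root by (auto simp: pos_def neq_iff)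

lemma not_pos_and_neg: "a \<in> pos \<Longrightarrow> - a \<notin> pos"
  by (auto simp: pos_def)

lemma reflection_root:
  assumes "t \<in> reflections W \<rho>"
  obtains a where "a \<in> pos" "t = rfl a"
proof -
  obtain b where b: "t \<in> carrier W" "b \<noteq> 0" "\<rho> t = reflect b"
    using assms by (auto simp: reflections_def is_reflection_def)
  let ?a = "(1 / norm b) *\<^sub>R b"
  have "?a \<in> roots" using b reflect_scale[of "1 / norm b" b] by (auto simp: roots_def)
  moreover have "t = rfl ?a" if "?a \<in> roots"
    using rfl[OF that] b reflect_scale[of "1 / norm b" b] by (auto intro: act_eqI)
  ultimately show ?thesis using that[of ?a] that[of "- ?a"] pos_or_neg[of ?a] rfl_minus[of ?a] by auto
qed

lemma act_reflect: "u \<in> carrier W \<Longrightarrow> \<rho> u (reflect a x) = reflect (\<rho> u a) (\<rho> u x)"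
  using orthogonal_reflect[OF orth] .

lemma rfl_rfl: "a \<in> roots \<Longrightarrow> rfl a \<otimes> rfl a = \<one>"
  by (rule act_eqI) (auto simp: rfl act_mult reflect_reflect act_one)

lemma act_root: assumes "u \<in> carrier W" "a \<in> roots" shows "\<rho> u a \<in> roots"
proof -
  have "\<rho> (u \<otimes> rfl a \<otimes> inv u) = reflect (\<rho> u a)"
    using assms rfl[OF assms(2)] by (intro ext) (simp add: act_mult act_reflect act_inv2)
  then show ?thesis using assms rfl[OF assms(2)]
    by (auto simp: roots_def act_norm intro!: bexI[of _ "u \<otimes> rfl a \<otimes> inv u"])
qed

lemma conj_rfl:
  assumes "u \<in> carrier W" "a \<in> roots"
  shows "u \<otimes> rfl a = rfl (\<rho> u a) \<otimes> u"
  using assms rfl[OF assms(2)] rfl[OF act_root[OF assms]]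
  by (intro act_eqI) (auto simp: act_mult act_reflect)

lemma finite_roots: "finite roots"
proof -
  have "finite {a::'v. norm a = 1 \<and> \<rho> t = reflect a}" for t
  proof (cases "\<exists>b::'v. norm b = 1 \<and> \<rho> t = reflect b")
    case True
    then obtain b :: 'v where "norm b = 1" "\<rho> t = reflect b" by blast
    then have "{a. norm a = 1 \<and> \<rho> t = reflect a} \<subseteq> {b, - b}" using reflect_eq_iff[of _ b] by force
    then show ?thesis by (rule finite_subset) simp
  next
    case False
    then have "{a. norm a = 1 \<and> \<rho> t = reflect a} = {}" by blast
    then show ?thesis by (simp only: finite.emptyI)
  qed
  moreover have "roots = (\<Union>t\<in>carrier W. {a. norm a = 1 \<and> \<rho> t = reflect a})"
    by (auto simp: roots_def)
  ultimately show ?thesis using finite_W by simp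
qed

lemma finite_pos: "finite pos"
  using finite_roots by (simp add: pos_def)

lemma simple_system:
  obtains \<Delta> \<omega> where "\<Delta> \<subseteq> pos" "card \<Delta> = DIM('v)"
    "\<And>d e. d \<in> \<Delta> \<Longrightarrow> e \<in> \<Delta> \<Longrightarrow> \<omega> d \<bullet> e = (if d = e then 1 else 0)"
    "\<And>v. v = (\<Sum>d\<in>\<Delta>. (\<omega> d \<bullet> v) *\<^sub>R d)"
    "\<And>a d. a \<in> pos \<Longrightarrow> d \<in> \<Delta> \<Longrightarrow> 0 \<le> \<omega> d \<bullet> a"
proof (rule simple_system_exists[OF finite_pos])
  show "0 < a \<bullet> y" "norm a = 1" if "a \<in> pos" for a
    using that by (auto simp: pos_def norm_root)
  show "reflect a b \<in> pos \<or> - reflect a b \<in> pos" if "a \<in> pos" "b \<in> pos" for a b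
    using that rfl[of a] act_root[of "rfl a" b] by (intro pos_or_neg) (simp add: pos_def)
  show "x = 0" if h: "\<And>a. a \<in> pos \<Longrightarrow> a \<bullet> x = 0" for x
  proof (rule essential)
    fix t assume "t \<in> reflections W \<rho>"
    then obtain a where a: "a \<in> pos" "t = rfl a" by (rule reflection_root)
    then show "\<rho> t x = x" using h[OF a(1)] rfl(2)[OF pos_root[OF a(1)]] by (simp add: reflect_def)
  qed
qed (use that in blast)

end

locale simple_system = reflection_group W \<rho> y
  for W :: "('w, 'm) monoid_scheme" (structure)
    and \<rho> :: "'w \<Rightarrow> 'v::euclidean_space \<Rightarrow> 'v" and y :: 'v +
  fixes \<Delta> :: "'v set" and \<omega> :: "'v \<Rightarrow> 'v"
  assumes simple_pos: "\<Delta> \<subseteq> pos" and card_simple: "card \<Delta> = DIM('v)"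
    and dual: "d \<in> \<Delta> \<Longrightarrow> e \<in> \<Delta> \<Longrightarrow> \<omega> d \<bullet> e = (if d = e then 1 else 0)"
    and expand: "v = (\<Sum>d\<in>\<Delta>. (\<omega> d \<bullet> v) *\<^sub>R d)"
    and coeff_pos: "a \<in> pos \<Longrightarrow> d \<in> \<Delta> \<Longrightarrow> 0 \<le> \<omega> d \<bullet> a"
begin

lemma simple_root: "d \<in> \<Delta> \<Longrightarrow> d \<in> roots" using simple_pos pos_root by blast

lemma finite_simple: "finite \<Delta>" using simple_pos finite_pos finite_subset by blast

definition simple_prod :: "'v list \<Rightarrow> 'w" where
  "simple_prod ds = word_prod W (map rfl ds)"

definition len :: "'w \<Rightarrow> nat" where
  "len = word_length W (rfl ` \<Delta>)"

lemma simple_prod_Nil [simp]: "simple_prod [] = \<one>" and simple_prod_Cons [simp]: "simple_prod (d # ds) = rfl d \<otimes> simple_prod ds"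
  by (simp_all add: simple_prod_def word_prod_def)

lemma simple_prod_closed [simp]: "set ds \<subseteq> \<Delta> \<Longrightarrow> simple_prod ds \<in> carrier W"
  by (induction ds) (auto simp: rfl simple_root)

lemma simple_prod_append: "set ds \<subseteq> \<Delta> \<Longrightarrow> set es \<subseteq> \<Delta> \<Longrightarrow> simple_prod (ds @ es) = simple_prod ds \<otimes> simple_prod es"
  by (induction ds) (auto simp: m_assoc rfl simple_root)

lemma inv_simple_prod: "set ds \<subseteq> \<Delta> \<Longrightarrow> inv (simple_prod ds) = simple_prod (rev ds)"
proof (induction ds)
  case (Cons d ds)
  have r: "rfl d \<in> carrier W" "inv (rfl d) = rfl d"
    using Cons.prems rfl simple_root rfl_rfl by (auto intro: inv_equality)
  then show ?case using Cons by (simp add: inv_mult_group simple_prod_append)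
qed simp

text \<open>Reflecting in \<open>d\<close> changes only the \<open>d\<close> coordinate, and a
  positive root other than \<open>d\<close> has a further positive coordinate, which
  survives.\<close>

lemma simple_permutes:
  assumes d: "d \<in> \<Delta>" and b: "b \<in> pos" "b \<noteq> d"
  shows "reflect d b \<in> pos"
proof -
  have r: "reflect d b \<in> roots" using act_root[of "rfl d" b] rfl[OF simple_root[OF d]] b pos_root by auto
  have "\<exists>e\<in>\<Delta>. e \<noteq> d \<and> 0 < \<omega> e \<bullet> b"
  proof (rule ccontr)
    assume "\<not> ?thesis"
    then have 0: "\<omega> e \<bullet> b = 0" if "e \<in> \<Delta>" "e \<noteq> d" for e
      using coeff_pos[OF b(1)] that by force
    have "b = (\<Sum>e\<in>\<Delta>. (\<omega> e \<bullet> b) *\<^sub>R e)" by (rule expand)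
    also have "\<dots> = (\<omega> d \<bullet> b) *\<^sub>R d"
      using 0 d finite_simple by (subst sum.remove[of _ d]) auto
    finally have e: "b = (\<omega> d \<bullet> b) *\<^sub>R d" .
    have "norm b = 1" "norm d = 1" using b d norm_root pos_root simple_root by auto
    then have "\<omega> d \<bullet> b = 1" using e coeff_pos[OF b(1) d]
      by (metis abs_of_nonneg mult.right_neutral norm_scaleR)
    then show False using e b(2) by simp
  qed
  then obtain e where e: "e \<in> \<Delta>" "e \<noteq> d" "0 < \<omega> e \<bullet> b" by blast
  have "\<omega> e \<bullet> reflect d b = \<omega> e \<bullet> b"
    using dual[OF e(1) d] e(2) by (simp add: reflect_def inner_diff_right)
  then have "\<omega> e \<bullet> (- reflect d b) < 0" using e by simp
  then have "- reflect d b \<notin> pos" using coeff_pos[of "- reflect d b" e] e(1) by force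
  then show ?thesis using pos_or_neg[OF r] by blast
qed

lemma root_act_pos_iff:
  assumes "u \<in> carrier W" "a \<in> roots"
  shows "\<rho> u a \<notin> pos \<longleftrightarrow> - \<rho> u a \<in> pos"
  using act_root[OF assms] pos_or_neg not_pos_and_neg by blast

text \<open>The images of \<open>b\<close> under longer and longer suffixes of the word begin
  positive and end negative. By \<open>simple_permutes\<close> the image just before the change is
  the letter about to act, and conjugation then cancels that letter.\<close>

lemma strong_exchange:
  assumes "set ds \<subseteq> \<Delta>" "b \<in> pos" "\<rho> (simple_prod ds) b \<notin> pos"
  obtains i where "i < length ds" "simple_prod ds \<otimes> rfl b = simple_prod (take i ds @ drop (Suc i) ds)"
  using assms
proof (induction ds arbitrary: thesis)
  case Nil
  then show ?case by (simp add: act_one)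
next
  case (Cons d ds)
  have d: "d \<in> \<Delta>" and ds: "set ds \<subseteq> \<Delta>" using Cons.prems by auto
  have rd: "rfl d \<in> carrier W" "\<rho> (rfl d) = reflect d" using rfl[OF simple_root[OF d]] by auto
  have rb: "b \<in> roots" "rfl b \<in> carrier W" using Cons.prems rfl pos_root by auto
  show ?case
  proof (cases "\<rho> (simple_prod ds) b \<in> pos")
    case False
    obtain i where i: "i < length ds" "simple_prod ds \<otimes> rfl b = simple_prod (take i ds @ drop (Suc i) ds)"
      by (rule Cons.IH[OF _ ds Cons.prems(3) False])
    have "simple_prod (d # ds) \<otimes> rfl b = rfl d \<otimes> (simple_prod ds \<otimes> rfl b)"
      using rd rb ds by (simp add: m_assoc)
    also have "\<dots> = simple_prod (take (Suc i) (d # ds) @ drop (Suc (Suc i)) (d # ds))" using i by simp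
    finally show ?thesis using Cons.prems(1)[of "Suc i"] i(1) by simp
  next
    case True
    have "reflect d (\<rho> (simple_prod ds) b) \<notin> pos"
      using Cons.prems(4) rd ds by (simp add: act_mult)
    then have e: "\<rho> (simple_prod ds) b = d" using simple_permutes[OF d True] by blast
    have "simple_prod (d # ds) \<otimes> rfl b = rfl d \<otimes> (simple_prod ds \<otimes> rfl b)"
      using rd rb ds by (simp add: m_assoc)
    also have "\<dots> = rfl d \<otimes> (rfl d \<otimes> simple_prod ds)" using conj_rfl[OF simple_prod_closed[OF ds] rb(1)] e by simp
    also have "\<dots> = simple_prod ds" using rd ds rfl_rfl[OF simple_root[OF d]] by (simp add: m_assoc[symmetric])
    finally show ?thesis using Cons.prems(1)[of 0] by simp
  qed
qed

text \<open>A positive root \<open>b\<close> outside \<open>\<Delta>\<close> has positive inner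
  product with some simple \<open>d\<close>. The root \<open>reflect d b\<close> is positive with a
  smaller inner product with \<open>y\<close>, and its reflection conjugated by \<open>rfl d\<close>
  is \<open>rfl b\<close>.\<close>

lemma rfl_word:
  assumes "b \<in> pos"
  shows "\<exists>ds. set ds \<subseteq> \<Delta> \<and> simple_prod ds = rfl b"
  using assms
proof (induction "card {a \<in> pos. a \<bullet> y < b \<bullet> y}" arbitrary: b rule: less_induct)
  case less
  show ?case
  proof (cases "b \<in> \<Delta>")
    case True
    then show ?thesis using rfl[OF simple_root[OF True]] by (intro exI[of _ "[b]"]) auto
  next
    case False
    have "\<exists>d\<in>\<Delta>. 0 < d \<bullet> b"
    proof (rule ccontr)
      assume n: "\<not> ?thesis"
      have "b \<bullet> b = (\<Sum>d\<in>\<Delta>. (\<omega> d \<bullet> b) * (d \<bullet> b))"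
        by (subst (1) expand[of b]) (simp add: inner_sum_left)
      also have "\<dots> \<le> 0" using n coeff_pos[OF less.prems]
        by (intro sum_nonpos) (force simp: mult_nonneg_nonpos not_less)
      finally show False using root_nonzero[OF pos_root[OF less.prems]] inner_gt_zero_iff[of b] by linarith
    qed
    then obtain d where d: "d \<in> \<Delta>" "0 < d \<bullet> b" by blast
    have rd: "rfl d \<in> carrier W" "\<rho> (rfl d) = reflect d" using rfl[OF simple_root[OF d(1)]] by auto
    let ?b = "reflect d b"
    have p: "?b \<in> pos" using simple_permutes[OF d(1) less.prems] False d by blast
    have lt: "?b \<bullet> y < b \<bullet> y"
      using d norm_root[OF simple_root[OF d(1)]] pos_inner[of d] simple_pos
      by (auto simp: reflect_unit inner_diff_left)
    have "card {a \<in> pos. a \<bullet> y < ?b \<bullet> y} < card {a \<in> pos. a \<bullet> y < b \<bullet> y}"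
      using lt p finite_pos by (intro psubset_card_mono psubsetI) auto
    from less.hyps[OF this p] obtain ds where ds: "set ds \<subseteq> \<Delta>" "simple_prod ds = rfl ?b" by blast
    have c: "rfl d \<otimes> rfl b = rfl ?b \<otimes> rfl d"
      using conj_rfl[OF rd(1) pos_root[OF less.prems]] rd by simp
    have "simple_prod (d # ds @ [d]) = rfl d \<otimes> (rfl ?b \<otimes> rfl d)"
      using ds d rd by (simp add: simple_prod_append)
    also have "\<dots> = rfl d \<otimes> (rfl d \<otimes> rfl b)" using c by simp
    also have "\<dots> = rfl b"
      using rd rfl(1)[OF pos_root[OF less.prems]] rfl_rfl[OF simple_root[OF d(1)]]
      by (simp add: m_assoc[symmetric])
    finally show ?thesis using ds d by (intro exI[of _ "d # ds @ [d]"]) auto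
  qed
qed

lemma word_exists:
  assumes "w \<in> carrier W"
  shows "\<exists>ds. set ds \<subseteq> \<Delta> \<and> simple_prod ds = w"
proof -
  have "w \<in> generate W (reflections W \<rho>)" using assms generated by simp
  then show ?thesis
  proof induction
    case one
    show ?case by (intro exI[of _ "[]"]) simp
  next
    case (incl h)
    then show ?case using rfl_word by (auto elim: reflection_root)
  next
    case (inv h)
    then obtain b where b: "b \<in> pos" "h = rfl b" by (auto elim: reflection_root)
    then have "inv h = h" using rfl rfl_rfl pos_root by (auto intro: inv_equality)
    then show ?case using rfl_word b by auto
  next
    case (eng h1 h2)
    then obtain ds es where "set ds \<subseteq> \<Delta>" "simple_prod ds = h1" "set es \<subseteq> \<Delta>" "simple_prod es = h2" by blast
    then show ?case by (intro exI[of _ "ds @ es"]) (auto simp: simple_prod_append)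
  qed
qed

section \<open>Length, Bruhat arrows and the orbit of the base point\<close>

lemma len_alt: "len w = (LEAST n. \<exists>ds. set ds \<subseteq> \<Delta> \<and> length ds = n \<and> simple_prod ds = w)"
proof -
  have "(\<exists>xs\<in>lists (rfl ` \<Delta>). length xs = n \<and> word_prod W xs = w) \<longleftrightarrow>
    (\<exists>ds. set ds \<subseteq> \<Delta> \<and> length ds = n \<and> simple_prod ds = w)" for n
  proof
    assume "\<exists>xs\<in>lists (rfl ` \<Delta>). length xs = n \<and> word_prod W xs = w"
    then obtain ds where "ds \<in> lists \<Delta>" "length (map rfl ds) = n" "word_prod W (map rfl ds) = w"
      by (auto simp: lists_image)
    then show "\<exists>ds. set ds \<subseteq> \<Delta> \<and> length ds = n \<and> simple_prod ds = w"
      by (auto simp: simple_prod_def in_lists_conv_set)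
  next
    assume "\<exists>ds. set ds \<subseteq> \<Delta> \<and> length ds = n \<and> simple_prod ds = w"
    then show "\<exists>xs\<in>lists (rfl ` \<Delta>). length xs = n \<and> word_prod W xs = w"
      by (force simp: simple_prod_def intro!: bexI[of _ "map rfl _"])
  qed
  then show ?thesis by (simp add: len_def word_length_def)
qed

lemma len_word:
  assumes "w \<in> carrier W"
  obtains ds where "set ds \<subseteq> \<Delta>" "length ds = len w" "simple_prod ds = w"
proof -
  have "\<exists>n. \<exists>ds. set ds \<subseteq> \<Delta> \<and> length ds = n \<and> simple_prod ds = w" using word_exists[OF assms] by blast
  from LeastI_ex[OF this] show ?thesis using that unfolding len_alt by blast
qed

lemma len_le: "set ds \<subseteq> \<Delta> \<Longrightarrow> len (simple_prod ds) \<le> length ds"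
  unfolding len_alt by (rule Least_le) blast

lemma len_mult_le:
  assumes "u \<in> carrier W" "set ds \<subseteq> \<Delta>"
  shows "len (u \<otimes> simple_prod ds) \<le> len u + length ds"
proof -
  obtain es where es: "set es \<subseteq> \<Delta>" "length es = len u" "simple_prod es = u" using len_word[OF assms(1)] .
  then have "len (simple_prod (es @ ds)) \<le> length (es @ ds)" using assms by (intro len_le) auto
  then show ?thesis using es assms by (simp add: simple_prod_append)
qed

lemma len_one: "len \<one> = 0" using len_le[of "[]"] by simp

lemma len_eq_0: "w \<in> carrier W \<Longrightarrow> len w = 0 \<Longrightarrow> w = \<one>"
  by (auto elim: len_word[of w])

lemma len_down:
  assumes u: "u \<in> carrier W" and b: "b \<in> pos" and n: "\<rho> u b \<notin> pos"
  shows "len (u \<otimes> rfl b) < len u"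
proof -
  obtain ds where ds: "set ds \<subseteq> \<Delta>" "length ds = len u" "simple_prod ds = u" using len_word[OF u] .
  obtain i where i: "i < length ds" "simple_prod ds \<otimes> rfl b = simple_prod (take i ds @ drop (Suc i) ds)"
    using strong_exchange[OF ds(1) b] n ds(3) by blast
  have "set (take i ds @ drop (Suc i) ds) \<subseteq> \<Delta>"
    using ds(1) set_take_subset[of i ds] set_drop_subset[of "Suc i" ds] by auto
  from len_le[OF this] i ds show ?thesis by simp
qed

lemma len_up_right:
  assumes u: "u \<in> carrier W" and b: "b \<in> pos" and p: "\<rho> u b \<in> pos"
  shows "len u < len (u \<otimes> rfl b)"
proof -
  have r: "rfl b \<in> carrier W" "\<rho> (rfl b) = reflect b" "b \<in> roots" using rfl b pos_root by auto
  have "\<rho> (u \<otimes> rfl b) b = - \<rho> u b"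
    using u r root_nonzero[OF r(3)] by (simp add: act_mult reflect_self linear_neg[OF act_linear])
  then have "\<rho> (u \<otimes> rfl b) b \<notin> pos" using not_pos_and_neg p by fastforce
  from len_down[OF _ b this] u r show ?thesis by (simp add: m_assoc rfl_rfl)
qed

text \<open>A Bruhat arrow with the reflection written on the left, so that the edge between the
  orbit points is parallel to \<open>a\<close>. The sign condition says that the inverse of
  \<open>u\<close> maps \<open>a\<close> to a positive root.\<close>

definition up :: "'w \<Rightarrow> 'w \<Rightarrow> 'v \<Rightarrow> bool" where
  "up u v a \<longleftrightarrow> u \<in> carrier W \<and> a \<in> pos \<and> 0 < a \<bullet> \<rho> u y \<and> v = rfl a \<otimes> u"

lemma up_iff_right:
  assumes "u \<in> carrier W" "b \<in> pos" "\<rho> u b \<in> pos"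
  shows "up u (u \<otimes> rfl b) (\<rho> u b)"
  using assms conj_rfl[OF assms(1) pos_root[OF assms(2)]]
  by (simp add: up_def act_inner pos_inner)

lemma up_right:
  assumes "up u v a"
  obtains b where "b \<in> pos" "\<rho> u b = a" "v = u \<otimes> rfl b"
proof -
  have u: "u \<in> carrier W" "a \<in> pos" "0 < a \<bullet> \<rho> u y" "v = rfl a \<otimes> u" using assms by (auto simp: up_def)
  let ?b = "\<rho> (inv u) a"
  have "?b \<in> roots" using u act_root pos_root by simp
  moreover have "?b \<bullet> y = a \<bullet> \<rho> u y" using act_inner[OF u(1), of ?b y] u by (simp add: act_inv2)
  ultimately have "?b \<in> pos" using u by (simp add: pos_def)
  moreover have "v = u \<otimes> rfl ?b" using u conj_rfl[OF u(1) \<open>?b \<in> roots\<close>] by (simp add: act_inv2)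
  ultimately show ?thesis using that u by (simp add: act_inv2)
qed

lemma up_len: assumes "up u v a" shows "len u < len v"
proof -
  obtain b where "b \<in> pos" "\<rho> u b = a" "v = u \<otimes> rfl b" using up_right[OF assms] .
  then show ?thesis using assms len_up_right[of u b] by (simp add: up_def)
qed

lemma up_closed: "up u v a \<Longrightarrow> v \<in> carrier W"
  by (auto simp: up_def rfl pos_root)

lemma up_act: "up u v a \<Longrightarrow> \<rho> v x = reflect a (\<rho> u x)"
  by (auto simp: up_def rfl pos_root act_mult)

lemma up_step: "up u v a \<Longrightarrow> \<rho> v y = \<rho> u y - (2 * (a \<bullet> \<rho> u y)) *\<^sub>R a"
  using up_act[of u v a y] by (simp add: reflect_unit up_def norm_root pos_root)

text \<open>Along a reduced word each letter subtracts a positive multiple of a positive root from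
  the orbit point. The coweight coordinates therefore never grow, and the inner product with
  \<open>y\<close> strictly falls.\<close>

lemma coeff_act_le:
  assumes w: "w \<in> carrier W" and d: "d \<in> \<Delta>"
  shows "\<omega> d \<bullet> \<rho> w y \<le> \<omega> d \<bullet> y"
    and "w \<noteq> \<one> \<Longrightarrow> \<rho> w y \<noteq> y"
proof -
  have "(\<forall>d\<in>\<Delta>. \<omega> d \<bullet> \<rho> w y \<le> \<omega> d \<bullet> y) \<and> (w \<noteq> \<one> \<longrightarrow> y \<bullet> \<rho> w y < y \<bullet> y)"
    using w
  proof (induction "len w" arbitrary: w rule: less_induct)
    case less
    show ?case
    proof (cases "w = \<one>")
      case True
      then show ?thesis by (simp add: act_one)
    next
      case False
      obtain ds where ds: "set ds \<subseteq> \<Delta>" "length ds = len w" "simple_prod ds = w" using len_word[OF less.prems] .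
      have "ds \<noteq> []" using ds False by auto
      then obtain es e where es: "ds = es @ [e]" by (metis rev_exhaust)
      have e: "e \<in> \<Delta>" "set es \<subseteq> \<Delta>" using ds es by auto
      have re: "rfl e \<in> carrier W" "\<rho> (rfl e) = reflect e" "e \<in> roots" "e \<in> pos"
        using rfl[OF simple_root[OF e(1)]] simple_root[OF e(1)] e(1) simple_pos by auto
      have w: "w = simple_prod es \<otimes> rfl e" using ds(3) e re by (simp add: es simple_prod_append)
      have lt: "len (simple_prod es) < len w" using len_le[OF e(2)] ds(2) es by simp
      have wes: "simple_prod es = w \<otimes> rfl e" using w re e by (simp add: m_assoc rfl_rfl)
      have "\<rho> (simple_prod es) e \<in> pos"
      proof (rule ccontr)
        assume "\<rho> (simple_prod es) e \<notin> pos"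
        from len_down[OF simple_prod_closed[OF e(2)] re(4) this] lt w show False by simp
      qed
      then have u: "up (simple_prod es) w (\<rho> (simple_prod es) e)" using up_iff_right[OF _ re(4)] e w by simp
      define k where "k = 2 * (\<rho> (simple_prod es) e \<bullet> \<rho> (simple_prod es) y)"
      have k: "k > 0" using u by (simp add: up_def k_def)
      have st: "\<rho> w y = \<rho> (simple_prod es) y - k *\<^sub>R \<rho> (simple_prod es) e" using up_step[OF u] by (simp add: k_def)
      have IH: "(\<forall>d\<in>\<Delta>. \<omega> d \<bullet> \<rho> (simple_prod es) y \<le> \<omega> d \<bullet> y)" "simple_prod es \<noteq> \<one> \<longrightarrow> y \<bullet> \<rho> (simple_prod es) y < y \<bullet> y"
        using less.hyps[OF lt] e by auto
      have p: "\<rho> (simple_prod es) e \<in> pos" using u by (simp add: up_def)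
      have "\<omega> d \<bullet> \<rho> w y \<le> \<omega> d \<bullet> y" if "d \<in> \<Delta>" for d
      proof -
        have "0 \<le> k * (\<omega> d \<bullet> \<rho> (simple_prod es) e)" using k coeff_pos[OF p that] by simp
        then show ?thesis using IH(1) that by (fastforce simp: st inner_diff_right)
      qed
      moreover have "0 < k * (y \<bullet> \<rho> (simple_prod es) e)" using k pos_inner[OF p] by (simp add: inner_commute)
      then have "y \<bullet> \<rho> w y < y \<bullet> y"
        using IH(2) by (cases "simple_prod es = \<one>") (auto simp: st inner_diff_right act_one)
      ultimately show ?thesis by blast
    qed
  qed
  then show "\<omega> d \<bullet> \<rho> w y \<le> \<omega> d \<bullet> y" and "w \<noteq> \<one> \<Longrightarrow> \<rho> w y \<noteq> y" using d by auto
qed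

lemma inj_orbit: "inj_on (\<lambda>w. \<rho> w y) (carrier W)"
proof (rule inj_onI)
  fix u v assume h: "u \<in> carrier W" "v \<in> carrier W" "\<rho> u y = \<rho> v y"
  have ne: "\<Delta> \<noteq> {}" using card_simple DIM_positive[where 'a='v] by force
  have "\<rho> (inv u \<otimes> v) y = y" using h by (simp add: act_mult flip: h(3)) (simp add: act_inv1)
  then have "inv u \<otimes> v = \<one>" using coeff_act_le(2)[of "inv u \<otimes> v"] ne h by blast
  then show "u = v" using h by (metis inv_comm inv_equality inv_inv inv_closed)
qed

text \<open>Supplies supporting hyperplanes of the permutahedron, with the group images of the
  coweights as normals.\<close>

lemma coweight_max:
  assumes "w \<in> carrier W" "u \<in> carrier W" "d \<in> \<Delta>"
  shows "\<rho> u (\<omega> d) \<bullet> \<rho> w y \<le> \<omega> d \<bullet> y"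
proof -
  have "\<rho> u (\<omega> d) \<bullet> \<rho> w y = \<rho> (inv u) (\<rho> u (\<omega> d)) \<bullet> \<rho> (inv u) (\<rho> w y)"
    using assms by (simp add: act_inner)
  also have "\<dots> = \<omega> d \<bullet> \<rho> (inv u \<otimes> w) y" using assms by (simp add: act_inv1 act_mult)
  also have "\<dots> \<le> \<omega> d \<bullet> y" using assms by (intro coeff_act_le) auto
  finally show ?thesis .
qed

end

section \<open>The base region and its walls\<close>

context simple_system begin

definition chamber :: "'v set" where
  "chamber = {x. \<forall>a\<in>pos. 0 < a \<bullet> x}"

lemma reflecting_hyperplane_rfl: "a \<in> pos \<Longrightarrow> reflecting_hyperplane \<rho> (rfl a) = {x. a \<bullet> x = 0}"
  using rfl(2)[OF pos_root] reflect_fixed_iff[OF root_nonzero[OF pos_root]]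
  by (auto simp: reflecting_hyperplane_def)

lemma reflections_eq: "reflections W \<rho> = rfl ` pos"
  using rfl_in_reflections pos_root by (auto elim: reflection_root)

text \<open>A connected set off the hyperplanes cannot change the sign of a root, and the chamber is
  a convex subset of the complement; both contain \<open>y\<close>.\<close>

lemma region_eq_chamber:
  assumes B: "B \<in> regions W \<rho>" and y: "y \<in> B"
  shows "B = chamber"
proof -
  let ?M = "UNIV - \<Union> (hyperplanes W \<rho>)"
  have M: "x \<in> ?M \<longleftrightarrow> (\<forall>a\<in>pos. a \<bullet> x \<noteq> 0)" for x
    using reflecting_hyperplane_rfl by (auto simp: hyperplanes_def reflections_eq)
  have B': "B \<in> components ?M" using B by (simp add: regions_def)
  show ?thesis
  proof
    have "connected B" "B \<subseteq> ?M"
      using B' in_components_connected in_components_subset by blast+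
    show "B \<subseteq> chamber"
    proof
      fix x assume x: "x \<in> B"
      show "x \<in> chamber"
        unfolding chamber_def
      proof (clarify, rule ccontr)
        fix a assume a: "a \<in> pos" "\<not> 0 < a \<bullet> x"
        then obtain z where z: "z \<in> B" "a \<bullet> z = 0"
          using connected_ivt_hyperplane[OF \<open>connected B\<close> x y, of a 0] pos_inner[OF a(1)] by auto
        then show False using \<open>B \<subseteq> ?M\<close> M a(1) by blast
      qed
    qed
    have "convex chamber"
    proof -
      have "chamber = (\<Inter>a\<in>pos. {x. a \<bullet> x > 0})" by (auto simp: chamber_def)
      then show ?thesis by (simp add: convex_INT convex_halfspace_gt)
    qed
    moreover have "chamber \<subseteq> ?M" unfolding subset_eq M by (auto simp: chamber_def)
    moreover have "y \<in> chamber" using pos_inner by (simp add: chamber_def)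
    ultimately show "chamber \<subseteq> B"
      using components_maximal[OF B' convex_connected] y by blast
  qed
qed

lemma closure_chamber: "closure chamber = {x. \<forall>a\<in>pos. 0 \<le> a \<bullet> x}"
proof
  have "{x. \<forall>a\<in>pos. 0 \<le> a \<bullet> x} = (\<Inter>a\<in>pos. {x. a \<bullet> x \<ge> 0})" by auto
  then have "closed {x. \<forall>a\<in>pos. 0 \<le> a \<bullet> x}" by (simp add: closed_INT closed_halfspace_ge)
  moreover have "chamber \<subseteq> {x. \<forall>a\<in>pos. 0 \<le> a \<bullet> x}" by (force simp: chamber_def)
  ultimately show "closure chamber \<subseteq> {x. \<forall>a\<in>pos. 0 \<le> a \<bullet> x}" by (simp add: closure_minimal)
  show "{x. \<forall>a\<in>pos. 0 \<le> a \<bullet> x} \<subseteq> closure chamber"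
  proof clarify
    fix x assume x: "\<forall>a\<in>pos. 0 \<le> a \<bullet> x"
    have "x + \<epsilon> *\<^sub>R y \<in> chamber" if "\<epsilon> > 0" for \<epsilon>
      using x that pos_inner by (auto simp: chamber_def inner_add_right add_nonneg_pos)
    moreover have "(\<lambda>n. x + (1 / real (Suc n)) *\<^sub>R y) \<longlonglongrightarrow> x + 0 *\<^sub>R y"
      by (intro tendsto_intros LIMSEQ_Suc lim_1_over_n)
    ultimately show "x \<in> closure chamber"
      unfolding closure_sequential by (intro exI[of _ "\<lambda>n. x + (1 / real (Suc n)) *\<^sub>R y"]) simp
  qed
qed

lemma closure_chamber_simple: "closure chamber = {x. \<forall>d\<in>\<Delta>. 0 \<le> d \<bullet> x}"
proof -
  have "0 \<le> a \<bullet> x" if "a \<in> pos" "\<forall>d\<in>\<Delta>. 0 \<le> d \<bullet> x" for a x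
  proof -
    have "a \<bullet> x = (\<Sum>d\<in>\<Delta>. (\<omega> d \<bullet> a) * (d \<bullet> x))"
      by (subst expand[of a]) (simp add: inner_sum_left)
    also have "\<dots> \<ge> 0" using that coeff_pos by (intro sum_nonneg) auto
    finally show ?thesis .
  qed
  then show ?thesis using simple_pos by (auto simp: closure_chamber)
qed

lemma aff_dim_closure_chamber: "aff_dim (closure chamber) = int DIM('v)"
proof (rule aff_dim_nonempty_interior)
  have "chamber = (\<Inter>a\<in>pos. {x. a \<bullet> x > 0})" by (auto simp: chamber_def)
  then have "open chamber" using finite_pos by (simp add: open_INT open_halfspace_gt)
  moreover have "y \<in> chamber" using pos_inner by (simp add: chamber_def)
  ultimately show "interior (closure chamber) \<noteq> {}"
    using closure_subset interior_maximal by blast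
qed

lemma convex_closure_chamber: "convex (closure chamber)"
proof -
  have "closure chamber = (\<Inter>a\<in>pos. {x. a \<bullet> x \<ge> 0})" by (auto simp: closure_chamber)
  then show ?thesis by (simp add: convex_INT convex_halfspace_ge)
qed

text \<open>On the closed chamber \<open>b \<bullet> x = 0\<close> forces
  \<open>d \<bullet> x = 0\<close> for every simple \<open>d\<close> with positive coefficient in
  \<open>b\<close>. If \<open>b\<close> differs from such a \<open>d\<close>, the face has
  codimension at least two. For simple \<open>b\<close> there is a point of the hyperplane on which
  all other simple roots are positive.\<close>

lemma wall_iff:
  assumes b: "b \<in> pos"
  shows "({x. b \<bullet> x = 0} \<inter> closure chamber) facet_of closure chamber \<longleftrightarrow> b \<in> \<Delta>"
proof
  assume f: "({x. b \<bullet> x = 0} \<inter> closure chamber) facet_of closure chamber"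
  have "\<exists>d\<in>\<Delta>. 0 < \<omega> d \<bullet> b"
  proof (rule ccontr)
    assume "\<not> ?thesis"
    then have "\<omega> d \<bullet> b = 0" if "d \<in> \<Delta>" for d using coeff_pos[OF b that] that by force
    then have "b = 0" using expand[of b] by simp
    then show False using root_nonzero[OF pos_root[OF b]] by simp
  qed
  then obtain d where d: "d \<in> \<Delta>" "0 < \<omega> d \<bullet> b" by blast
  have sub: "{x. b \<bullet> x = 0} \<inter> closure chamber \<subseteq> {x. d \<bullet> x = 0} \<inter> {x. b \<bullet> x = 0}"
  proof clarify
    fix x assume x: "b \<bullet> x = 0" "x \<in> closure chamber"
    have "0 = (\<Sum>d\<in>\<Delta>. (\<omega> d \<bullet> b) * (d \<bullet> x))"
      using x(1) by (subst (asm) expand[of b]) (simp add: inner_sum_left)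
    moreover have "0 \<le> (\<omega> d \<bullet> b) * (d \<bullet> x)" if "d \<in> \<Delta>" for d
      using x(2) coeff_pos[OF b that] that by (simp add: closure_chamber_simple)
    ultimately have "(\<omega> d \<bullet> b) * (d \<bullet> x) = 0"
      using sum_nonneg_eq_0_iff[OF finite_simple, of "\<lambda>d. (\<omega> d \<bullet> b) * (d \<bullet> x)"] d(1) by auto
    then show "x \<in> {x. d \<bullet> x = 0} \<inter> {x. b \<bullet> x = 0}" using d x by simp
  qed
  have dn: "d \<noteq> 0" "norm d = 1" "norm b = 1"
    using d root_nonzero simple_root norm_root pos_root b by auto
  have "b = d"
  proof (rule ccontr)
    assume "b \<noteq> d"
    let ?x = "b - (d \<bullet> b) *\<^sub>R d"
    have dx: "d \<bullet> ?x = 0" using dn by (simp add: inner_diff_right dot_square_norm)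
    have "b \<bullet> ?x \<noteq> 0"
    proof
      assume "b \<bullet> ?x = 0"
      then have "?x \<bullet> ?x = 0" using dx by (simp add: inner_diff_left)
      then have e: "b = (d \<bullet> b) *\<^sub>R d" by simp
      then have "\<bar>d \<bullet> b\<bar> = 1" using dn by (metis mult.right_neutral norm_scaleR)
      moreover have "0 < (d \<bullet> b) * (d \<bullet> y)" using pos_inner[OF b] arg_cong[OF e, of "\<lambda>v. v \<bullet> y"] by simp
      ultimately have "d \<bullet> b = 1" using pos_inner[of d] d simple_pos by (auto simp: zero_less_mult_iff)
      then show False using e \<open>b \<noteq> d\<close> by simp
    qed
    then have ps: "{x. d \<bullet> x = 0} \<inter> {x. b \<bullet> x = 0} \<subset> {x. d \<bullet> x = 0}" using dx by blast
    have "affine {x. d \<bullet> x = 0}" "affine ({x. d \<bullet> x = 0} \<inter> {x. b \<bullet> x = 0})"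
      by (intro affine_Int affine_hyperplane)+
    then have "aff_dim ({x. d \<bullet> x = 0} \<inter> {x. b \<bullet> x = 0}) < aff_dim {x. d \<bullet> x = 0}"
      using ps by (intro aff_dim_psubset) (simp only: affine_hull_eq[THEN iffD2])
    moreover have "aff_dim {x. d \<bullet> x = 0} = int DIM('v) - 1" using dn aff_dim_hyperplane[of d 0] by simp
    ultimately show False
      using f aff_dim_subset[OF sub] aff_dim_closure_chamber by (simp add: facet_of_def)
  qed
  then show "b \<in> \<Delta>" using d by simp
next
  assume d: "b \<in> \<Delta>"
  let ?F = "{x. b \<bullet> x = 0} \<inter> closure chamber"
  have face: "?F face_of closure chamber"
    using face_of_Int_supporting_hyperplane_ge[OF convex_closure_chamber, where a = b and b = 0] b
    by (simp add: closure_chamber Int_commute)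
  let ?U = "\<Inter>e\<in>\<Delta> - {b}. {x. e \<bullet> x > 0}"
  \<comment> \<open>The sum of the other coweights: zero on \<open>b\<close> and one on every other
    simple root.\<close>
  let ?p = "\<Sum>e\<in>\<Delta> - {b}. \<omega> e"
  have ep: "e \<bullet> ?p = (if e = b then 0 else 1)" if "e \<in> \<Delta>" for e
  proof -
    have "e \<bullet> ?p = (\<Sum>z\<in>\<Delta> - {b}. if e = z then 1 else 0)"
      unfolding inner_sum_right using dual that
      by (intro sum.cong) (auto simp: inner_commute)
    then show ?thesis using that finite_simple by simp
  qed
  have "?p \<in> {x. b \<bullet> x = 0} \<inter> ?U" using ep d by auto
  then have ne: "{x. b \<bullet> x = 0} \<inter> ?U \<noteq> {}" by blast
  have "open ?U" using finite_simple by (intro open_INT ballI) (auto simp: open_halfspace_gt)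
  then have "aff_dim ({x. b \<bullet> x = 0} \<inter> ?U) = aff_dim {x. b \<bullet> x = 0}"
    using ne by (intro aff_dim_convex_Int_open convex_hyperplane)
  also have "\<dots> = int DIM('v) - 1"
    using root_nonzero[OF pos_root[OF b]] aff_dim_hyperplane[of b 0] by simp
  finally have dimU: "aff_dim ({x. b \<bullet> x = 0} \<inter> ?U) = int DIM('v) - 1" .
  have "{x. b \<bullet> x = 0} \<inter> ?U \<subseteq> ?F"
  proof
    fix x assume x: "x \<in> {x. b \<bullet> x = 0} \<inter> ?U"
    then have "0 \<le> e \<bullet> x" if "e \<in> \<Delta>" for e using that by (cases "e = b") (auto intro: less_imp_le)
    then show "x \<in> ?F" using x by (simp add: closure_chamber_simple)
  qed
  then have "int DIM('v) - 1 \<le> aff_dim ?F" using aff_dim_subset dimU by metis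
  moreover have "aff_dim ?F \<le> aff_dim {x. b \<bullet> x = 0}" by (rule aff_dim_subset) blast
  then have "aff_dim ?F \<le> int DIM('v) - 1"
    using root_nonzero[OF pos_root[OF b]] aff_dim_hyperplane[of b 0] by simp
  moreover have "?F \<noteq> {}"
  proof -
    have "0 \<in> ?F" by (simp add: closure_chamber)
    then show ?thesis by blast
  qed
  ultimately show "?F facet_of closure chamber"
    using face aff_dim_closure_chamber by (simp add: facet_of_def)
qed

section \<open>Covers and Coxeter elements of the base region in terms of roots\<close>

definition cover :: "'w \<Rightarrow> 'w \<Rightarrow> bool" where
  "cover u v \<longleftrightarrow> (\<exists>a. up u v a) \<and> len v = len u + 1"

lemma cover_closed: "cover u v \<Longrightarrow> u \<in> carrier W" "cover u v \<Longrightarrow> v \<in> carrier W"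
  using up_closed by (auto simp: cover_def up_def)

context
  fixes B assumes B: "B \<in> regions W \<rho>" and y: "y \<in> B"
begin

lemma simple_reflections_eq: "simple_reflections W \<rho> B = rfl ` \<Delta>"
proof -
  have "rfl a \<in> simple_reflections W \<rho> B \<longleftrightarrow> a \<in> \<Delta>" if "a \<in> pos" for a
  proof -
    have "{x. a \<bullet> x = 0} \<in> hyperplanes W \<rho>"
      using that reflecting_hyperplane_rfl[OF that] by (auto simp: hyperplanes_def reflections_eq)
    then show ?thesis
      using that wall_iff[OF that] rfl_in_reflections[OF pos_root]
      by (auto simp: simple_reflections_def walls_def region_eq_chamber[OF B y]
          reflecting_hyperplane_rfl)
  qed
  moreover have "simple_reflections W \<rho> B \<subseteq> rfl ` pos"
    by (auto simp: simple_reflections_def reflections_eq)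
  ultimately show ?thesis using simple_pos by blast
qed

lemma word_length_eq: "word_length W (simple_reflections W \<rho> B) = len"
  by (simp add: len_def simple_reflections_eq)

text \<open>Conjugation moves the reflection from the right of \<open>u\<close> to its left; the
  growing length excludes, by \<open>len_down\<close>, that \<open>u\<close> makes the root
  negative.\<close>

lemma bruhat_cover_iff: "bruhat_cover W \<rho> B u v \<longleftrightarrow> cover u v"
proof
  assume "bruhat_cover W \<rho> B u v"
  then obtain b where b: "u \<in> carrier W" "b \<in> pos" "v = u \<otimes> rfl b" "len v = len u + 1"
    by (auto simp: bruhat_cover_def reflections_eq word_length_eq)
  then have "\<rho> u b \<in> pos" using len_down[of u b] by fastforce
  then show "cover u v" using up_iff_right b by (auto simp: cover_def)
next
  assume c: "cover u v"
  then obtain a where a: "up u v a" by (auto simp: cover_def)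
  then obtain b where "b \<in> pos" "v = u \<otimes> rfl b" by (rule up_right)
  then have "\<exists>t\<in>reflections W \<rho>. v = u \<otimes> t" by (auto simp: reflections_eq)
  then show "bruhat_cover W \<rho> B u v"
    using c cover_closed[OF c] by (simp add: bruhat_cover_def word_length_eq cover_def)
qed

lemma standard_coxeter_element_word:
  assumes "c \<in> standard_coxeter_elements W \<rho> B"
  obtains ds where "distinct ds" "set ds = \<Delta>" "c = simple_prod ds"
proof -
  obtain xs where xs: "distinct xs" "set xs = rfl ` \<Delta>" "c = word_prod W xs"
    using assms by (auto simp: standard_coxeter_elements_def simple_reflections_eq)
  have inj: "inj_on rfl \<Delta>"
  proof (rule inj_onI)
    fix a b assume h: "a \<in> \<Delta>" "b \<in> \<Delta>" "rfl a = rfl b"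
    then have "reflect a = reflect b" using rfl(2) simple_root by metis
    then have "a = b \<or> a = - b" using h norm_root simple_root by (intro reflect_eq_iff) auto
    then show "a = b" using h simple_pos not_pos_and_neg by blast
  qed
  have "xs \<in> lists (rfl ` \<Delta>)" using xs(2) by (simp add: in_lists_conv_set)
  then obtain ds where ds: "xs = map rfl ds" "set ds \<subseteq> \<Delta>"
    by (auto simp: lists_image in_lists_conv_set)
  moreover have "\<Delta> \<subseteq> set ds"
  proof
    fix d assume "d \<in> \<Delta>"
    then obtain e where "e \<in> set ds" "rfl d = rfl e" using xs(2) ds(1) by fastforce
    then show "d \<in> set ds" using inj \<open>d \<in> \<Delta>\<close> ds(2) by (metis inj_on_def subsetD)
  qed
  moreover have "distinct ds" using xs(1) ds by (simp add: distinct_map)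
  ultimately show ?thesis using that xs(3) by (auto simp: simple_prod_def)
qed

end

end

section \<open>Root systems in the plane\<close>

lemma cis_inner: "cis a \<bullet> (R *\<^sub>R cis b) = R * cos (a - b)"
  by (simp add: inner_complex_def cos_diff algebra_simps)

lemma inner_cis: "z \<bullet> cis t = cmod z * cos (t - Arg z)"
  using cis_inner[of t "cmod z" "Arg z"] rcis_cmod_Arg[of z]
  by (metis inner_commute rcis_def scaleR_conv_of_real)

text \<open>A root system of rank two in the complex plane: \<open>- (a\<^sup>2 * cnj b)\<close> is
  the mirror image of \<open>b\<close> in the line orthogonal to the unit vector \<open>a\<close>,
  and \<open>\<xi>\<close> stands for the projection of the base point.\<close>

locale planar_roots =
  fixes A :: "complex set" and \<xi> :: complex
  assumes finite_A: "finite A" and nonempty: "A \<noteq> {}" and unit: "a \<in> A \<Longrightarrow> cmod a = 1"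
    and minus: "a \<in> A \<Longrightarrow> - a \<in> A"
    and refl: "a \<in> A \<Longrightarrow> b \<in> A \<Longrightarrow> - (a\<^sup>2 * cnj b) \<in> A"
    and \<xi>: "a \<in> A \<Longrightarrow> \<xi> \<bullet> a \<noteq> 0"
begin

text \<open>The angles of roots relative to a fixed root form a set closed under 2 s - t and under
  adding pi. Its least positive element generates it. The numbering starts at the first root on the
  positive side of \<open>\<xi>\<close>.\<close>

lemma equally_spaced:
  obtains \<theta> \<delta> and m :: nat where "0 < m" "real m * \<delta> = pi"
    "A = range (\<lambda>k::int. cis (\<theta> + real_of_int k * \<delta>))"
    "\<And>k. 0 \<le> k \<Longrightarrow> k < int m \<Longrightarrow> 0 < \<xi> \<bullet> cis (\<theta> + real_of_int k * \<delta>)"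
proof -
  obtain a where a: "a \<in> A" using nonempty by blast
  define \<eta> where "\<eta> = Arg a"
  have a_eq: "a = cis \<eta>" using rcis_cmod_Arg[of a] unit[OF a] by (simp add: rcis_def \<eta>_def)
  define G where "G = {t. cis (\<eta> + t) \<in> A}"
  have G0: "0 \<in> G" using a a_eq by (simp add: G_def)
  have Gpi: "t + pi \<in> G" if "t \<in> G" for t
    using minus[of "cis (\<eta> + t)"] that cis_mult[of "\<eta> + t" pi] by (simp add: G_def add.assoc)
  have Grefl: "2 * s - t \<in> G" if "s \<in> G" "t \<in> G" for s t
  proof -
    have "- ((cis (\<eta> + s))\<^sup>2 * cnj (cis (\<eta> + t))) \<in> A" using refl that by (simp add: G_def)
    moreover have "(cis (\<eta> + s))\<^sup>2 * cnj (cis (\<eta> + t)) = cis (\<eta> + (2 * s - t))"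
      by (simp add: Complex.DeMoivre cis_cnj cis_mult)
    ultimately show ?thesis using minus by (fastforce simp: G_def)
  qed
  have Gneg: "- t \<in> G" if "t \<in> G" for t using Grefl[OF G0 that] by simp
  let ?P = "{t \<in> G. 0 < t \<and> t \<le> pi}"
  have "inj_on (\<lambda>t. cis (\<eta> + t)) ?P"
  proof (rule inj_onI)
    fix s t assume h: "s \<in> ?P" "t \<in> ?P" "cis (\<eta> + s) = cis (\<eta> + t)"
    then have "cis \<eta> * cis s = cis \<eta> * cis t" by (simp add: cis_mult)
    then have "cis s = cis t" by simp
    then have "Arg (cis s) = Arg (cis t)" by simp
    moreover have "Arg (cis s) = s" "Arg (cis t) = t" using h by (auto intro!: Arg_cis)
    ultimately show "s = t" by simp
  qed
  then have finP: "finite ?P"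
    by (rule finite_imageD[rotated]) (rule finite_subset[OF _ finite_A], auto simp: G_def)
  have piP: "pi \<in> ?P" using Gpi[OF G0] by simp
  define \<delta> where "\<delta> = Min ?P"
  have \<delta>: "\<delta> \<in> G" "0 < \<delta>" "\<delta> \<le> pi"
    using Min_in[OF finP] piP unfolding \<delta>_def by blast+
  have min: "\<delta> \<le> t" if "t \<in> G" "0 < t" for t
    using Min_le[OF finP, of t] that \<delta> by (cases "t \<le> pi") (auto simp: \<delta>_def)
  have nat_mult: "real k * \<delta> \<in> G" for k :: nat
  proof (induction k rule: less_induct)
    case (less k)
    consider "k = 0" | "k = 1" | j where "k = j + 2" by (metis One_nat_def Suc_1 add_2_eq_Suc' not0_implies_Suc)
    then show ?case
    proof cases
      case (3 j)
      have "2 * (real (j + 1) * \<delta>) - real j * \<delta> \<in> G" using less[of j] less[of "j + 1"] 3 Grefl by simp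
      moreover have "2 * (real (j + 1) * \<delta>) - real j * \<delta> = real k * \<delta>" using 3 by (simp add: algebra_simps)
      ultimately show ?thesis by simp
    qed (use G0 \<delta> in auto)
  qed
  have int_mult: "real_of_int k * \<delta> \<in> G" for k
    using nat_mult[of "nat k"] Gneg[OF nat_mult[of "nat (- k)"]] by (cases "k \<ge> 0") auto
  have shift: "t + 2 * (real_of_int j * \<delta>) \<in> G" if "t \<in> G" for t j
    using Grefl[OF int_mult Gneg[OF that], of j] by (simp add: add.commute)
  have mult: "\<exists>k. t = real_of_int k * \<delta>" if t: "t \<in> G" for t
  proof -
    define k where "k = \<lfloor>t / \<delta>\<rfloor>"
    define r where "r = t - real_of_int k * \<delta>"
    have r: "0 \<le> r" "r < \<delta>"
      using floor_divide_lower[OF \<delta>(2), of t] floor_divide_upper[OF \<delta>(2), of t]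
      by (auto simp: r_def k_def algebra_simps)
    \<comment> \<open>Only even multiples of \<open>\<delta>\<close> are available as translations
      of \<open>G\<close>, so for an odd quotient the argument uses \<open>\<delta> - r\<close>
      instead of \<open>r\<close>.\<close>
    have "r = 0"
    proof (cases "even k")
      case True
      then obtain j where j: "k = 2 * j" by blast
      have "r \<in> G" using shift[OF t, of "- j"] by (simp add: r_def j algebra_simps)
      then show ?thesis using min[of r] r by force
    next
      case False
      then obtain j where j: "k = 2 * j + 1" using oddE by blast
      have "r - \<delta> \<in> G" using shift[OF t, of "- (j + 1)"] by (simp add: r_def j algebra_simps)
      then have "\<delta> - r \<in> G" using Gneg by fastforce
      then show ?thesis using min[of "\<delta> - r"] r by force
    qed
    then show ?thesis by (auto simp: r_def)
  qed
  have G_eq: "t \<in> G \<longleftrightarrow> (\<exists>k. t = real_of_int k * \<delta>)" for t using mult int_mult by blast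
  obtain M where M: "pi = real_of_int M * \<delta>" using mult piP by blast
  then have "M > 0" using \<delta> by (metis of_int_0_less_iff pi_gt_zero zero_less_mult_pos2)
  define m where "m = nat M"
  have m: "0 < m" "real m * \<delta> = pi" using M \<open>M > 0\<close> by (auto simp: m_def)
  define \<psi> where "\<psi> = Arg \<xi>"
  have \<psi>: "\<xi> \<bullet> cis t = cmod \<xi> * cos (t - \<psi>)" for t by (simp add: inner_cis \<psi>_def)
  \<comment> \<open>Chosen so that \<open>\<theta>\<close> is the first root angle beyond
    \<open>\<psi> - pi / 2\<close>; the next \<open>m\<close> angles then stay within a right angle
    of \<open>\<psi>\<close>.\<close>
  define k0 where "k0 = \<lfloor>(\<psi> - pi / 2 - \<eta>) / \<delta>\<rfloor> + 1"
  define \<theta> where "\<theta> = \<eta> + real_of_int k0 * \<delta>"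
  have \<theta>: "\<psi> - pi / 2 < \<theta>" "\<theta> - \<delta> \<le> \<psi> - pi / 2"
    using floor_divide_lower[OF \<delta>(2), of "\<psi> - pi / 2 - \<eta>"] floor_divide_upper[OF \<delta>(2), of "\<psi> - pi / 2 - \<eta>"]
    by (auto simp: \<theta>_def k0_def algebra_simps)
  have in_A: "cis (\<theta> + real_of_int k * \<delta>) \<in> A" for k
    using int_mult[of "k0 + k"] by (simp add: G_def \<theta>_def algebra_simps)
  have "A \<subseteq> range (\<lambda>k::int. cis (\<theta> + real_of_int k * \<delta>))"
  proof
    fix b assume b: "b \<in> A"
    have "b = cis (\<eta> + (Arg b - \<eta>))" using rcis_cmod_Arg[of b] unit[OF b] by (simp add: rcis_def)
    with b have "Arg b - \<eta> \<in> G" by (simp add: G_def)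
    then obtain k where "Arg b - \<eta> = real_of_int k * \<delta>" using mult by blast
    then have "b = cis (\<theta> + real_of_int (k - k0) * \<delta>)"
      using \<open>b = cis (\<eta> + (Arg b - \<eta>))\<close> by (simp add: \<theta>_def algebra_simps)
    then show "b \<in> range (\<lambda>k::int. cis (\<theta> + real_of_int k * \<delta>))" by blast
  qed
  then have A_eq: "A = range (\<lambda>k::int. cis (\<theta> + real_of_int k * \<delta>))"
    using in_A by auto
  have "0 < \<xi> \<bullet> cis (\<theta> + real_of_int k * \<delta>)" if k: "0 \<le> k" "k < int m" for k
  proof -
    have "real_of_int k * \<delta> \<ge> 0" using k \<delta> by simp
    moreover have "real_of_int k * \<delta> \<le> (real m - 1) * \<delta>" using k \<delta> by (intro mult_right_mono) auto
    moreover have "(real m - 1) * \<delta> = pi - \<delta>" using m by (simp add: left_diff_distrib)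
    ultimately have b: "- (pi / 2) \<le> \<theta> + real_of_int k * \<delta> - \<psi>" "\<theta> + real_of_int k * \<delta> - \<psi> \<le> pi / 2"
      using \<theta> by linarith+
    then have "0 \<le> cos (\<theta> + real_of_int k * \<delta> - \<psi>)" by (intro cos_ge_zero) auto
    then have "0 \<le> \<xi> \<bullet> cis (\<theta> + real_of_int k * \<delta>)" by (simp add: \<psi>)
    then show ?thesis using \<xi>[OF in_A[of k]] by simp
  qed
  with m A_eq that show ?thesis by blast
qed

definition up_step :: "complex \<Rightarrow> complex \<Rightarrow> bool" where
  "up_step q q' \<longleftrightarrow> (\<exists>a\<in>A. 0 < \<xi> \<bullet> a \<and> 0 < a \<bullet> q \<and> q' = - (a\<^sup>2 * cnj q))"

end

text \<open>In units of \<open>\<delta>\<close> the period of the cosine is 2 m, and the bounds say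
  that \<open>t\<close> is farther than \<open>h\<close> from the nearest multiple of the
  period.\<close>

lemma cos_less_scaled:
  fixes h t m \<delta> :: real
  assumes "0 < m" "m * \<delta> = pi" "\<bar>h\<bar> < \<bar>t\<bar>" "\<bar>t\<bar> < 2 * m - \<bar>h\<bar>"
  shows "cos (t * \<delta>) < cos (h * \<delta>)"
proof -
  have \<delta>: "0 < \<delta>" using assms by (metis pi_gt_zero zero_less_mult_pos)
  have c: "cos (x * \<delta>) = cos (\<bar>x\<bar> * \<delta>)" for x
    by (cases "x \<ge> 0") auto
  have mono: "cos (x * \<delta>) < cos (\<bar>h\<bar> * \<delta>)" if "\<bar>h\<bar> < x" "x \<le> m" for x
  proof (rule cos_monotone_0_pi)
    show "0 \<le> \<bar>h\<bar> * \<delta>" using \<delta> by simp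
    show "\<bar>h\<bar> * \<delta> < x * \<delta>" using that \<delta> by (intro mult_strict_right_mono) auto
    have "x * \<delta> \<le> m * \<delta>" using that \<delta> by (intro mult_right_mono) auto
    then show "x * \<delta> \<le> pi" using assms by simp
  qed
  show ?thesis
  proof (cases "\<bar>t\<bar> \<le> m")
    case True
    then show ?thesis using mono[of "\<bar>t\<bar>"] assms c by metis
  next
    case False
    have "(2 * m - \<bar>t\<bar>) * \<delta> = 2 * pi - \<bar>t\<bar> * \<delta>" using assms by (simp add: left_diff_distrib)
    then have "cos ((2 * m - \<bar>t\<bar>) * \<delta>) = cos (\<bar>t\<bar> * \<delta>)" by simp
    then show ?thesis using mono[of "2 * m - \<bar>t\<bar>"] False assms c by simp
  qed
qed

text \<open>Twice the signed area of the triangle; its sign tells on which side of the line through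
  \<open>p\<close> and \<open>q\<close> the point \<open>z\<close> lies.\<close>

definition cross :: "complex \<Rightarrow> complex \<Rightarrow> complex \<Rightarrow> real" where
  "cross p q z = Im (cnj (q - p) * (z - p))"

text \<open>For a chord symmetric about the direction \<open>\<mu>\<close>, comparing the cosines of
  \<open>h\<close> and \<open>t\<close> decides the side of the third point.\<close>

lemma cross_circle:
  "cross (R *\<^sub>R cis (\<mu> - h)) (R *\<^sub>R cis (\<mu> + h)) (R *\<^sub>R cis (\<mu> + t)) = 2 * R\<^sup>2 * sin h * (cos h - cos t)"
proof -
  have "cross (R *\<^sub>R cis a) (R *\<^sub>R cis b) (R *\<^sub>R cis c) = R\<^sup>2 * (sin (c - b) + sin (b - a) - sin (c - a))"
    for a b c
    unfolding cross_def by (simp add: sin_diff algebra_simps power2_eq_square)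
  then have "cross (R *\<^sub>R cis (\<mu> - h)) (R *\<^sub>R cis (\<mu> + h)) (R *\<^sub>R cis (\<mu> + t))
      = R\<^sup>2 * (sin (\<mu> + t - (\<mu> + h)) + sin (\<mu> + h - (\<mu> - h)) - sin (\<mu> + t - (\<mu> - h)))" .
  moreover have "\<mu> + t - (\<mu> + h) = t - h" "\<mu> + h - (\<mu> - h) = h + h" "\<mu> + t - (\<mu> - h) = t + h" by auto
  ultimately have "cross (R *\<^sub>R cis (\<mu> - h)) (R *\<^sub>R cis (\<mu> + h)) (R *\<^sub>R cis (\<mu> + t))
      = R\<^sup>2 * (sin (t - h) + sin (h + h) - sin (t + h))" by metis
  then show ?thesis unfolding sin_add sin_diff by (simp add: algebra_simps)
qed

text \<open>The signed area is affine in its third point, so it vanishes strictly inside the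
  segment. There \<open>w - p\<close> is a real multiple of \<open>q - p\<close>, with factor the
  \<open>\<mu>\<close> of the proof.\<close>

lemma cross_opposite:
  assumes "cross p q z * cross p q z' < 0"
  shows "\<exists>l\<in>{0<..<1}. \<exists>\<mu>. (1 - l) *\<^sub>R z + l *\<^sub>R z' = (1 - \<mu>) *\<^sub>R p + \<mu> *\<^sub>R q"
proof -
  let ?c = "cross p q z" and ?c' = "cross p q z'"
  define l where "l = ?c / (?c - ?c')"
  have ne: "?c - ?c' \<noteq> 0" using assms by (auto simp: mult_less_0_iff)
  have l: "0 < l" "l < 1" using assms
    by (auto simp: l_def mult_less_0_iff zero_less_divide_iff divide_less_eq)
  define w where "w = (1 - l) *\<^sub>R z + l *\<^sub>R z'"
  have "cross p q w = (1 - l) * ?c + l * ?c'"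
    by (simp add: cross_def w_def algebra_simps)
  also have "\<dots> = 0" using ne by (simp add: l_def field_simps)
  finally have im: "Im (cnj (q - p) * (w - p)) = 0" by (simp add: cross_def)
  have "q \<noteq> p" using assms by (auto simp: cross_def)
  define \<mu> where "\<mu> = Re (cnj (q - p) * (w - p)) / (cmod (q - p))\<^sup>2"
  have "cnj (q - p) * (w - p) = complex_of_real (Re (cnj (q - p) * (w - p)))"
    using im by (simp add: complex_eq_iff)
  also have "\<dots> = complex_of_real (\<mu> * (cmod (q - p))\<^sup>2)" using \<open>q \<noteq> p\<close> by (simp add: \<mu>_def)
  also have "\<dots> = cnj (q - p) * (complex_of_real \<mu> * (q - p))"
    using complex_norm_square[of "q - p"] by (simp add: mult.commute mult.left_commute)
  finally have "w - p = complex_of_real \<mu> * (q - p)" using \<open>q \<noteq> p\<close> by simp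
  then have "w = (1 - \<mu>) *\<^sub>R p + \<mu> *\<^sub>R q" by (simp add: scaleR_conv_of_real algebra_simps)
  then show ?thesis using l w_def by (auto intro!: bexI[of _ l] exI[of _ \<mu>])
qed


section \<open>The orbit of a dihedral group, numbered by sectors\<close>

locale dihedral_orbit = planar_roots +
  fixes \<theta> \<delta> :: real and m :: nat and R f :: real
  assumes m: "0 < m" and m_\<delta>: "real m * \<delta> = pi" and A_eq: "A = range (\<lambda>k::int. cis (\<theta> + real_of_int k * \<delta>))"
    and pos: "0 \<le> k \<Longrightarrow> k < int m \<Longrightarrow> 0 < \<xi> \<bullet> cis (\<theta> + real_of_int k * \<delta>)"
    and R: "0 < R" and f: "0 < f" "f < 1"
begin

lemma \<delta>_pos: "0 < \<delta>" using m m_\<delta> by (metis of_nat_0_less_iff pi_gt_zero zero_less_mult_pos)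

text \<open>Neighbouring sectors are mirror images, so the distance of the orbit point from the
  upper line of its sector, in units of \<open>\<delta>\<close>, alternates between \<open>f\<close>
  and \<open>1 - f\<close>.\<close>

definition off :: "int \<Rightarrow> real" where
  "off n = (if even n then f else 1 - f)"

text \<open>The reflecting lines have angles theta + pi/2 + k delta, so \<open>pt n\<close> lies
  between the lines n - 1 and n. Sector 0 contains \<open>\<xi>\<close>, and for |n| <= m exactly
  |n| lines separate it from sector n: |n| is the length in the dihedral group.\<close>

definition pt :: "int \<Rightarrow> complex" where
  "pt n = R *\<^sub>R cis (\<theta> + pi / 2 + (real_of_int n - off n) * \<delta>)"

lemma pt_period_int: "pt (n + 2 * int m * j) = pt n"
proof -
  have "(real_of_int (n + 2 * int m * j) - off (n + 2 * int m * j)) * \<delta>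
      = (real_of_int n - off n) * \<delta> + 2 * pi * real_of_int j"
    using m_\<delta> by (simp add: off_def algebra_simps flip: m_\<delta>)
  then have "pt (n + 2 * int m * j) = R *\<^sub>R (cis (\<theta> + pi / 2 + (real_of_int n - off n) * \<delta>)
      * cis (2 * pi * real_of_int j))"
    by (simp only: pt_def cis_mult add.assoc)
  then show ?thesis by (simp add: pt_def cis_multiple_2pi)
qed

lemma pt_period: "pt (n + 2 * int m) = pt n"
  using pt_period_int[of n 1] by simp

lemma reflect_pt:
  "- ((cis (\<theta> + real_of_int k * \<delta>))\<^sup>2 * cnj (pt n)) = pt (2 * k + 1 - n)"
proof -
  have "off (2 * k + 1 - n) = 1 - off n" by (simp add: off_def)
  then have e: "2 * (\<theta> + real_of_int k * \<delta>) - (\<theta> + pi / 2 + (real_of_int n - off n) * \<delta>) + pi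
     = \<theta> + pi / 2 + (real_of_int (2 * k + 1 - n) - off (2 * k + 1 - n)) * \<delta>"
    by (simp only:) (simp add: algebra_simps)
  have r: "- (cis a ^ 2 * cnj (R *\<^sub>R cis b)) = R *\<^sub>R cis (2 * a - b + pi)" for a b
  proof -
    have "cis (2 * a - b + pi) = - (cis a ^ 2 * cnj (cis b))"
      by (simp add: Complex.DeMoivre cis_cnj cis_mult flip: cis_mult[of _ pi])
    then show ?thesis by simp
  qed
  have "- ((cis (\<theta> + real_of_int k * \<delta>))\<^sup>2 * cnj (pt n)) =
      R *\<^sub>R cis (2 * (\<theta> + real_of_int k * \<delta>) - (\<theta> + pi / 2 + (real_of_int n - off n) * \<delta>) + pi)"
    unfolding pt_def by (rule r)
  then show ?thesis unfolding e by (simp add: pt_def)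
qed

lemma inner_pt:
  "cis (\<theta> + real_of_int k * \<delta>) \<bullet> pt n = R * sin ((real_of_int (k - n) + off n) * \<delta>)"
proof -
  have "\<theta> + real_of_int k * \<delta> - (\<theta> + pi / 2 + (real_of_int n - off n) * \<delta>)
      = (real_of_int (k - n) + off n) * \<delta> - pi / 2"
    by (simp add: algebra_simps)
  then have "cos (\<theta> + real_of_int k * \<delta> - (\<theta> + pi / 2 + (real_of_int n - off n) * \<delta>))
      = sin ((real_of_int (k - n) + off n) * \<delta>)"
    by (simp only: cos_diff) simp
  then show ?thesis unfolding pt_def cis_inner by simp
qed

text \<open>The argument of the sine in \<open>inner_pt\<close> lies in (-pi, 0), (0, pi) or (pi, 2
  pi), according to the three cases of the proof.\<close>

lemma inner_pt_pos_iff: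
  assumes "\<bar>n\<bar> \<le> int m" "0 \<le> k" "k < int m"
  shows "0 < cis (\<theta> + real_of_int k * \<delta>) \<bullet> pt n \<longleftrightarrow> n \<le> k \<and> k - n < int m"
proof -
  have off: "0 < off n" "off n < 1" using f by (auto simp: off_def)
  let ?x = "real_of_int (k - n) + off n"
  have s: "0 < cis (\<theta> + real_of_int k * \<delta>) \<bullet> pt n \<longleftrightarrow> 0 < sin (?x * \<delta>)"
    using R by (simp add: inner_pt zero_less_mult_iff)
  consider "k < n" | "n \<le> k" "k - n < int m" | "k - n \<ge> int m" by linarith
  then show ?thesis
  proof cases
    case 1
    then have "real_of_int (k - n) \<le> -1" "real_of_int (k - n) \<ge> - real m" using assms by linarith+
    then have "?x * \<delta> < 0" "- pi < ?x * \<delta>"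
      using off \<delta>_pos m_\<delta> mult_strict_right_mono[of "- real m" ?x \<delta>] by (auto simp: mult_less_0_iff)
    then have "sin (- (?x * \<delta>)) > 0" by (intro sin_gt_zero) auto
    then show ?thesis unfolding s using 1 by simp
  next
    case 2
    then have "0 \<le> real_of_int (k - n)" "real_of_int (k - n) \<le> real m - 1" by linarith+
    then have "0 < ?x * \<delta>" "?x * \<delta> < pi"
      using off \<delta>_pos m_\<delta> mult_strict_right_mono[of ?x "real m" \<delta>] by auto
    then have "sin (?x * \<delta>) > 0" by (intro sin_gt_zero) auto
    then show ?thesis unfolding s using 2 by simp
  next
    case 3
    then have "real m \<le> real_of_int (k - n)" "real_of_int (k - n) \<le> 2 * real m - 1" using assms by linarith+
    then have l: "real m < ?x" "?x < 2 * real m" using off by linarith+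
    have "real m * \<delta> < ?x * \<delta>" "?x * \<delta> < (2 * real m) * \<delta>"
      using l \<delta>_pos by (intro mult_strict_right_mono; simp)+
    then have "sin (?x * \<delta>) < 0" using m_\<delta> by (intro sin_lt_zero) auto
    then show ?thesis unfolding s using 3 by simp
  qed
qed

lemma positive_roots:
  "a \<in> A \<and> 0 < \<xi> \<bullet> a \<longleftrightarrow> (\<exists>k. 0 \<le> k \<and> k < int m \<and> a = cis (\<theta> + real_of_int k * \<delta>))"
proof
  assume a: "a \<in> A \<and> 0 < \<xi> \<bullet> a"
  then obtain j where j: "a = cis (\<theta> + real_of_int j * \<delta>)" using A_eq by blast
  let ?k = "j mod int m" and ?q = "j div int m"
  have k: "0 \<le> ?k" "?k < int m" using m by auto
  have "real_of_int j = real_of_int ?q * real m + real_of_int ?k"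
    by (metis div_mult_mod_eq of_int_add of_int_mult of_int_of_nat_eq)
  then have e: "\<theta> + real_of_int j * \<delta> = \<theta> + real_of_int ?k * \<delta> + real_of_int ?q * pi"
    using m_\<delta> by (simp add: algebra_simps)
  have "a = cis (\<theta> + real_of_int ?k * \<delta>) * cis (real_of_int ?q * pi)"
    unfolding j e by (simp add: cis_mult)
  moreover have "cis (real_of_int ?q * pi) = (if even ?q then 1 else - 1)"
    by (simp add: complex_eq_iff mult.commute)
  ultimately have a': "a = (if even ?q then cis (\<theta> + real_of_int ?k * \<delta>)
       else - cis (\<theta> + real_of_int ?k * \<delta>))" by simp
  have "even ?q" using a' a pos[OF k] by (auto split: if_splits)
  then show "\<exists>k. 0 \<le> k \<and> k < int m \<and> a = cis (\<theta> + real_of_int k * \<delta>)"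
    using a' k by auto
next
  assume "\<exists>k. 0 \<le> k \<and> k < int m \<and> a = cis (\<theta> + real_of_int k * \<delta>)"
  then show "a \<in> A \<and> 0 < \<xi> \<bullet> a" using pos A_eq by auto
qed

text \<open>The new index is 2 k + 1 - n, not yet reduced modulo 2 m. Folding indices above
  \<open>m\<close> back by 2 m, as in \<open>up_stepE\<close>, gives the dihedral Bruhat graph:
  every step to larger absolute value and other parity.\<close>

lemma up_step_iff:
  assumes n: "\<bar>n\<bar> \<le> int m"
  shows "up_step (pt n) q \<longleftrightarrow>
    (\<exists>n'. \<bar>n\<bar> < n' \<and> n' < 2 * int m - \<bar>n\<bar> \<and> odd (n' - n) \<and> q = pt n')"
proof -
  have "up_step (pt n) q \<longleftrightarrow> (\<exists>k. 0 \<le> k \<and> k < int m \<and>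
     0 < cis (\<theta> + real_of_int k * \<delta>) \<bullet> pt n \<and> q = pt (2 * k + 1 - n))"
    unfolding up_step_def using positive_roots reflect_pt by (smt (verit, best))
  also have "\<dots> \<longleftrightarrow> (\<exists>k. 0 \<le> k \<and> k < int m \<and> n \<le> k \<and> k - n < int m \<and> q = pt (2 * k + 1 - n))"
    using inner_pt_pos_iff[OF n] by blast
  also have "\<dots> \<longleftrightarrow> (\<exists>n'. \<bar>n\<bar> < n' \<and> n' < 2 * int m - \<bar>n\<bar> \<and> odd (n' - n) \<and> q = pt n')"
  proof
    assume "\<exists>k. 0 \<le> k \<and> k < int m \<and> n \<le> k \<and> k - n < int m \<and> q = pt (2 * k + 1 - n)"
    then obtain k where k: "0 \<le> k" "k < int m" "n \<le> k" "k - n < int m" "q = pt (2 * k + 1 - n)" by blast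
    have "odd (2 * k + 1 - n - n)" by simp
    moreover have "\<bar>n\<bar> < 2 * k + 1 - n" "2 * k + 1 - n < 2 * int m - \<bar>n\<bar>" using k by linarith+
    ultimately show "\<exists>n'. \<bar>n\<bar> < n' \<and> n' < 2 * int m - \<bar>n\<bar> \<and> odd (n' - n) \<and> q = pt n'" using k(5) by blast
  next
    assume "\<exists>n'. \<bar>n\<bar> < n' \<and> n' < 2 * int m - \<bar>n\<bar> \<and> odd (n' - n) \<and> q = pt n'"
    then obtain n' where n': "\<bar>n\<bar> < n'" "n' < 2 * int m - \<bar>n\<bar>" "odd (n' - n)" "q = pt n'" by blast
    then obtain j where j: "n' - n = 2 * j + 1" using oddE by blast
    then have "n' = 2 * (n + j) + 1 - n" by simp
    moreover have "0 \<le> n + j" "n + j < int m" "n \<le> n + j" "n + j - n < int m" using n' j by linarith+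
    ultimately show "\<exists>k. 0 \<le> k \<and> k < int m \<and> n \<le> k \<and> k - n < int m \<and> q = pt (2 * k + 1 - n)"
      using n'(4) by blast
  qed
  finally show ?thesis .
qed

lemma up_stepI:
  assumes "\<bar>n\<bar> < \<bar>n'\<bar>" "\<bar>n'\<bar> \<le> int m" "odd (n' - n)"
  shows "up_step (pt n) (pt n')"
proof (cases "n' \<ge> 0")
  case True
  then show ?thesis using assms by (subst up_step_iff) (auto intro!: exI[of _ n'])
next
  case False
  then show ?thesis using assms pt_period[of n']
    by (subst up_step_iff) (auto intro!: exI[of _ "n' + 2 * int m"])
qed

lemma up_stepE:
  assumes "\<bar>n\<bar> \<le> int m" "up_step (pt n) q"
  obtains n' where "\<bar>n\<bar> < \<bar>n'\<bar>" "\<bar>n'\<bar> \<le> int m" "odd (n' - n)" "q = pt n'"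
proof -
  obtain n' where n': "\<bar>n\<bar> < n'" "n' < 2 * int m - \<bar>n\<bar>" "odd (n' - n)" "q = pt n'"
    using assms up_step_iff by blast
  show ?thesis
  proof (cases "n' \<le> int m")
    case True
    then show ?thesis using that[of n'] n' by simp
  next
    case False
    then show ?thesis using that[of "n' - 2 * int m"] n' pt_period[of "n' - 2 * int m"] by simp
  qed
qed

text \<open>By parity a gap other than two would be at least four, leaving room for a path of four
  steps through |n| + 1, |n| + 2 and |n| + 3, which \<open>short\<close> forbids.\<close>

lemma diamond_points:
  assumes n: "\<bar>n\<bar> \<le> int m" and q1: "up_step (pt n) q1" and q2: "up_step q1 q2"
    and short: "\<And>a b c. up_step (pt n) a \<Longrightarrow> up_step a b \<Longrightarrow> up_step b c \<Longrightarrow> \<not> up_step c q2"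
  obtains n2 where "\<bar>n2\<bar> = \<bar>n\<bar> + 2" "\<bar>n2\<bar> \<le> int m" "even (n2 - n)" "q2 = pt n2"
    "q1 = pt (\<bar>n\<bar> + 1) \<or> q1 = pt (- (\<bar>n\<bar> + 1))"
proof -
  obtain n1 where n1: "\<bar>n\<bar> < \<bar>n1\<bar>" "\<bar>n1\<bar> \<le> int m" "odd (n1 - n)" "q1 = pt n1"
    using up_stepE[OF n q1] .
  obtain n2 where n2: "\<bar>n1\<bar> < \<bar>n2\<bar>" "\<bar>n2\<bar> \<le> int m" "odd (n2 - n1)" "q2 = pt n2"
    using up_stepE[OF n1(2)] q2 n1(4) by blast
  have ev: "even (n2 - n)" using n1(3) n2(3) by simp
  have "\<bar>n2\<bar> = \<bar>n\<bar> + 2"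
  proof (rule ccontr)
    assume ne: "\<bar>n2\<bar> \<noteq> \<bar>n\<bar> + 2"
    have "even (\<bar>n2\<bar> - \<bar>n\<bar>)" using ev by simp
    then obtain j where j: "\<bar>n2\<bar> - \<bar>n\<bar> = 2 * j" by blast
    have "2 * j \<ge> 2" "2 * j \<noteq> 2" using j ne n1(1) n2(1) by linarith+
    then have "j \<ge> 2" by presburger
    then have big: "\<bar>n\<bar> + 4 \<le> \<bar>n2\<bar>" using j by linarith
    have "up_step (pt n) (pt (\<bar>n\<bar> + 1))" using big n2(2) by (intro up_stepI) auto
    moreover have "up_step (pt (\<bar>n\<bar> + 1)) (pt (\<bar>n\<bar> + 2))" using big n2(2) by (intro up_stepI) auto
    moreover have "up_step (pt (\<bar>n\<bar> + 2)) (pt (\<bar>n\<bar> + 3))" using big n2(2) by (intro up_stepI) auto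
    moreover have "up_step (pt (\<bar>n\<bar> + 3)) q2"
      unfolding n2(4) using big n2(2) ev by (intro up_stepI) auto
    ultimately show False using short by blast
  qed
  then have "\<bar>n1\<bar> = \<bar>n\<bar> + 1" using n1(1) n2(1) by linarith
  then have "n1 = \<bar>n\<bar> + 1 \<or> n1 = - (\<bar>n\<bar> + 1)" by linarith
  then show ?thesis using that[of n2] \<open>\<bar>n2\<bar> = \<bar>n\<bar> + 2\<close> n2 ev n1(4) by blast
qed

text \<open>The chord has half angle \<open>h * \<delta>\<close>, and the two middle points sit at
  angles \<open>t1 * \<delta>\<close> and \<open>t2 * \<delta>\<close> from its middle direction.
  For each choice of signs of \<open>n\<close> and \<open>n2\<close> exactly one of
  \<open>t1\<close>, \<open>t2\<close> is smaller than \<open>h\<close> in absolute value, so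
  \<open>cross_circle\<close> gives opposite sides.\<close>

lemma opposite_points:
  assumes n2: "\<bar>n2\<bar> = \<bar>n\<bar> + 2" "\<bar>n2\<bar> \<le> int m" "even (n2 - n)"
  shows "cross (pt n) (pt n2) (pt (\<bar>n\<bar> + 1)) * cross (pt n) (pt n2) (pt (- (\<bar>n\<bar> + 1))) < 0"
proof -
  define g where "g = off n"
  define h where "h = (real_of_int n2 - real_of_int n) / 2"
  define mid where "mid = (real_of_int n + real_of_int n2) / 2"
  \<comment> \<open>The middle points have the other parity and offset \<open>1 - g\<close>;
    \<open>e\<close> is the correction that expresses them with offset \<open>g\<close>.\<close>
  define e where "e = 2 * g - 1"
  have g2: "off n2 = g" using n2(3) by (auto simp: off_def g_def)
  have gm: "off (\<bar>n\<bar> + 1) = 1 - g" "off (- (\<bar>n\<bar> + 1)) = 1 - g" by (auto simp: off_def g_def)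
  have e: "- 1 < e" "e < 1" using f by (auto simp: e_def g_def off_def)
  let ?\<mu> = "\<theta> + pi / 2 + (mid - g) * \<delta>"
  define t1 where "t1 = real_of_int (\<bar>n\<bar> + 1) + e - mid"
  define t2 where "t2 = - real_of_int (\<bar>n\<bar> + 1) + e - mid"
  have p: "pt n = R *\<^sub>R cis (?\<mu> - h * \<delta>)"
    "pt n2 = R *\<^sub>R cis (?\<mu> + h * \<delta>)"
    "pt (\<bar>n\<bar> + 1) = R *\<^sub>R cis (?\<mu> + t1 * \<delta>)"
    "pt (- (\<bar>n\<bar> + 1)) = R *\<^sub>R cis (?\<mu> + t2 * \<delta>)"
    unfolding pt_def g2 gm g_def[symmetric]
    by (rule arg_cong[where f = "\<lambda>x. R *\<^sub>R cis x"], simp add: mid_def h_def t1_def t2_def e_def field_simps)+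
  let ?C = "2 * R\<^sup>2 * sin (h * \<delta>)"
  have prod: "cross (pt n) (pt n2) (pt (\<bar>n\<bar> + 1)) * cross (pt n) (pt n2) (pt (- (\<bar>n\<bar> + 1)))
     = ?C\<^sup>2 * ((cos (h * \<delta>) - cos (t1 * \<delta>)) * (cos (h * \<delta>) - cos (t2 * \<delta>)))"
    unfolding p cross_circle by (simp add: power2_eq_square)
  define l where "l = real_of_int \<bar>n\<bar>"
  have l: "0 \<le> l" "l + 2 \<le> real m" using n2 by (auto simp: l_def)
  have n_l: "real_of_int n = l \<or> real_of_int n = - l" by (auto simp: l_def)
  have n2_l: "real_of_int n2 = l + 2 \<or> real_of_int n2 = - (l + 2)" using n2(1) by (auto simp: l_def)
  have t: "t1 = (l + 1) + e - mid" "t2 = - (l + 1) + e - mid" by (auto simp: t1_def t2_def l_def)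
  have hb: "0 < \<bar>h\<bar>" "\<bar>h\<bar> < real m" using n_l n2_l l by (auto simp: h_def)
  have "sin (\<bar>h\<bar> * \<delta>) > 0"
  proof (rule sin_gt_zero)
    show "0 < \<bar>h\<bar> * \<delta>" using hb \<delta>_pos by simp
    have "\<bar>h\<bar> * \<delta> < real m * \<delta>" using hb \<delta>_pos by (intro mult_strict_right_mono)
    then show "\<bar>h\<bar> * \<delta> < pi" using m_\<delta> by simp
  qed
  then have "sin (h * \<delta>) \<noteq> 0" by (cases "h \<ge> 0") auto
  then have C: "?C\<^sup>2 > 0" using R by simp
  have lt: "cos (t * \<delta>) < cos (h' * \<delta>)" if "\<bar>h'\<bar> < \<bar>t\<bar>" "\<bar>t\<bar> < 2 * real m - \<bar>h'\<bar>" for t h'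
    using that m m_\<delta> by (intro cos_less_scaled[of "real m"]) auto
  have "(\<bar>t1\<bar> < \<bar>h\<bar> \<and> \<bar>h\<bar> < \<bar>t2\<bar> \<and> \<bar>t2\<bar> < 2 * real m - \<bar>h\<bar>) \<or>
        (\<bar>t2\<bar> < \<bar>h\<bar> \<and> \<bar>h\<bar> < \<bar>t1\<bar> \<and> \<bar>t1\<bar> < 2 * real m - \<bar>h\<bar>)"
    using n_l n2_l
  proof (elim disjE)
    assume "real_of_int n = l" "real_of_int n2 = l + 2"
    then have "h = 1" "t1 = e" "t2 = - 2 * l - 2 + e" by (simp_all add: h_def t mid_def field_simps)
    then show ?thesis using l e by linarith
  next
    assume "real_of_int n = l" "real_of_int n2 = - (l + 2)"
    then have "h = - l - 1" "t1 = l + 2 + e" "t2 = - l + e" by (simp_all add: h_def t mid_def field_simps)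
    then show ?thesis using l e by linarith
  next
    assume "real_of_int n = - l" "real_of_int n2 = l + 2"
    then have "h = l + 1" "t1 = l + e" "t2 = - l - 2 + e" by (simp_all add: h_def t mid_def field_simps)
    then show ?thesis using l e by linarith
  next
    assume "real_of_int n = - l" "real_of_int n2 = - (l + 2)"
    then have "h = - 1" "t1 = 2 * l + 2 + e" "t2 = e" by (simp_all add: h_def t mid_def field_simps)
    then show ?thesis using l e by linarith
  qed
  then have "(cos (h * \<delta>) - cos (t1 * \<delta>)) * (cos (h * \<delta>) - cos (t2 * \<delta>)) < 0"
    using lt[of t1 h] lt[of h t1] lt[of t2 h] lt[of h t2] hb by (auto simp: mult_less_0_iff)
  then show ?thesis unfolding prod using C by (simp add: mult_pos_neg)
qed

end

context planar_roots begin

lemma diamond: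
  assumes reg: "\<And>a. a \<in> A \<Longrightarrow> a \<bullet> q0 \<noteq> 0" and q1: "up_step q0 q1" and q2: "up_step q1 q2"
    and short: "\<And>a b c. up_step q0 a \<Longrightarrow> up_step a b \<Longrightarrow> up_step b c \<Longrightarrow> \<not> up_step c q2"
  shows "\<exists>q1'. up_step q0 q1' \<and> up_step q1' q2 \<and>
    (\<exists>l\<in>{0<..<1}. \<exists>\<mu>. (1 - l) *\<^sub>R q1 + l *\<^sub>R q1' = (1 - \<mu>) *\<^sub>R q0 + \<mu> *\<^sub>R q2) \<and>
    (\<forall>q. up_step q0 q \<and> up_step q q2 \<longrightarrow> q = q1 \<or> q = q1')"
proof -
  obtain \<theta> \<delta> and m :: nat where m: "0 < m" "real m * \<delta> = pi"
    and A_eq: "A = range (\<lambda>k::int. cis (\<theta> + real_of_int k * \<delta>))"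
    and pos: "\<And>k. 0 \<le> k \<Longrightarrow> k < int m \<Longrightarrow> 0 < \<xi> \<bullet> cis (\<theta> + real_of_int k * \<delta>)"
    by (rule equally_spaced) (rule that; assumption)
  have d: "\<delta> > 0" using m by (metis of_nat_0_less_iff pi_gt_zero zero_less_mult_pos)
  define R where "R = cmod q0"
  \<comment> \<open>The angle of \<open>q0\<close> from the line orthogonal to root 0, in units of
    \<open>\<delta>\<close>. Its ceiling is the number of the sector, and \<open>f\<close> below is
    fitted to make \<open>off N\<close> equal to \<open>N - x\<close>; an integral \<open>x\<close>
    would put \<open>q0\<close> on a reflecting line.\<close>
  define x where "x = (Arg q0 - \<theta> - pi / 2) / \<delta>"
  have q0x: "q0 = R *\<^sub>R cis (\<theta> + pi / 2 + x * \<delta>)"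
    using rcis_cmod_Arg[of q0] d by (simp add: rcis_def scaleR_conv_of_real R_def x_def)
  have "R > 0" using reg nonempty by (auto simp: R_def)
  define N where "N = \<lceil>x\<rceil>"
  have xN: "x \<le> of_int N" "of_int N - 1 < x" unfolding N_def by linarith+
  have "x \<noteq> of_int N"
  proof
    assume e: "x = of_int N"
    have "cis (\<theta> + real_of_int N * \<delta>) \<in> A" using A_eq by auto
    moreover have "cis (\<theta> + real_of_int N * \<delta>) \<bullet> q0 = 0"
    proof -
      have "\<theta> + real_of_int N * \<delta> - (\<theta> + pi / 2 + x * \<delta>) = - (pi / 2)" by (simp add: e)
      then show ?thesis unfolding q0x cis_inner by (simp only:) simp
    qed
    ultimately show False using reg by blast
  qed
  define g where "g = of_int N - x"
  have g: "0 < g" "g < 1" using xN \<open>x \<noteq> of_int N\<close> by (auto simp: g_def)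
  define f where "f = (if even N then g else 1 - g)"
  have f: "0 < f" "f < 1" using g by (auto simp: f_def)
  interpret dihedral_orbit A \<xi> \<theta> \<delta> m R f
    by unfold_locales (use m A_eq pos \<open>R > 0\<close> f in auto)
  have "q0 = pt N" 
  proof -
    have "off N = g" unfolding off_def by (simp add: f_def)
    then have "real_of_int N - off N = x" by (simp add: g_def)
    then show ?thesis unfolding q0x pt_def by simp
  qed
  \<comment> \<open>Reduction modulo the period into the range where the absolute value is the
    dihedral length.\<close>
  define n where "n = (N + int m) mod (2 * int m) - int m"
  have n: "\<bar>n\<bar> \<le> int m"
  proof -
    have "0 \<le> (N + int m) mod (2 * int m)" "(N + int m) mod (2 * int m) < 2 * int m" using m by simp_all
    then show ?thesis by (simp only: n_def abs_le_iff) linarith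
  qed
  have "N = n + 2 * int m * ((N + int m) div (2 * int m))"
    using mult_div_mod_eq[of "2 * int m" "N + int m"] unfolding n_def by linarith
  then have q0: "q0 = pt n" using \<open>q0 = pt N\<close> pt_period_int by metis
  have short': "\<not> up_step c q2" if "up_step (pt n) a" "up_step a b" "up_step b c" for a b c
    using short that by (simp add: q0)
  obtain n2 where n2: "\<bar>n2\<bar> = \<bar>n\<bar> + 2" "\<bar>n2\<bar> \<le> int m" "even (n2 - n)" "q2 = pt n2"
    and q1: "q1 = pt (\<bar>n\<bar> + 1) \<or> q1 = pt (- (\<bar>n\<bar> + 1))"
    by (rule diamond_points[OF n q1[unfolded q0] q2 short'])
  have mids: "up_step q0 (pt (\<bar>n\<bar> + 1))" "up_step (pt (\<bar>n\<bar> + 1)) q2"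
     "up_step q0 (pt (- (\<bar>n\<bar> + 1)))" "up_step (pt (- (\<bar>n\<bar> + 1))) q2"
    unfolding q0 n2(4) using n2 by (intro up_stepI; auto)+
  have only: "q = pt (\<bar>n\<bar> + 1) \<or> q = pt (- (\<bar>n\<bar> + 1))" if "up_step q0 q" "up_step q q2" for q
    by (rule diamond_points[OF n that(1)[unfolded q0] that(2) short'])
  have opp: "cross q0 q2 (pt (\<bar>n\<bar> + 1)) * cross q0 q2 (pt (- (\<bar>n\<bar> + 1))) < 0"
    unfolding q0 n2(4) by (rule opposite_points[OF n2(1-3)])
  show ?thesis
    using q1
  proof
    assume "q1 = pt (\<bar>n\<bar> + 1)"
    then show ?thesis using mids only cross_opposite[OF opp]
      by (intro exI[of _ "pt (- (\<bar>n\<bar> + 1))"]) blast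
  next
    assume "q1 = pt (- (\<bar>n\<bar> + 1))"
    moreover have "cross q0 q2 (pt (- (\<bar>n\<bar> + 1))) * cross q0 q2 (pt (\<bar>n\<bar> + 1)) < 0"
      using opp by (simp add: mult.commute)
    ultimately show ?thesis using mids only cross_opposite
      by (intro exI[of _ "pt (\<bar>n\<bar> + 1)"]) blast
  qed
qed

end

section \<open>Bruhat intervals of length two\<close>

locale orthonormal_plane =
  fixes e1 e2 :: "'v::euclidean_space"
  assumes e: "e1 \<bullet> e1 = 1" "e2 \<bullet> e2 = 1" "e1 \<bullet> e2 = 0"
begin

definition plane :: "'v set" where
  "plane = {v. v = (e1 \<bullet> v) *\<^sub>R e1 + (e2 \<bullet> v) *\<^sub>R e2}"

definition proj :: "'v \<Rightarrow> complex" where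
  "proj v = Complex (e1 \<bullet> v) (e2 \<bullet> v)"

lemma subspace_plane: "subspace plane"
  unfolding subspace_def
proof (intro conjI allI ballI)
  show "0 \<in> plane" by (simp add: plane_def)
  show "a + b \<in> plane" if "a \<in> plane" "b \<in> plane" for a b
  proof -
    have "(e1 \<bullet> (a + b)) *\<^sub>R e1 + (e2 \<bullet> (a + b)) *\<^sub>R e2
      = ((e1 \<bullet> a) *\<^sub>R e1 + (e2 \<bullet> a) *\<^sub>R e2) + ((e1 \<bullet> b) *\<^sub>R e1 + (e2 \<bullet> b) *\<^sub>R e2)"
      by (simp add: inner_add_right scaleR_left_distrib)
    also have "\<dots> = a + b" using that by (simp add: plane_def)
    finally show ?thesis by (simp add: plane_def)
  qed
  show "c *\<^sub>R a \<in> plane" if "a \<in> plane" for c a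
  proof -
    have "(e1 \<bullet> (c *\<^sub>R a)) *\<^sub>R e1 + (e2 \<bullet> (c *\<^sub>R a)) *\<^sub>R e2
      = c *\<^sub>R ((e1 \<bullet> a) *\<^sub>R e1 + (e2 \<bullet> a) *\<^sub>R e2)" by (simp add: scaleR_add_right)
    also have "\<dots> = c *\<^sub>R a" using that by (simp add: plane_def)
    finally show ?thesis by (simp add: plane_def)
  qed
qed

lemma linear_proj: "linear proj"
  by (rule linearI) (simp_all add: proj_def complex_eq_iff inner_add_right)

lemma proj_inner: "b \<in> plane \<Longrightarrow> proj a \<bullet> proj b = a \<bullet> b"
proof -
  assume "b \<in> plane"
  then have "a \<bullet> b = a \<bullet> ((e1 \<bullet> b) *\<^sub>R e1 + (e2 \<bullet> b) *\<^sub>R e2)" by (simp add: plane_def)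
  then show ?thesis by (simp add: proj_def inner_complex_def inner_add_right inner_commute)
qed

lemma proj_inner': "a \<in> plane \<Longrightarrow> proj a \<bullet> proj b = a \<bullet> b"
  using proj_inner[of a b] by (simp add: inner_commute)

lemma proj_eq_0: "v \<in> plane \<Longrightarrow> proj v = 0 \<Longrightarrow> v = 0"
  by (simp add: plane_def proj_def complex_eq_iff)

lemma proj_norm: "a \<in> plane \<Longrightarrow> cmod (proj a) = norm a"
  using proj_inner[of a a] by (simp add: norm_eq_sqrt_inner)

lemma proj_reflect:
  assumes "a \<in> plane" "norm a = 1"
  shows "proj (reflect a v) = - ((proj a)\<^sup>2 * cnj (proj v))"
proof -
  have n: "(Re (proj a))\<^sup>2 + (Im (proj a))\<^sup>2 = 1"
    using proj_norm[OF assms(1)] assms(2) cmod_power2[of "proj a"] by simp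
  have "proj (reflect a v) = proj v - (2 * (proj v \<bullet> proj a)) *\<^sub>R proj a"
    using assms linear_proj by (simp add: reflect_unit linear_diff linear_scale proj_inner inner_commute[of a v])
  also have "\<dots> = - ((proj a)\<^sup>2 * cnj (proj v)) + (1 - ((Re (proj a))\<^sup>2 + (Im (proj a))\<^sup>2)) *\<^sub>R proj v"
    by (simp add: complex_eq_iff inner_complex_def power2_eq_square algebra_simps)
  finally show ?thesis using n by simp
qed

text \<open>The difference of \<open>a\<close> and its projection is orthogonal to the plane, hence
  by assumption to \<open>a\<close>, hence to itself.\<close>

lemma orthogonal_plane_complement:
  assumes "\<And>v. (\<And>w. w \<in> plane \<Longrightarrow> v \<bullet> w = 0) \<Longrightarrow> a \<bullet> v = 0"
  shows "a \<in> plane"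
proof -
  let ?v = "a - ((e1 \<bullet> a) *\<^sub>R e1 + (e2 \<bullet> a) *\<^sub>R e2)"
  have v1: "?v \<bullet> e1 = 0" "?v \<bullet> e2 = 0"
    using e by (simp_all add: inner_diff_left inner_add_left inner_commute[of e2 e1] inner_commute[of a])
  have "?v \<bullet> w = 0" if "w \<in> plane" for w
  proof -
    have "w = (e1 \<bullet> w) *\<^sub>R e1 + (e2 \<bullet> w) *\<^sub>R e2" using that by (simp add: plane_def)
    then have "?v \<bullet> w = ?v \<bullet> ((e1 \<bullet> w) *\<^sub>R e1 + (e2 \<bullet> w) *\<^sub>R e2)" by metis
    then show ?thesis using v1 by (simp add: inner_add_right)
  qed
  then have "a \<bullet> ?v = 0" by (rule assms)
  moreover have "?v \<bullet> ?v = a \<bullet> ?v - (e1 \<bullet> a) * (?v \<bullet> e1) - (e2 \<bullet> a) * (?v \<bullet> e2)"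
    by (simp only: inner_diff_left inner_add_left inner_scaleR_left inner_diff_right inner_add_right
        inner_scaleR_right inner_commute[of a e1] inner_commute[of a e2] inner_commute[of e2 e1])
  ultimately have "?v = 0" using v1 by simp
  then show ?thesis by (simp add: plane_def)
qed

end

context simple_system begin

text \<open>A step along \<open>a\<close> reverses the sign of the inner product with
  \<open>a\<close>, so the next step upwards cannot use \<open>a\<close> again.\<close>

lemma up_up_not_parallel:
  assumes "up x w a" "up w z b"
  shows "a \<noteq> b"
proof
  assume "a = b"
  have "a \<bullet> \<rho> w y = - (a \<bullet> \<rho> x y)"
    using up_act[OF assms(1), of y] assms(1)
    by (simp add: up_def reflect_def inner_diff_right norm_root pos_root)
  then show False using assms \<open>a = b\<close> by (simp add: up_def)
qed

text \<open>The two reflections move \<open>v\<close> by the same vector, a multiple of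
  \<open>a\<close> and of \<open>b\<close>; distinct positive roots are not parallel, so the vector
  is zero.\<close>

lemma reflect_reflect_fixed:
  assumes ab: "a \<in> pos" "b \<in> pos" "a \<noteq> b" and fixed: "reflect b (reflect a v) = v"
  shows "a \<bullet> v = 0"
proof (rule ccontr)
  assume n: "a \<bullet> v \<noteq> 0"
  have na: "norm a = 1" "norm b = 1" using ab norm_root pos_root by auto
  have "reflect a v = reflect b v" using fixed reflect_reflect[of b] by metis
  then have e: "(a \<bullet> v) *\<^sub>R a = (b \<bullet> v) *\<^sub>R b" 
  proof -
    have "2 *\<^sub>R ((a \<bullet> v) *\<^sub>R a) = 2 *\<^sub>R ((b \<bullet> v) *\<^sub>R b)"
      using \<open>reflect a v = reflect b v\<close> na by (simp add: reflect_unit)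
    then show ?thesis by (simp only: scaleR_cancel_left) simp
  qed
  then have "\<bar>a \<bullet> v\<bar> = \<bar>b \<bullet> v\<bar>" using na by (metis mult.right_neutral norm_scaleR)
  moreover have "(a \<bullet> v) * (a \<bullet> y) = (b \<bullet> v) * (b \<bullet> y)" using arg_cong[OF e, of "\<lambda>u. u \<bullet> y"] by simp
  then have "sgn (a \<bullet> v) = sgn (b \<bullet> v)"
    using pos_inner[OF ab(1)] pos_inner[OF ab(2)]
    by (metis mult.right_neutral sgn_mult sgn_pos)
  ultimately have "a \<bullet> v = b \<bullet> v" by (metis sgn_mult_abs)
  then show False using e n ab(3) by simp
qed

text \<open>The steps through \<open>x1\<close> use reflections in the plane of \<open>g1\<close>
  and \<open>g2\<close>, and \<open>planar_roots.diamond\<close> supplies the second middle point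
  there. Any other middle element uses the same plane, because the product of its two reflections is
  the same orthogonal map.\<close>

lemma diamond:
  assumes u1: "up x x1 g1" and u2: "up x1 z g2" and len_z: "len z = len x + 2"
  shows "\<exists>w. (\<exists>a. up x w a) \<and> (\<exists>a. up w z a) \<and>
    (\<exists>l\<in>{0<..<1}. \<exists>\<mu>. (1 - l) *\<^sub>R \<rho> x1 y + l *\<^sub>R \<rho> w y = (1 - \<mu>) *\<^sub>R \<rho> x y + \<mu> *\<^sub>R \<rho> z y) \<and>
    (\<forall>w' a b. up x w' a \<and> up w' z b \<longrightarrow> w' = x1 \<or> w' = w)"
proof -
  have g: "g1 \<in> pos" "g2 \<in> pos" using u1 u2 by (auto simp: up_def)
  have ng: "norm g1 = 1" "norm g2 = 1" using g norm_root pos_root by auto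
  have ne: "g1 \<noteq> g2" by (rule up_up_not_parallel[OF u1 u2])
  define t where "t = g2 - (g1 \<bullet> g2) *\<^sub>R g1"
  have t0: "t \<noteq> 0"
  proof
    assume "t = 0"
    then have e: "g2 = (g1 \<bullet> g2) *\<^sub>R g1" by (simp add: t_def)
    then have "\<bar>g1 \<bullet> g2\<bar> = 1" using ng by (metis mult.right_neutral norm_scaleR)
    moreover have "0 < (g1 \<bullet> g2) * (g1 \<bullet> y)" using pos_inner[OF g(2)] arg_cong[OF e, of "\<lambda>v. v \<bullet> y"] by simp
    ultimately have "g1 \<bullet> g2 = 1" using pos_inner[OF g(1)] by (auto simp: zero_less_mult_iff)
    then show False using e ne by simp
  qed
  define e2 where "e2 = (1 / norm t) *\<^sub>R t"
  have tg: "g1 \<bullet> t = 0" using ng by (simp add: t_def inner_diff_right dot_square_norm)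
  interpret orthonormal_plane g1 e2
    using ng t0 tg by unfold_locales (simp_all add: e2_def dot_square_norm power2_eq_square)
  have g1P: "g1 \<in> plane" using e by (simp add: plane_def inner_commute)
  have e2P: "e2 \<in> plane" using e by (simp add: plane_def inner_commute)
  have "g2 = (g1 \<bullet> g2) *\<^sub>R g1 + norm t *\<^sub>R e2" using t0 by (simp add: e2_def t_def)
  then have g2P: "g2 \<in> plane"
    using g1P e2P subspace_plane by (metis subspace_add subspace_scale)
  let ?A = "proj ` (roots \<inter> plane)" and ?\<xi> = "proj y"
  interpret planar_roots ?A ?\<xi>
  proof
    show "finite ?A" using finite_roots by simp
    show "?A \<noteq> {}" using g1P g pos_root by blast
    show "cmod a = 1" if "a \<in> ?A" for a using that by (auto simp: proj_norm norm_root)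
    show "- a \<in> ?A" if a: "a \<in> ?A" for a
    proof -
      obtain b where b: "b \<in> roots" "b \<in> plane" "a = proj b" using a by blast
      then have "- b \<in> roots \<inter> plane" using minus_root subspace_neg[OF subspace_plane] by blast
      moreover have "- a = proj (- b)" using b linear_neg[OF linear_proj] by simp
      ultimately show ?thesis by blast
    qed
    show "- (a\<^sup>2 * cnj b) \<in> ?A" if ab: "a \<in> ?A" "b \<in> ?A" for a b
    proof -
      obtain a' b' where h: "a' \<in> roots" "a' \<in> plane" "a = proj a'" "b' \<in> roots" "b' \<in> plane" "b = proj b'"
        using ab by blast
      have "reflect a' b' \<in> roots" using act_root[of "rfl a'" b'] rfl[OF h(1)] h by simp
      moreover have "reflect a' b' \<in> plane"
        using h subspace_plane by (simp add: reflect_def subspace_diff subspace_scale)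
      moreover have "- (a\<^sup>2 * cnj b) = proj (reflect a' b')"
        using proj_reflect[OF h(2) norm_root[OF h(1)]] h by simp
      ultimately show ?thesis by blast
    qed
    show "?\<xi> \<bullet> a \<noteq> 0" if "a \<in> ?A" for a
      using that root_inner_y by (auto simp: proj_inner inner_commute[of y])
  qed
  let ?q = "\<lambda>w. proj (\<rho> w y)"
  have to_plane: "up_step (?q u) (?q v) \<and> \<rho> v y - \<rho> u y \<in> plane" if "up u v a" "a \<in> plane" for u v a
  proof -
    have a: "a \<in> pos" "0 < a \<bullet> \<rho> u y" "norm a = 1" using that by (auto simp: up_def norm_root pos_root)
    have "?q v = - ((proj a)\<^sup>2 * cnj (?q u))" using up_act[OF that(1)] proj_reflect[OF that(2) a(3)] by simp
    moreover have "0 < ?\<xi> \<bullet> proj a" using pos_inner[OF a(1)] that(2) by (simp add: proj_inner inner_commute[of y])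
    moreover have "0 < proj a \<bullet> ?q u"
      using a(2) proj_inner'[OF that(2), of "\<rho> u y"] by simp
    ultimately have "up_step (?q u) (?q v)"
      unfolding up_step_def using a(1) pos_root that(2) by blast
    moreover have "\<rho> v y - \<rho> u y \<in> plane"
      using up_step[OF that(1)] that(2) subspace_plane by (simp add: subspace_neg subspace_scale)
    ultimately show ?thesis ..
  qed
  have from_plane: "\<exists>v a. up u v a \<and> ?q v = q \<and> a \<in> plane"
    if "up_step (?q u) q" "u \<in> carrier W" for u q
  proof -
    from that(1) obtain a where a: "a \<in> roots" "a \<in> plane" "0 < ?\<xi> \<bullet> proj a" "0 < proj a \<bullet> ?q u"
       "q = - ((proj a)\<^sup>2 * cnj (?q u))"
      by (auto simp: up_step_def)
    have "a \<in> pos" using a by (simp add: pos_def proj_inner inner_commute[of y])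
    moreover have "0 < a \<bullet> \<rho> u y" using a(4) proj_inner'[OF a(2), of "\<rho> u y"] by simp
    ultimately have "up u (rfl a \<otimes> u) a" using that(2) by (simp add: up_def)
    moreover from this have "?q (rfl a \<otimes> u) = q"
      using up_act[of u "rfl a \<otimes> u" a] a proj_reflect[OF a(2) norm_root[OF a(1)]] by simp
    ultimately show ?thesis using a(2) by blast
  qed
  \<comment> \<open>These orbit points differ from \<open>\<rho> x y\<close> by vectors of the
    plane, so the projection loses nothing.\<close>
  have inj: "v = w" if "\<rho> v y - \<rho> x y \<in> plane" "\<rho> w y - \<rho> x y \<in> plane" "?q v = ?q w"
     "v \<in> carrier W" "w \<in> carrier W" for v w
  proof -
    have "\<rho> v y - \<rho> w y \<in> plane"
      using subspace_diff[OF subspace_plane that(1,2)] by simp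
    moreover have "proj (\<rho> v y - \<rho> w y) = 0" using that(3) linear_diff[OF linear_proj] by simp
    ultimately have "\<rho> v y = \<rho> w y" using proj_eq_0 by fastforce
    then show ?thesis using inj_orbit that(4,5) by (auto dest: inj_onD)
  qed
  have plane_trans: "\<rho> v y - \<rho> x y \<in> plane" if "\<rho> u y - \<rho> x y \<in> plane" "up u v a" "a \<in> plane" for u v a
    using subspace_add[OF subspace_plane that(1), of "\<rho> v y - \<rho> u y"] to_plane[OF that(2,3)] by simp
  have x: "x \<in> carrier W" "x1 \<in> carrier W" "z \<in> carrier W" using u1 u2 up_closed by (auto simp: up_def)
  have xx: "\<rho> x y - \<rho> x y \<in> plane" using subspace_0[OF subspace_plane] by simp
  have x1P: "\<rho> x1 y - \<rho> x y \<in> plane" using plane_trans[OF xx u1 g1P] .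
  have zP: "\<rho> z y - \<rho> x y \<in> plane" using plane_trans[OF x1P u2 g2P] .
  \<comment> \<open>Planar steps lift to Bruhat arrows, and four arrows raise the length by at least
    four.\<close>
  have short: "\<not> up_step c (?q z)" if abc: "up_step (?q x) a" "up_step a b" "up_step b c" for a b c
  proof
    assume d: "up_step c (?q z)"
    obtain w1 a1 where 1: "up x w1 a1" "?q w1 = a" "a1 \<in> plane" using from_plane[OF abc(1) x(1)] by blast
    obtain w2 a2 where 2: "up w1 w2 a2" "?q w2 = b" "a2 \<in> plane"
      using from_plane[of w1 b] abc(2) 1 up_closed by blast
    obtain w3 a3 where 3: "up w2 w3 a3" "?q w3 = c" "a3 \<in> plane"
      using from_plane[of w2 c] abc(3) 2 up_closed by blast
    obtain w4 a4 where 4: "up w3 w4 a4" "?q w4 = ?q z" "a4 \<in> plane"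
      using from_plane[of w3 "?q z"] d 3 up_closed by blast
    have "\<rho> w4 y - \<rho> x y \<in> plane"
      using plane_trans[OF plane_trans[OF plane_trans[OF plane_trans[OF xx 1(1,3)] 2(1,3)] 3(1,3)] 4(1,3)] .
    then have "w4 = z" using inj zP 4 up_closed x by blast
    then show False using up_len[OF 1(1)] up_len[OF 2(1)] up_len[OF 3(1)] up_len[OF 4(1)] len_z by simp
  qed
  have reg: "a \<bullet> ?q x \<noteq> 0" if a: "a \<in> ?A" for a
  proof -
    obtain b where b: "b \<in> roots" "b \<in> plane" "a = proj b" using a by blast
    have "\<rho> (inv x) b \<bullet> y \<noteq> 0" using root_inner_y act_root b x by simp
    moreover have "\<rho> (inv x) b \<bullet> y = b \<bullet> \<rho> x y"
      using act_inner[OF x(1), of "\<rho> (inv x) b" y] x by (simp add: act_inv2)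
    ultimately show ?thesis using b proj_inner'[OF b(2), of "\<rho> x y"] by simp
  qed
  have "\<exists>q'. up_step (?q x) q' \<and> up_step q' (?q z) \<and>
    (\<exists>l\<in>{0<..<1}. \<exists>\<mu>. (1 - l) *\<^sub>R ?q x1 + l *\<^sub>R q' = (1 - \<mu>) *\<^sub>R ?q x + \<mu> *\<^sub>R ?q z) \<and>
    (\<forall>q. up_step (?q x) q \<and> up_step q (?q z) \<longrightarrow> q = ?q x1 \<or> q = q')"
    by (rule planar_roots.diamond[OF planar_roots_axioms])
      (use reg short to_plane[OF u1 g1P] to_plane[OF u2 g2P] in blast)+
  then obtain q' l \<mu> where q': "up_step (?q x) q'" "up_step q' (?q z)" and l: "l \<in> {0<..<1}"
    and eq: "(1 - l) *\<^sub>R ?q x1 + l *\<^sub>R q' = (1 - \<mu>) *\<^sub>R ?q x + \<mu> *\<^sub>R ?q z"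
    and only: "\<And>q. up_step (?q x) q \<Longrightarrow> up_step q (?q z) \<Longrightarrow> q = ?q x1 \<or> q = q'"
    by blast
  obtain w a where w: "up x w a" "?q w = q'" "a \<in> plane" using from_plane[OF q'(1) x(1)] by blast
  have wP: "\<rho> w y - \<rho> x y \<in> plane" using plane_trans[OF xx w(1,3)] .
  obtain z' b where z': "up w z' b" "?q z' = ?q z" "b \<in> plane"
    using from_plane[of w "?q z"] q'(2) w up_closed by blast
  have "z' = z" using inj[OF plane_trans[OF wP z'(1,3)] zP z'(2)] z'(1) up_closed x by blast
  have seg: "(1 - l) *\<^sub>R \<rho> x1 y + l *\<^sub>R \<rho> w y = (1 - \<mu>) *\<^sub>R \<rho> x y + \<mu> *\<^sub>R \<rho> z y"
  proof -
    let ?D = "(1 - l) *\<^sub>R (\<rho> x1 y - \<rho> x y) + l *\<^sub>R (\<rho> w y - \<rho> x y) - \<mu> *\<^sub>R (\<rho> z y - \<rho> x y)"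
    have "?D \<in> plane"
      by (intro subspace_diff subspace_add subspace_scale subspace_plane x1P wP zP)
    moreover have "proj ?D = ((1 - l) *\<^sub>R ?q x1 + l *\<^sub>R q') - ((1 - \<mu>) *\<^sub>R ?q x + \<mu> *\<^sub>R ?q z)"
      by (simp only: linear_diff[OF linear_proj] linear_add[OF linear_proj] linear_scale[OF linear_proj] w(2))
        (simp add: algebra_simps)
    then have "proj ?D = 0" using eq by simp
    ultimately have "?D = 0" by (rule proj_eq_0)
    then show ?thesis by (simp add: algebra_simps)
  qed
  have "w' = x1 \<or> w' = w" if h: "up x w' a'" "up w' z b'" for w' a' b'
  proof -
    have ab: "a' \<in> pos" "b' \<in> pos" "a' \<noteq> b'" using h up_up_not_parallel by (auto simp: up_def)
    \<comment> \<open>The product of the two reflections depends only on \<open>x\<close> and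
      \<open>z\<close>. It agrees with the one through \<open>x1\<close>, which fixes the complement
      of the plane.\<close>
    have "reflect b' (reflect a' v) = v" if v: "\<And>p. p \<in> plane \<Longrightarrow> v \<bullet> p = 0" for v
    proof -
      let ?v = "\<rho> (inv x) v"
      have vx: "\<rho> x ?v = v" using x by (simp add: act_inv2)
      have "reflect g2 (reflect g1 v) = v"
        using v[OF g1P] v[OF g2P] by (simp add: reflect_def inner_commute)
      then have "\<rho> z ?v = v" using up_act[OF u2, of ?v] up_act[OF u1, of ?v] vx by simp
      then show ?thesis using up_act[OF h(2), of ?v] up_act[OF h(1), of ?v] vx by simp
    qed
    note fixed = this
    have a'P: "a' \<in> plane"
      by (rule orthogonal_plane_complement) (rule reflect_reflect_fixed[OF ab fixed])
    have b'P: "b' \<in> plane"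
    proof (rule orthogonal_plane_complement)
      fix v assume v: "\<And>p. p \<in> plane \<Longrightarrow> v \<bullet> p = 0"
      have "a' \<bullet> v = 0" using v[OF a'P] by (simp add: inner_commute)
      then have "reflect b' v = v" using fixed[OF v] by (simp add: reflect_def)
      then show "b' \<bullet> v = 0" using reflect_fixed_iff root_nonzero pos_root ab(2) by metis
    qed
    have "?q w' = ?q x1 \<or> ?q w' = q'"
      using only to_plane[OF h(1) a'P] to_plane[OF h(2) b'P] by blast
    moreover have "\<rho> w' y - \<rho> x y \<in> plane" using plane_trans[OF xx h(1) a'P] .
    moreover have "w' \<in> carrier W" "w \<in> carrier W" using h(1) w(1) up_closed by auto
    ultimately show ?thesis using inj[of w' x1] inj[of w' w] x1P wP x w(2) by metis
  qed
  then show ?thesis using w(1) z'(1) \<open>z' = z\<close> l seg by blast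
qed

end

section \<open>Bruhat chains from \<open>u\<close> to \<open>u c\<close>\<close>

lemma interval_remove_top: "0 < n \<Longrightarrow> {0..n} - {n} = {0..n - 1}" for n :: nat
  by auto

context simple_system begin

lemma coeff_simple_prod:
  assumes "set es \<subseteq> \<Delta>" "d \<in> \<Delta>" "d \<notin> set es"
  shows "\<omega> d \<bullet> \<rho> (simple_prod es) x = \<omega> d \<bullet> x"
  using assms
proof (induction es)
  case (Cons e es)
  have e: "e \<in> \<Delta>" "d \<noteq> e" using Cons.prems by auto
  have "\<rho> (simple_prod (e # es)) x = reflect e (\<rho> (simple_prod es) x)"
    using Cons.prems rfl[OF simple_root[OF e(1)]] by (simp add: act_mult)
  then show ?case using Cons dual[OF Cons.prems(2) e(1)] e(2)
    by (simp add: reflect_def inner_diff_right)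
qed (simp add: act_one)

lemma coweight_fixed:
  assumes "set es \<subseteq> \<Delta>" "d \<in> \<Delta>" "d \<notin> set es"
  shows "\<rho> (simple_prod es) (\<omega> d) = \<omega> d"
  using assms
proof (induction es)
  case (Cons e es)
  have e: "e \<in> \<Delta>" "d \<noteq> e" using Cons.prems by auto
  have "e \<bullet> \<omega> d = 0" using dual[OF Cons.prems(2) e(1)] e(2) by (simp add: inner_commute)
  then show ?case using Cons rfl[OF simple_root[OF e(1)]] by (simp add: act_mult reflect_def)
qed (simp add: act_one)

lemma coweight_nonzero: "d \<in> \<Delta> \<Longrightarrow> \<omega> d \<noteq> 0"
  using dual[of d d] by auto

lemma simple_image_pos:
  assumes "set es \<subseteq> \<Delta>" "d \<in> \<Delta>" "d \<notin> set es"
  shows "\<rho> (simple_prod es) d \<in> pos"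
proof (rule ccontr)
  assume "\<rho> (simple_prod es) d \<notin> pos"
  then have "- \<rho> (simple_prod es) d \<in> pos" using root_act_pos_iff assms simple_root by auto
  from coeff_pos[OF this assms(2)] coeff_simple_prod[OF assms, of d] dual[OF assms(2,2)] show False by simp
qed

text \<open>Only the first letter \<open>e\<close> can alter the \<open>e\<close> coordinate when it
  does not recur, so a fixed vector is orthogonal to \<open>e\<close>, and then it is fixed by the
  rest of the word.\<close>

lemma distinct_fixed:
  assumes "distinct es" "set es \<subseteq> \<Delta>" "\<rho> (simple_prod es) x = x"
  shows "\<forall>d\<in>set es. d \<bullet> x = 0"
  using assms
proof (induction es)
  case (Cons e es)
  have e: "e \<in> \<Delta>" "set es \<subseteq> \<Delta>" "e \<notin> set es" using Cons.prems by auto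
  have "x = reflect e (\<rho> (simple_prod es) x)"
    using Cons.prems(3) e rfl[OF simple_root[OF e(1)]] by (simp add: act_mult)
  then have w: "\<rho> (simple_prod es) x = reflect e x" by (metis reflect_reflect)
  have "\<omega> e \<bullet> reflect e x = \<omega> e \<bullet> x" using coeff_simple_prod[OF e(2,1,3), of x] w by simp
  then have "e \<bullet> x = 0"
    using dual[OF e(1,1)] norm_root[OF simple_root[OF e(1)]] by (simp add: reflect_unit inner_diff_right)
  then have "\<rho> (simple_prod es) x = x" using w by (simp add: reflect_def)
  then show ?case using Cons.IH Cons.prems \<open>e \<bullet> x = 0\<close> by simp
qed simp

lemma orth_simple_0: "(\<And>d. d \<in> \<Delta> \<Longrightarrow> d \<bullet> x = 0) \<Longrightarrow> x = 0"
proof -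
  assume 0: "\<And>d. d \<in> \<Delta> \<Longrightarrow> d \<bullet> x = 0"
  have "x \<bullet> x = (\<Sum>d\<in>\<Delta>. (\<omega> d \<bullet> x) * (d \<bullet> x))"
    by (subst (1) expand[of x]) (simp add: inner_sum_left)
  then show "x = 0" using 0 by simp
qed

lemma inner_orbit_less: "w \<in> carrier W \<Longrightarrow> w \<noteq> \<one> \<Longrightarrow> y \<bullet> \<rho> w y < y \<bullet> y"
proof -
  assume w: "w \<in> carrier W" "w \<noteq> \<one>"
  have "\<Delta> \<noteq> {}" using card_simple DIM_positive[where 'a='v] by force
  then have "\<rho> w y \<noteq> y" using coeff_act_le(2)[OF w(1)] w by blast
  then have "0 < (y - \<rho> w y) \<bullet> (y - \<rho> w y)" by simp
  then show ?thesis using act_inner[OF w(1), of y y]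
    by (simp add: inner_diff_left inner_diff_right inner_commute)
qed

end

section \<open>Chains and the nondegeneracy of their simplices\<close>

locale coxeter_chains = simple_system W \<rho> y \<Delta> \<omega>
  for W :: "('w, 'm) monoid_scheme" (structure)
    and \<rho> :: "'w \<Rightarrow> 'v::euclidean_space \<Rightarrow> 'v" and y :: 'v and \<Delta> \<omega> +
  fixes ds :: "'v list" and c :: 'w
  assumes distinct_ds: "distinct ds" and set_ds: "set ds = \<Delta>" and c_eq: "c = simple_prod ds"
begin

abbreviation r :: nat where "r \<equiv> length ds"

lemma length_ds: "length ds = DIM('v)"
  using distinct_card[OF distinct_ds] set_ds card_simple by simp

lemma c_closed [simp]: "c \<in> carrier W"
  using set_ds by (simp add: c_eq)

lemma inv_c: "inv c = simple_prod (rev ds)"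
  using inv_simple_prod[of ds] set_ds by (simp add: c_eq)

lemma coxeter_fixed: "\<rho> c x = x \<Longrightarrow> x = 0"
  using distinct_fixed[OF distinct_ds, of x] set_ds by (intro orth_simple_0) (auto simp: c_eq)

lemma len_mult_c: "u \<in> carrier W \<Longrightarrow> len (u \<otimes> c) \<le> len u + r"
  using len_mult_le[of u ds] set_ds by (simp add: c_eq)

definition chain :: "(nat \<Rightarrow> 'w) \<Rightarrow> bool" where
  "chain f \<longleftrightarrow> f 0 \<in> carrier W \<and> f r = f 0 \<otimes> c \<and> (\<forall>i<r. cover (f i) (f (Suc i)))"

definition pts :: "(nat \<Rightarrow> 'w) \<Rightarrow> 'v set" where
  "pts f = (\<lambda>i. \<rho> (f i) y) ` {0..r}"

text \<open>Vertex sets rather than hulls, so that exchanging a vertex is an operation on finite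
  sets.\<close>

definition simplices :: "'v set set" where
  "simplices = pts ` Collect chain"

lemma chain_cover: "chain f \<Longrightarrow> i < r \<Longrightarrow> cover (f i) (f (Suc i))"
  by (simp add: chain_def)

lemma chain_closed: "chain f \<Longrightarrow> i \<le> r \<Longrightarrow> f i \<in> carrier W"
  using cover_closed(2)[OF chain_cover[of f "i - 1"]] by (cases i) (auto simp: chain_def)

lemma chain_len: "chain f \<Longrightarrow> i \<le> r \<Longrightarrow> len (f i) = len (f 0) + i"
  by (induction i) (auto simp: chain_def cover_def)

lemma chain_inj: "chain f \<Longrightarrow> i \<le> r \<Longrightarrow> j \<le> r \<Longrightarrow> f i = f j \<longleftrightarrow> i = j"
  by (metis add_left_cancel chain_len)

lemma orbit_eq: "u \<in> carrier W \<Longrightarrow> v \<in> carrier W \<Longrightarrow> \<rho> u y = \<rho> v y \<longleftrightarrow> u = v"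
  using inj_orbit by (auto dest: inj_onD)

lemma chain_pt_inj: "chain f \<Longrightarrow> i \<le> r \<Longrightarrow> j \<le> r \<Longrightarrow> \<rho> (f i) y = \<rho> (f j) y \<longleftrightarrow> i = j"
  using orbit_eq chain_closed chain_inj by metis

lemma chain_pt_inj_on: "chain f \<Longrightarrow> inj_on (\<lambda>i. \<rho> (f i) y) {0..r}"
  by (rule inj_onI) (auto simp: chain_pt_inj)

lemma pts_remove: "chain f \<Longrightarrow> i \<le> r \<Longrightarrow> pts f - {\<rho> (f i) y} = (\<lambda>j. \<rho> (f j) y) ` ({0..r} - {i})"
  unfolding pts_def using inj_on_image_set_diff[OF chain_pt_inj_on, of f "{0..r}" "{i}"] by auto

definition root_at :: "(nat \<Rightarrow> 'w) \<Rightarrow> nat \<Rightarrow> 'v" where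
  "root_at f i = (SOME a. up (f i) (f (Suc i)) a)"

lemma chain_up: "chain f \<Longrightarrow> i < r \<Longrightarrow> up (f i) (f (Suc i)) (root_at f i)"
proof -
  assume "chain f" "i < r"
  then have "\<exists>a. up (f i) (f (Suc i)) a" by (auto simp: chain_def cover_def)
  then show ?thesis unfolding root_at_def by (rule someI_ex)
qed

text \<open>A vector orthogonal to the roots of the chain is fixed by all reflections leading from
  \<open>f 0\<close> to \<open>f 0 c\<close>. Pulled back by \<open>f 0\<close>, it is fixed by
  \<open>c\<close>.\<close>

lemma orth_roots_0:
  assumes f: "chain f" and v: "\<And>i. i < r \<Longrightarrow> root_at f i \<bullet> v = 0"
  shows "v = 0"
proof -
  let ?x = "\<rho> (inv (f 0)) v"
  have f0: "f 0 \<in> carrier W" using f by (simp add: chain_def)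
  have "\<rho> (f i) ?x = v" if "i \<le> r" for i
    using that
  proof (induction i)
    case 0
    show ?case using f0 by (simp add: act_inv2)
  next
    case (Suc i)
    then show ?case using up_act[OF chain_up[OF f], of i ?x] v[of i] by (simp add: reflect_def)
  qed
  from this[of r] have "\<rho> (f 0) (\<rho> c ?x) = v" using f f0 by (simp add: chain_def act_mult)
  then have "\<rho> (inv (f 0)) (\<rho> (f 0) (\<rho> c ?x)) = ?x" by simp
  then have "\<rho> c ?x = ?x" using f0 by (simp add: act_inv1)
  then have "?x = 0" by (rule coxeter_fixed)
  then show ?thesis using f0 act_inv2[OF f0, of v] linear_0[OF act_linear[OF f0]] by simp
qed

text \<open>Consecutive vertices differ by nonzero multiples of the chain roots, so the normal of a
  hyperplane through all vertices would be orthogonal to all these roots.\<close>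

lemma nondegenerate_pts: assumes f: "chain f" shows "nondegenerate (pts f)"
proof -
  have card: "card (pts f) = Suc r"
    unfolding pts_def using card_image[OF chain_pt_inj_on[OF f]] by simp
  have "aff_dim (pts f) = int r"
  proof (rule ccontr)
    assume "aff_dim (pts f) \<noteq> int r"
    then have "aff_dim (pts f) < int DIM('v)" using aff_dim_le_DIM[of "pts f"] length_ds by simp
    then obtain a b where a: "a \<noteq> 0" "pts f \<subseteq> {x. a \<bullet> x = b}" by (rule aff_lowdim_subset_hyperplane)
    have "root_at f i \<bullet> a = 0" if "i < r" for i
    proof -
      have u: "up (f i) (f (Suc i)) (root_at f i)" using chain_up[OF f that] .
      have "\<rho> (f i) y \<in> pts f" "\<rho> (f (Suc i)) y \<in> pts f" using that by (auto simp: pts_def)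
      then have "a \<bullet> \<rho> (f i) y = b" "a \<bullet> \<rho> (f (Suc i)) y = b" using a(2) by auto
      then have "2 * (root_at f i \<bullet> \<rho> (f i) y) * (a \<bullet> root_at f i) = 0"
        unfolding up_step[OF u] by (simp add: inner_diff_right)
      then show ?thesis using u by (auto simp: up_def inner_commute)
    qed
    then show False using orth_roots_0[OF f] a(1) by blast
  qed
  moreover have "finite (pts f)" by (simp add: pts_def)
  ultimately show ?thesis using card affine_independent_iff_card[of "pts f"]
    by (simp add: nondegenerate_def length_ds)
qed

text \<open>By \<open>orth_roots_0\<close> the \<open>r\<close> roots span a space of dimension
  \<open>r\<close>, so they are distinct and form a basis.\<close>

lemma roots_independent:
  assumes f: "chain f" and I: "I \<subseteq> {..<r}" and sum: "(\<Sum>i\<in>I. k i *\<^sub>R root_at f i) = 0" and i: "i \<in> I"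
  shows "k i = 0"
proof -
  let ?G = "root_at f ` {..<r}"
  have spn: "span ?G = UNIV"
  proof (rule ccontr)
    assume "span ?G \<noteq> UNIV"
    then obtain x where x: "x \<noteq> 0" "\<forall>z\<in>span ?G. x \<bullet> z = 0" using span_not_UNIV_orthogonal by blast
    have "root_at f i \<bullet> x = 0" if "i < r" for i
    proof -
      have "root_at f i \<in> span ?G" using that by (intro span_base) auto
      then show ?thesis using x(2) inner_commute by metis
    qed
    then show False using orth_roots_0[OF f, of x] x(1) by blast
  qed
  have cG: "card ?G \<le> r" using card_image_le[of "{..<r}" "root_at f"] by simp
  have ind: "independent ?G" using cG spn length_ds by (intro card_le_dim_spanning[of _ UNIV]) auto
  have "dim (span ?G) = DIM('v)" by (simp only: spn dim_UNIV)
  then have "card ?G = r" using dim_eq_card_independent[OF ind] length_ds by simp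
  then have inj: "inj_on (root_at f) {..<r}" by (intro eq_card_imp_inj_on) auto
  have fI: "finite I" using I finite_subset by blast
  have "(\<Sum>i<r. (if i \<in> I then k i else 0) *\<^sub>R root_at f i) = (\<Sum>i\<in>I. k i *\<^sub>R root_at f i)"
    using I by (intro sum.mono_neutral_cong_right) auto
  then have "(\<Sum>i<r. (if i \<in> I then k i else 0) *\<^sub>R root_at f i) = 0" using sum by simp
  \<comment> \<open>Coefficients indexed by positions become coefficients indexed by vectors, which
    is possible since \<open>root_at f\<close> is injective.\<close>
  define k' where "k' v = (let i = the_inv_into {..<r} (root_at f) v in if i \<in> I then k i else 0)" for v
  have k': "k' (root_at f i) = (if i \<in> I then k i else 0)" if "i < r" for i
    using that the_inv_into_f_f[OF inj] by (simp add: k'_def)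
  have "(\<Sum>v\<in>?G. k' v *\<^sub>R v) = (\<Sum>i<r. k' (root_at f i) *\<^sub>R root_at f i)"
    by (simp add: sum.reindex[OF inj])
  also have "\<dots> = (\<Sum>i<r. (if i \<in> I then k i else 0) *\<^sub>R root_at f i)"
    using k' by (intro sum.cong) auto
  also have "\<dots> = 0" by fact
  finally have 0: "(\<Sum>v\<in>?G. k' v *\<^sub>R v) = 0" .
  have "i < r" using I i by auto
  then have "k' (root_at f i) = 0"
    by (intro independentD[OF ind finite_imageI[OF finite_lessThan] subset_refl 0]) simp
  then show ?thesis using k'[OF \<open>i < r\<close>] i by simp
qed

text \<open>The image of \<open>x\<close> changes at each step by a multiple of the root of that
  step. A zero total forces every multiple to vanish, by independence.\<close>

lemma fixed_along_chain:
  assumes f: "chain f" and jk: "j \<le> k" "k \<le> r" and x: "\<rho> (f k) x = \<rho> (f j) x"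
    and i: "j \<le> i" "i \<le> k"
  shows "\<rho> (f i) x = \<rho> (f j) x"
proof -
  define d where "d i = 2 * (root_at f i \<bullet> \<rho> (f i) x)" for i
  have step: "\<rho> (f (Suc i)) x = \<rho> (f i) x - d i *\<^sub>R root_at f i" if "i < r" for i
    using up_act[OF chain_up[OF f that], of x] chain_up[OF f that]
    by (simp add: d_def reflect_unit up_def norm_root pos_root)
  have tele: "\<rho> (f i) x = \<rho> (f j) x - (\<Sum>i\<in>{j..<i}. d i *\<^sub>R root_at f i)" if "j \<le> i" "i \<le> r" for i
    using that
  proof (induction i rule: dec_induct)
    case (step n)
    then show ?case using \<open>\<And>i. i < r \<Longrightarrow> _\<close> by simp
  qed simp
  have "(\<Sum>i\<in>{j..<k}. d i *\<^sub>R root_at f i) = 0" using tele[of k] jk x by simp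
  moreover have "{j..<k} \<subseteq> {..<r}" using jk by auto
  ultimately have "d i = 0" if "i \<in> {j..<k}" for i
    using roots_independent[OF f, of "{j..<k}" d i] that by auto
  then show ?thesis using tele[of i] i jk by simp
qed


text \<open>The image of the coweight is constant along this part of the chain, so all its vertices
  attain the bound of \<open>coweight_max\<close> for one and the same functional.\<close>

lemma facet_on_boundary:
  assumes f: "chain f" and jk: "j \<le> k" "k \<le> r" and d: "d \<in> \<Delta>"
    and fixed: "\<rho> (f k) (\<omega> d) = \<rho> (f j) (\<omega> d)"
  shows "convex hull ((\<lambda>i. \<rho> (f i) y) ` {j..k}) \<inter> interior (Perm W \<rho> y) = {}"
proof -
  have fj: "f j \<in> carrier W" using chain_closed f jk by simp
  let ?v = "\<rho> (f j) (\<omega> d)" and ?M = "\<omega> d \<bullet> y"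
  have "?v \<noteq> 0"
    using coweight_nonzero[OF d] act_norm[OF fj, of "\<omega> d"] by force
  have "?v \<bullet> \<rho> (f i) y = ?M" if "i \<in> {j..k}" for i
  proof -
    have "\<rho> (f i) (\<omega> d) = ?v" by (rule fixed_along_chain[OF f jk fixed]) (use that in auto)
    then have "?v \<bullet> \<rho> (f i) y = \<rho> (f i) (\<omega> d) \<bullet> \<rho> (f i) y" by simp
    then show ?thesis using act_inner[of "f i"] chain_closed[OF f, of i] that jk by simp
  qed
  then have "convex hull ((\<lambda>i. \<rho> (f i) y) ` {j..k}) \<subseteq> {z. ?v \<bullet> z = ?M}"
    by (intro hull_minimal convex_hyperplane) auto
  moreover have "Perm W \<rho> y \<subseteq> {z. ?v \<bullet> z \<le> ?M}"
    unfolding Perm_def using coweight_max[OF _ fj d]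
    by (intro hull_minimal convex_halfspace_le) auto
  then have "interior (Perm W \<rho> y) \<subseteq> interior {z. ?v \<bullet> z \<le> ?M}" by (rule interior_mono)
  then have "interior (Perm W \<rho> y) \<subseteq> {z. ?v \<bullet> z < ?M}"
    using interior_halfspace_le[OF \<open>?v \<noteq> 0\<close>] by simp
  ultimately show ?thesis by fastforce
qed

text \<open>Since the letters are distinct, the letter deleted by strong exchange is absent from
  what remains, and its coweight is orthogonal to all remaining letters.\<close>

lemma inversion_deletes_letter:
  assumes es: "set es = \<Delta>" "distinct es" and b: "b \<in> pos" and n: "\<rho> (simple_prod es) b \<notin> pos"
  obtains d where "d \<in> \<Delta>" "\<rho> (simple_prod es \<otimes> rfl b) (\<omega> d) = \<omega> d"
proof -
  obtain i where i: "i < length es" "simple_prod es \<otimes> rfl b = simple_prod (take i es @ drop (Suc i) es)"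
    using strong_exchange[OF _ b n] es by blast
  let ?es = "take i es @ drop (Suc i) es"
  have "distinct (take i es @ es ! i # drop (Suc i) es)" using es(2) id_take_nth_drop[OF i(1)] by simp
  then have "es ! i \<notin> set ?es" by auto
  moreover have "set ?es \<subseteq> \<Delta>"
    using es(1) set_take_subset[of i es] set_drop_subset[of "Suc i" es] by auto
  moreover have "es ! i \<in> \<Delta>" using es(1) i(1) by auto
  ultimately show ?thesis using that coweight_fixed i(2) by metis
qed

section \<open>End facets: supporting hyperplane or shifted chain\<close>

lemma opposite_parallel:
  fixes a p q :: 'v
  assumes "0 < k" "0 < k'" "p \<in> F" "q \<in> F"
  shows "\<exists>l\<in>{0<..<1}. (1 - l) *\<^sub>R (p - k *\<^sub>R a) + l *\<^sub>R (q + k' *\<^sub>R a) \<in> affine hull F"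
proof
  \<comment> \<open>The weight at which the two multiples of \<open>a\<close> cancel.\<close>
  let ?l = "k / (k + k')"
  show "?l \<in> {0<..<1}" using assms by simp
  have 1: "(1 - ?l) * k = ?l * k'" using assms by (simp add: field_simps)
  have "(1 - ?l) *\<^sub>R (p - k *\<^sub>R a) + ?l *\<^sub>R (q + k' *\<^sub>R a)
      = (1 - ?l) *\<^sub>R p + ?l *\<^sub>R q + (?l * k' - (1 - ?l) * k) *\<^sub>R a"
    by (simp only: scaleR_diff_right scaleR_add_right scaleR_scaleR scaleR_left_diff_distrib)
      (simp add: algebra_simps)
  then show "(1 - ?l) *\<^sub>R (p - k *\<^sub>R a) + ?l *\<^sub>R (q + k' *\<^sub>R a) \<in> affine hull F"
    unfolding 1 using mem_affine[OF affine_affine_hull, of p F q "1 - ?l" ?l] assms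
    by (simp add: hull_inc)
qed

lemma r_pos: "0 < r" using length_ds by simp

text \<open>Either \<open>b\<close> is an inversion of \<open>c\<close> and the facet lies on the
  boundary, or the window shifts down by one place. Old and new edge use the same root, which puts
  the two end vertices on opposite sides.\<close>

lemma remove_top:
  assumes f: "chain f"
  shows "convex hull (pts f - {\<rho> (f r) y}) \<inter> interior (Perm W \<rho> y) = {} \<or>
    (\<exists>g. chain g \<and> g 0 = f (r - 1) \<otimes> inv c \<and> pts g = insert (\<rho> (g 0) y) (pts f - {\<rho> (f r) y}) \<and>
      (\<exists>l\<in>{0<..<1}. (1 - l) *\<^sub>R \<rho> (f r) y + l *\<^sub>R \<rho> (g 0) y \<in> affine hull (pts f - {\<rho> (f r) y})))"
proof -
  let ?w = "f (r - 1)"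
  have Suc_r: "Suc (r - 1) = r" using r_pos by simp
  have w: "?w \<in> carrier W" "f 0 \<in> carrier W" "f r = f 0 \<otimes> c" using f chain_closed by (auto simp: chain_def)
  have u: "up ?w (f r) (root_at f (r - 1))" using chain_up[OF f, of "r - 1"] r_pos Suc_r by simp
  then obtain b where b: "b \<in> pos" "\<rho> ?w b = root_at f (r - 1)" "f r = ?w \<otimes> rfl b" by (rule up_right)
  have rb: "rfl b \<in> carrier W" "b \<in> roots" "\<rho> (rfl b) = reflect b" using rfl b pos_root by auto
  have w_eq: "?w = f 0 \<otimes> (c \<otimes> rfl b)"
  proof -
    have "?w = f r \<otimes> rfl b" using b w rb by (simp add: m_assoc rfl_rfl)
    then show ?thesis using w rb by (simp add: m_assoc)
  qed
  have facet: "pts f - {\<rho> (f r) y} = (\<lambda>j. \<rho> (f j) y) ` {0..r - 1}"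
    by (simp only: pts_remove[OF f order_refl] interval_remove_top[OF r_pos])
  show ?thesis
  proof (cases "\<rho> c b \<in> pos")
    case False
    then obtain d where d: "d \<in> \<Delta>" "\<rho> (c \<otimes> rfl b) (\<omega> d) = \<omega> d"
      using inversion_deletes_letter[OF set_ds distinct_ds b(1)] c_eq by metis
    then have "\<rho> ?w (\<omega> d) = \<rho> (f 0) (\<omega> d)" using w_eq w rb by (simp add: act_mult)
    then show ?thesis unfolding facet using facet_on_boundary[OF f _ _ d(1), of 0 "r - 1"] by simp
  next
    case True
    let ?w' = "?w \<otimes> inv c" and ?a = "root_at f (r - 1)"
    have a: "?a \<in> pos" "?a \<in> roots" using u pos_root by (auto simp: up_def)
    have w'c: "?w' \<otimes> c = ?w" using w by (simp add: m_assoc)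
    have f0: "f 0 = rfl ?a \<otimes> ?w'"
    proof -
      have "f 0 = f r \<otimes> inv c" using w by (simp add: m_assoc)
      also have "\<dots> = rfl ?a \<otimes> ?w \<otimes> inv c" using u by (simp add: up_def)
      finally show ?thesis using w rfl[OF a(2)] by (simp add: m_assoc)
    qed
    \<comment> \<open>The minus sign makes \<open>?a\<close> negative on
      \<open>\<rho> (f 0) y\<close>, so reflecting \<open>f 0\<close> in \<open>?a\<close> leads
      down, to the new bottom \<open>?w'\<close>.\<close>
    have "?a = - \<rho> (f 0) (\<rho> c b)"
    proof -
      have "?a = \<rho> (f 0) (\<rho> c (reflect b b))" using b(2) w_eq w rb by (metis act_mult c_closed m_closed)
      then show ?thesis using root_nonzero[OF rb(2)] w
        by (simp add: reflect_self linear_neg[OF act_linear])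
    qed
    then have neg: "?a \<bullet> \<rho> (f 0) y < 0" using act_inner[OF w(2)] pos_inner[OF True] by simp
    have "?a \<bullet> \<rho> (f 0) y = - (?a \<bullet> \<rho> ?w' y)"
      using f0 w rfl[OF a(2)] norm_root[OF a(2)] by (simp add: act_mult reflect_unit inner_diff_right dot_square_norm)
    then have u': "up ?w' (f 0) ?a" using neg a f0 w by (simp add: up_def)
    \<comment> \<open>Multiplying by \<open>c\<close> adds at most \<open>r\<close> to the length,
      and \<open>?w\<close> is \<open>r - 1\<close> above \<open>f 0\<close>; so the step from
      \<open>?w'\<close> to \<open>f 0\<close> adds at most one.\<close>
    have "len ?w \<le> len ?w' + r" using len_mult_c[of ?w'] w w'c by simp
    moreover have "len ?w = len (f 0) + (r - 1)" using chain_len[OF f, of "r - 1"] by simp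
    moreover have "len ?w' < len (f 0)" using up_len[OF u'] .
    ultimately have cov: "cover ?w' (f 0)" using u' r_pos by (auto simp: cover_def)
    define g where "g i = (if i = 0 then ?w' else f (i - 1))" for i
    have "cover (g i) (g (Suc i))" if "i < r" for i
      using cov chain_cover[OF f, of "i - 1"] that by (cases i) (auto simp: g_def)
    then have g: "chain g" unfolding chain_def using w w'c r_pos by (auto simp: g_def)
    have "{0..r} = insert 0 (Suc ` {0..r - 1})"
      using r_pos by (metis Suc_r atLeast0_atMost_Suc_eq_insert_0 atLeast0AtMost)
    then have "pts g = insert (\<rho> (g 0) y) ((\<lambda>i. \<rho> (g i) y) ` Suc ` {0..r - 1})"
      by (simp only: pts_def image_insert)
    also have "(\<lambda>i. \<rho> (g i) y) ` Suc ` {0..r - 1} = (\<lambda>i. \<rho> (f i) y) ` {0..r - 1}"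
      unfolding image_image by (intro image_cong) (simp_all add: g_def)
    finally have pg: "pts g = insert (\<rho> (g 0) y) (pts f - {\<rho> (f r) y})" unfolding facet .
    have "\<exists>l\<in>{0<..<1}. (1 - l) *\<^sub>R (\<rho> ?w y - (2 * (?a \<bullet> \<rho> ?w y)) *\<^sub>R ?a)
        + l *\<^sub>R (\<rho> (f 0) y + (2 * (?a \<bullet> \<rho> ?w' y)) *\<^sub>R ?a) \<in> affine hull (pts f - {\<rho> (f r) y})"
    proof (rule opposite_parallel)
      show "\<rho> ?w y \<in> pts f - {\<rho> (f r) y}" "\<rho> (f 0) y \<in> pts f - {\<rho> (f r) y}"
        unfolding facet by (rule image_eqI[OF refl], simp)+
    qed (use u u' in \<open>simp_all add: up_def\<close>)
    moreover have "\<rho> (f 0) y + (2 * (?a \<bullet> \<rho> ?w' y)) *\<^sub>R ?a = \<rho> (g 0) y"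
      using up_step[OF u'] by (simp add: g_def)
    moreover have "\<rho> ?w y - (2 * (?a \<bullet> \<rho> ?w y)) *\<^sub>R ?a = \<rho> (f r) y" using up_step[OF u] by simp
    ultimately have seg: "\<exists>l\<in>{0<..<1}. (1 - l) *\<^sub>R \<rho> (f r) y + l *\<^sub>R \<rho> (g 0) y
        \<in> affine hull (pts f - {\<rho> (f r) y})" by (simp only:)
    have g0: "g 0 = ?w'" by (simp add: g_def)
    show ?thesis by (intro disjI2 exI[of _ g] conjI g g0 pg seg)
  qed
qed

text \<open>The mirror image of \<open>remove_top\<close>: the window shifts up, and the inverse of
  \<open>c\<close>, the reversed word, takes the place of \<open>c\<close>.\<close>

lemma remove_bottom:
  assumes f: "chain f"
  shows "convex hull (pts f - {\<rho> (f 0) y}) \<inter> interior (Perm W \<rho> y) = {} \<or>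
    (\<exists>g. chain g \<and> g r = f 1 \<otimes> c \<and> pts g = insert (\<rho> (g r) y) (pts f - {\<rho> (f 0) y}) \<and>
      (\<exists>l\<in>{0<..<1}. (1 - l) *\<^sub>R \<rho> (f 0) y + l *\<^sub>R \<rho> (g r) y \<in> affine hull (pts f - {\<rho> (f 0) y})))"
proof -
  let ?w = "f 1" and ?a = "root_at f 0"
  have w: "?w \<in> carrier W" "f 0 \<in> carrier W" "f r = f 0 \<otimes> c" "f r \<in> carrier W"
    using f chain_closed[OF f, of 1] chain_closed[OF f, of r] r_pos by (auto simp: chain_def)
  have u: "up (f 0) ?w ?a" using chain_up[OF f r_pos] by simp
  then obtain b where b: "b \<in> pos" "\<rho> (f 0) b = ?a" "?w = f 0 \<otimes> rfl b" by (rule up_right)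
  have rb: "rfl b \<in> carrier W" "b \<in> roots" "\<rho> (rfl b) = reflect b" using rfl b pos_root by auto
  have a: "?a \<in> pos" "?a \<in> roots" using u pos_root by (auto simp: up_def)
  have f0: "f 0 = ?w \<otimes> rfl b" using b w rb by (simp add: m_assoc rfl_rfl)
  have r1: "1 \<le> r" using r_pos by linarith
  have facet: "pts f - {\<rho> (f 0) y} = (\<lambda>j. \<rho> (f j) y) ` {1..r}"
    unfolding pts_remove[OF f le0] by (intro arg_cong[where f = "(`) _"]) auto
  show ?thesis
  proof (cases "\<rho> (inv c) b \<in> pos")
    case False
    then have "\<rho> (simple_prod (rev ds)) b \<notin> pos" by (simp add: inv_c)
    then obtain d where d: "d \<in> \<Delta>" "\<rho> (inv c \<otimes> rfl b) (\<omega> d) = \<omega> d"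
      using inversion_deletes_letter[of "rev ds" b] set_ds distinct_ds b(1) inv_c by auto
    have "\<rho> (f r) (\<omega> d) = \<rho> (f r) (\<rho> (inv c \<otimes> rfl b) (\<omega> d))" by (simp only: d(2))
    also have "\<dots> = \<rho> (f r \<otimes> (inv c \<otimes> rfl b)) (\<omega> d)" using w rb by (simp add: act_mult)
    also have "f r \<otimes> (inv c \<otimes> rfl b) = ?w"
    proof -
      have "f r \<otimes> (inv c \<otimes> rfl b) = f 0 \<otimes> (c \<otimes> inv c) \<otimes> rfl b"
        using w rb by (simp only: w(3) m_assoc m_closed inv_closed c_closed)
      then show ?thesis using w rb b(3) by simp
    qed
    finally show ?thesis unfolding facet using facet_on_boundary[OF f _ _ d(1), of 1 r] r_pos by simp
  next
    case True
    let ?w' = "?w \<otimes> c"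
    have w': "?w' = rfl ?a \<otimes> f r"
      using u w rfl[OF a(2)] by (simp add: up_def m_assoc)
    have "?a \<bullet> \<rho> (f r) y = b \<bullet> \<rho> c y" using b(2) w act_inner[OF w(2)] by (metis act_mult c_closed)
    also have "\<dots> = \<rho> (inv c) b \<bullet> y"
      using act_inner[of c "\<rho> (inv c) b" y] by (simp add: act_inv2)
    finally have u': "up (f r) ?w' ?a" using pos_inner[OF True] a w w' by (simp add: up_def)
    have "len ?w' \<le> len ?w + r" using len_mult_c[of ?w] w by simp
    moreover have "len ?w = len (f 0) + 1" using chain_len[OF f, of 1] r_pos by simp
    moreover have "len (f r) = len (f 0) + r" by (rule chain_len[OF f order_refl])
    moreover have "len (f r) < len ?w'" using up_len[OF u'] .
    ultimately have cov: "cover (f r) ?w'" using u' by (auto simp: cover_def)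
    define g where "g i = (if i = r then ?w' else f (Suc i))" for i
    have "cover (g i) (g (Suc i))" if "i < r" for i
      using cov chain_cover[OF f, of "Suc i"] that by (cases "Suc i = r") (auto simp: g_def)
    then have g: "chain g" unfolding chain_def using w r_pos by (auto simp: g_def)
    have "{0..r} = insert r {0..<r}" by auto
    then have "pts g = insert (\<rho> (g r) y) ((\<lambda>i. \<rho> (g i) y) ` {0..<r})" by (simp add: pts_def)
    also have "(\<lambda>i. \<rho> (g i) y) ` {0..<r} = (\<lambda>i. \<rho> (f i) y) ` Suc ` {0..<r}"
      unfolding image_image by (intro image_cong) (auto simp: g_def)
    also have "Suc ` {0..<r} = {1..r}" by (simp add: atLeastLessThanSuc_atLeastAtMost)
    finally have pg: "pts g = insert (\<rho> (g r) y) (pts f - {\<rho> (f 0) y})" unfolding facet .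
    have "\<exists>l\<in>{0<..<1}. (1 - l) *\<^sub>R (\<rho> (f r) y - (2 * (?a \<bullet> \<rho> (f r) y)) *\<^sub>R ?a)
        + l *\<^sub>R (\<rho> ?w y + (2 * (?a \<bullet> \<rho> (f 0) y)) *\<^sub>R ?a) \<in> affine hull (pts f - {\<rho> (f 0) y})"
    proof (rule opposite_parallel)
      show "\<rho> (f r) y \<in> pts f - {\<rho> (f 0) y}" "\<rho> ?w y \<in> pts f - {\<rho> (f 0) y}"
        unfolding facet by (rule image_eqI[OF refl], use r1 in simp)+
    qed (use u u' in \<open>simp_all add: up_def\<close>)
    moreover have "\<rho> ?w y + (2 * (?a \<bullet> \<rho> (f 0) y)) *\<^sub>R ?a = \<rho> (f 0) y" using up_step[OF u] by simp
    moreover have "\<rho> (f r) y - (2 * (?a \<bullet> \<rho> (f r) y)) *\<^sub>R ?a = \<rho> (g r) y"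
      using up_step[OF u'] by (simp add: g_def)
    ultimately have "\<exists>l\<in>{0<..<1}. (1 - l) *\<^sub>R \<rho> (g r) y + l *\<^sub>R \<rho> (f 0) y
        \<in> affine hull (pts f - {\<rho> (f 0) y})" by (simp only:)
    \<comment> \<open>\<open>opposite_parallel\<close> was applied from the new vertex to the old
      one; replacing \<open>l\<close> by \<open>1 - l\<close> reverses the segment.\<close>
    then obtain l where l: "l \<in> {0<..<1}"
      "(1 - l) *\<^sub>R \<rho> (g r) y + l *\<^sub>R \<rho> (f 0) y \<in> affine hull (pts f - {\<rho> (f 0) y})" by blast
    have "1 - l \<in> {0<..<1}" "(1 - (1 - l)) *\<^sub>R \<rho> (f 0) y + (1 - l) *\<^sub>R \<rho> (g r) y \<in> affine hull (pts f - {\<rho> (f 0) y})"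
      using l by (auto simp: add.commute)
    then have seg: "\<exists>l\<in>{0<..<1}. (1 - l) *\<^sub>R \<rho> (f 0) y + l *\<^sub>R \<rho> (g r) y
        \<in> affine hull (pts f - {\<rho> (f 0) y})" by blast
    have gr: "g r = ?w'" by (simp add: g_def)
    show ?thesis by (intro disjI2 exI[of _ g] conjI g gr pg seg)
  qed
qed

end

section \<open>Middle facets, and uniqueness of the neighbour\<close>

context coxeter_chains begin

text \<open>The diamond places the crossing point on the line through the vertices
  \<open>i - 1\<close> and \<open>i + 1\<close>, and both of these belong to the facet.\<close>

lemma remove_middle:
  assumes f: "chain f" and i: "0 < i" "i < r"
  obtains w where "chain (f(i := w))" "pts (f(i := w)) = insert (\<rho> w y) (pts f - {\<rho> (f i) y})"
    "\<exists>l\<in>{0<..<1}. (1 - l) *\<^sub>R \<rho> (f i) y + l *\<^sub>R \<rho> w y \<in> affine hull (pts f - {\<rho> (f i) y})"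
    "\<And>w'. cover (f (i - 1)) w' \<Longrightarrow> cover w' (f (Suc i)) \<Longrightarrow> w' = f i \<or> w' = w"
proof -
  have S: "Suc (i - 1) = i" using i by simp
  let ?x = "f (i - 1)" and ?z = "f (Suc i)"
  have u1: "up ?x (f i) (root_at f (i - 1))" using chain_up[OF f, of "i - 1"] i S by simp
  have u2: "up (f i) ?z (root_at f i)" using chain_up[OF f i(2)] .
  have len_z: "len ?z = len ?x + 2"
    using chain_len[OF f, of "i - 1"] chain_len[OF f, of "Suc i"] i by simp
  obtain w a b l \<mu> where w: "up ?x w a" "up w ?z b" and l: "l \<in> {0<..<1}"
    and seg: "(1 - l) *\<^sub>R \<rho> (f i) y + l *\<^sub>R \<rho> w y = (1 - \<mu>) *\<^sub>R \<rho> ?x y + \<mu> *\<^sub>R \<rho> ?z y"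
    and only: "\<And>w' a b. up ?x w' a \<Longrightarrow> up w' ?z b \<Longrightarrow> w' = f i \<or> w' = w"
    using diamond[OF u1 u2 len_z] by blast
  have "len ?x < len w" "len w < len ?z" using up_len[OF w(1)] up_len[OF w(2)] by auto
  then have cov: "cover ?x w" "cover w ?z" using w len_z by (auto simp: cover_def)
  have facet: "pts f - {\<rho> (f i) y} = (\<lambda>j. \<rho> (f j) y) ` ({0..r} - {i})"
    using i by (intro pts_remove[OF f]) simp
  have "cover ((f(i := w)) k) ((f(i := w)) (Suc k))" if k: "k < r" for k
  proof -
    consider "Suc k = i" | "k = i" | "k \<noteq> i" "Suc k \<noteq> i" by blast
    then show ?thesis
    proof cases
      case 1
      then have "k = i - 1" "k \<noteq> i" by auto
      then show ?thesis using cov(1) 1 by simp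
    next
      case 2
      then show ?thesis using cov(2) by simp
    next
      case 3
      then show ?thesis using chain_cover[OF f k] by simp
    qed
  qed
  then have ch: "chain (f(i := w))" using f i by (simp add: chain_def)
  have "{0..r} = insert i ({0..r} - {i})" using i by auto
  then have "pts (f(i := w)) = insert (\<rho> w y) ((\<lambda>j. \<rho> ((f(i := w)) j) y) ` ({0..r} - {i}))"
    unfolding pts_def by (metis (no_types, lifting) fun_upd_same image_insert)
  also have "(\<lambda>j. \<rho> ((f(i := w)) j) y) ` ({0..r} - {i}) = pts f - {\<rho> (f i) y}"
    unfolding facet by (intro image_cong) auto
  finally have pg: "pts (f(i := w)) = insert (\<rho> w y) (pts f - {\<rho> (f i) y})" .
  have "\<rho> ?x y \<in> pts f - {\<rho> (f i) y}" "\<rho> ?z y \<in> pts f - {\<rho> (f i) y}"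
    unfolding facet using i by (auto intro!: imageI)
  then have "(1 - \<mu>) *\<^sub>R \<rho> ?x y + \<mu> *\<^sub>R \<rho> ?z y \<in> affine hull (pts f - {\<rho> (f i) y})"
    by (intro mem_affine[OF affine_affine_hull]) (auto simp: hull_inc)
  then have "\<exists>l\<in>{0<..<1}. (1 - l) *\<^sub>R \<rho> (f i) y + l *\<^sub>R \<rho> w y \<in> affine hull (pts f - {\<rho> (f i) y})"
    using l seg by metis
  moreover have "w' = f i \<or> w' = w" if "cover ?x w'" "cover w' ?z" for w'
    using that only by (auto simp: cover_def)
  ultimately show ?thesis using that ch pg by blast
qed

text \<open>Orbit points determine group elements, and lengths determine positions, so the surviving
  vertices occur in \<open>g\<close> in the same order up to one shift.\<close>

lemma swap_vertex:
  assumes f: "chain f" and g: "chain g" and i: "i \<le> r" and eq: "insert x (pts f - {\<rho> (f i) y}) = pts g"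
  shows "\<exists>j\<le>r. x = \<rho> (g j) y \<and> (\<forall>k\<le>r. k \<noteq> i \<longrightarrow>
    (\<exists>k'\<le>r. k' \<noteq> j \<and> g k' = f k \<and> len (f 0) + k = len (g 0) + k'))"
proof -
  have "x \<in> pts g" using eq by blast
  then obtain j where j: "j \<le> r" "x = \<rho> (g j) y" by (auto simp: pts_def)
  have xn: "x \<notin> pts f - {\<rho> (f i) y}"
  proof
    assume "x \<in> pts f - {\<rho> (f i) y}"
    then have e: "pts g = pts f - {\<rho> (f i) y}" using eq by (simp add: insert_absorb)
    have "\<rho> (f i) y \<in> pts f" using i by (auto simp: pts_def)
    then have "card (pts g) < card (pts f)" unfolding e by (intro card_Diff1_less) (simp add: pts_def)
    then show False using nondegenerate_pts[OF f] nondegenerate_pts[OF g] by (simp add: nondegenerate_def)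
  qed
  have "\<exists>k'\<le>r. k' \<noteq> j \<and> g k' = f k \<and> len (f 0) + k = len (g 0) + k'" if k: "k \<le> r" "k \<noteq> i" for k
  proof -
    have "\<rho> (f k) y \<in> pts f - {\<rho> (f i) y}" unfolding pts_remove[OF f i] using k by auto
    then have "\<rho> (f k) y \<in> pts g" "\<rho> (f k) y \<noteq> x" using eq xn by blast+
    then obtain k' where k': "k' \<le> r" "\<rho> (f k) y = \<rho> (g k') y" by (auto simp: pts_def)
    then have "g k' = f k" using orbit_eq chain_closed[OF f k(1)] chain_closed[OF g k'(1)] by metis
    moreover have "k' \<noteq> j" using \<open>\<rho> (f k) y \<noteq> x\<close> k' j by auto
    ultimately show ?thesis using k'(1) chain_len[OF f k(1)] chain_len[OF g k'(1)] by auto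
  qed
  then show ?thesis using j by blast
qed

lemma swap_middle:
  assumes f: "chain f" and g: "chain g" and i: "0 < i" "i < r"
    and eq: "insert x (pts f - {\<rho> (f i) y}) = pts g"
  shows "x = \<rho> (g i) y" "cover (f (i - 1)) (g i)" "cover (g i) (f (Suc i))"
proof -
  have ir: "i \<le> r" using i by simp
  obtain j where j: "j \<le> r" "x = \<rho> (g j) y"
    and s: "\<And>k. k \<le> r \<Longrightarrow> k \<noteq> i \<Longrightarrow> \<exists>k'\<le>r. k' \<noteq> j \<and> g k' = f k \<and> len (f 0) + k = len (g 0) + k'"
    using swap_vertex[OF f g ir eq] by blast
  obtain k0 where k0: "len (f 0) + 0 = len (g 0) + k0" using s[of 0] i by auto
  obtain k1 where k1: "k1 \<le> r" "len (f 0) + r = len (g 0) + k1" using s[of r] i by auto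
  \<comment> \<open>Both ends of \<open>f\<close> survive, and their lengths differ by
    \<open>r\<close>, the whole range available in \<open>g\<close>.\<close>
  have l: "len (f 0) = len (g 0)" using k0 k1 by linarith
  have s': "k \<noteq> j \<and> g k = f k" if "k \<le> r" "k \<noteq> i" for k
    using s[OF that] l by auto
  have "j = i" using s'[of j] j(1) by blast
  then show "x = \<rho> (g i) y" using j(2) by simp
  have "cover (g (i - 1)) (g (Suc (i - 1)))" using i by (intro chain_cover[OF g]) simp
  then show "cover (f (i - 1)) (g i)" using s'[of "i - 1"] i by simp
  show "cover (g i) (f (Suc i))" using chain_cover[OF g i(2)] s'[of "Suc i"] i by simp
qed

text \<open>The surviving vertices have consecutive lengths, so they are the first \<open>r\<close>
  or the last \<open>r\<close> vertices of \<open>g\<close>. The relation \<open>g r = g 0 c\<close>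
  then determines the remaining one.\<close>

lemma swap_top:
  assumes f: "chain f" and g: "chain g" and eq: "insert x (pts f - {\<rho> (f r) y}) = pts g"
  shows "x = \<rho> (f r) y \<or> x = \<rho> (f (r - 1) \<otimes> inv c) y"
proof -
  obtain j where j: "j \<le> r" "x = \<rho> (g j) y"
    and s: "\<And>k. k \<le> r \<Longrightarrow> k \<noteq> r \<Longrightarrow> \<exists>k'\<le>r. k' \<noteq> j \<and> g k' = f k \<and> len (f 0) + k = len (g 0) + k'"
    using swap_vertex[OF f g order_refl eq] by blast
  have r: "0 \<noteq> r" "r - 1 \<noteq> r" "r - 1 \<le> r" "Suc (r - 1) = r" using r_pos by linarith+
  obtain k0 where k0: "len (f 0) + 0 = len (g 0) + k0" using s[OF le0 r(1)] by blast
  obtain k1 where k1: "k1 \<le> r" "len (f 0) + (r - 1) = len (g 0) + k1" using s[OF r(3,2)] by blast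
  have "k0 \<le> 1" using k0 k1 r(4) by linarith
  have g0: "g 0 \<in> carrier W" "g r = g 0 \<otimes> c" and fr: "f r = f 0 \<otimes> c" using f g by (auto simp: chain_def)
  show ?thesis
  proof (cases "k0 = 0")
    case True
    then have l: "len (f 0) = len (g 0)" using k0 by simp
    have s': "k \<noteq> j \<and> g k = f k" if "k < r" for k using s[of k] that l by auto
    have "j = r" using s'[of j] j(1) by (meson nat_less_le)
    moreover have "g 0 = f 0" using s'[OF r_pos] by blast
    ultimately show ?thesis using j(2) g0 fr by simp
  next
    case False
    then have l: "len (f 0) = len (g 0) + 1" using k0 \<open>k0 \<le> 1\<close> by simp
    have s': "Suc k \<noteq> j \<and> g (Suc k) = f k" if "k < r" for k using s[of k] that l by auto
    have "j = 0" 
    proof (rule ccontr)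
      assume "j \<noteq> 0"
      then obtain k where "j = Suc k" using not0_implies_Suc by blast
      then show False using s'[of k] j(1) by simp
    qed
    have "g r = f (r - 1)" using s'[of "r - 1"] r r_pos by simp
    moreover have "g r \<otimes> inv c = g 0" using g0 by (simp add: m_assoc)
    ultimately have "g 0 = f (r - 1) \<otimes> inv c" by simp
    then show ?thesis using j(2) \<open>j = 0\<close> by simp
  qed
qed

lemma swap_bottom:
  assumes f: "chain f" and g: "chain g" and eq: "insert x (pts f - {\<rho> (f 0) y}) = pts g"
  shows "x = \<rho> (f 0) y \<or> x = \<rho> (f 1 \<otimes> c) y"
proof -
  obtain j where j: "j \<le> r" "x = \<rho> (g j) y"
    and s: "\<And>k. k \<le> r \<Longrightarrow> k \<noteq> 0 \<Longrightarrow> \<exists>k'\<le>r. k' \<noteq> j \<and> g k' = f k \<and> len (f 0) + k = len (g 0) + k'"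
    using swap_vertex[OF f g le0 eq] by blast
  have r: "r \<noteq> 0" "1 \<le> r" using r_pos by linarith+
  obtain k0 where k0: "len (f 0) + 1 = len (g 0) + k0" using s[OF r(2)] by auto
  obtain k1 where k1: "k1 \<le> r" "len (f 0) + r = len (g 0) + k1" using s[OF order_refl r(1)] by blast
  have "k0 \<le> 1" using k0 k1 r(2) by linarith
  have g0: "g 0 \<in> carrier W" "g r = g 0 \<otimes> c" and fr: "f 0 \<in> carrier W" "f r = f 0 \<otimes> c"
    using f g by (auto simp: chain_def)
  show ?thesis
  proof (cases "k0 = 1")
    case True
    then have l: "len (f 0) = len (g 0)" using k0 by simp
    have s': "k \<noteq> j \<and> g k = f k" if "k \<le> r" "k \<noteq> 0" for k using s[OF that] l by auto
    have "j = 0" using s'[of j] j(1) by blast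
    moreover have "g r = f r" using s'[OF order_refl r(1)] by blast
    then have "g 0 = f 0" using g0 fr right_cancel[of c "g 0" "f 0"] by simp
    ultimately show ?thesis using j(2) by simp
  next
    case False
    then have l: "len (g 0) = len (f 0) + 1" using k0 \<open>k0 \<le> 1\<close> by simp
    have s': "k \<noteq> j \<and> g k = f (Suc k)" if "k < r" for k using s[of "Suc k"] that l by auto
    have "j = r" using s'[of j] j(1) by (meson nat_less_le)
    moreover have "g 0 = f 1" using s'[OF r_pos] by simp
    ultimately show ?thesis using j(2) g0 by simp
  qed
qed

lemma matched_simplices_Perm: "matched simplices (interior (Perm W \<rho> y))"
  unfolding matched_def
proof (intro ballI impI)
  fix X x assume X: "X \<in> simplices" "x \<in> X" and ne: "convex hull (X - {x}) \<inter> interior (Perm W \<rho> y) \<noteq> {}"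
  then obtain f where f: "chain f" "X = pts f" by (auto simp: simplices_def)
  then obtain i where i: "i \<le> r" "x = \<rho> (f i) y" using X by (auto simp: pts_def)
  let ?P = "\<lambda>x'. insert x' (X - {x}) \<in> simplices \<and>
        (\<exists>l\<in>{0<..<1}. (1 - l) *\<^sub>R x + l *\<^sub>R x' \<in> affine hull (X - {x})) \<and>
        (\<forall>x''. insert x'' (X - {x}) \<in> simplices \<longrightarrow> x'' = x \<or> x'' = x')"
  consider "i = r" | "i = 0" | "0 < i" "i < r" using i(1) by linarith
  then show "\<exists>x'. ?P x'"
  proof cases
    case 1
    have ne': "\<not> convex hull (pts f - {\<rho> (f r) y}) \<inter> interior (Perm W \<rho> y) = {}"
      using ne by (simp only: f(2) i(2) 1 not_False_eq_True)
    then obtain g where g: "chain g" "g 0 = f (r - 1) \<otimes> inv c" "pts g = insert (\<rho> (g 0) y) (pts f - {\<rho> (f r) y})"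
      "\<exists>l\<in>{0<..<1}. (1 - l) *\<^sub>R \<rho> (f r) y + l *\<^sub>R \<rho> (g 0) y \<in> affine hull (pts f - {\<rho> (f r) y})"
      using remove_top[OF f(1)] by blast
    have "?P (\<rho> (g 0) y)"
      unfolding f(2) i(2) 1
    proof (intro conjI allI impI)
      show "insert (\<rho> (g 0) y) (pts f - {\<rho> (f r) y}) \<in> simplices"
        unfolding g(3)[symmetric] simplices_def using g(1) by blast
      show "x'' = \<rho> (f r) y \<or> x'' = \<rho> (g 0) y" if "insert x'' (pts f - {\<rho> (f r) y}) \<in> simplices" for x''
        using that swap_top[OF f(1)] g(2) unfolding simplices_def by auto
    qed (rule g(4))
    then show ?thesis ..
  next
    case 2
    have ne': "\<not> convex hull (pts f - {\<rho> (f 0) y}) \<inter> interior (Perm W \<rho> y) = {}"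
      using ne by (simp only: f(2) i(2) 2 not_False_eq_True)
    then obtain g where g: "chain g" "g r = f 1 \<otimes> c" "pts g = insert (\<rho> (g r) y) (pts f - {\<rho> (f 0) y})"
      "\<exists>l\<in>{0<..<1}. (1 - l) *\<^sub>R \<rho> (f 0) y + l *\<^sub>R \<rho> (g r) y \<in> affine hull (pts f - {\<rho> (f 0) y})"
      using remove_bottom[OF f(1)] by blast
    have "?P (\<rho> (g r) y)"
      unfolding f(2) i(2) 2
    proof (intro conjI allI impI)
      show "insert (\<rho> (g r) y) (pts f - {\<rho> (f 0) y}) \<in> simplices"
        unfolding g(3)[symmetric] simplices_def using g(1) by blast
      show "x'' = \<rho> (f 0) y \<or> x'' = \<rho> (g r) y" if "insert x'' (pts f - {\<rho> (f 0) y}) \<in> simplices" for x''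
        using that swap_bottom[OF f(1)] g(2) unfolding simplices_def by auto
    qed (rule g(4))
    then show ?thesis ..
  next
    case 3
    obtain w where w: "chain (f(i := w))" "pts (f(i := w)) = insert (\<rho> w y) (pts f - {\<rho> (f i) y})"
    "\<exists>l\<in>{0<..<1}. (1 - l) *\<^sub>R \<rho> (f i) y + l *\<^sub>R \<rho> w y \<in> affine hull (pts f - {\<rho> (f i) y})"
    "\<And>w'. cover (f (i - 1)) w' \<Longrightarrow> cover w' (f (Suc i)) \<Longrightarrow> w' = f i \<or> w' = w"
      by (rule remove_middle[OF f(1) 3]) blast
    have "?P (\<rho> w y)"
      unfolding f(2) i(2)
    proof (intro conjI allI impI)
      show "insert (\<rho> w y) (pts f - {\<rho> (f i) y}) \<in> simplices"
        unfolding w(2)[symmetric] simplices_def using w(1) by blast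
      show "x'' = \<rho> (f i) y \<or> x'' = \<rho> w y" if h: "insert x'' (pts f - {\<rho> (f i) y}) \<in> simplices" for x''
      proof -
        obtain g where g: "chain g" "insert x'' (pts f - {\<rho> (f i) y}) = pts g"
          using h by (auto simp: simplices_def)
        show ?thesis using swap_middle(1)[OF f(1) g(1) 3 g(2)] w(4)[OF swap_middle(2,3)[OF f(1) g(1) 3 g(2)]]
          by auto
      qed
    qed (rule w(3))
    then show ?thesis ..
  qed
qed

end

section \<open>Simplices at the base point\<close>

lemma distinct_delete_nth:
  assumes "distinct es" "i < length es"
  shows "take i es @ drop (Suc i) es = filter (\<lambda>e. e \<noteq> es ! i) es"
proof -
  have s: "es = take i es @ es ! i # drop (Suc i) es" using assms(2) by (rule id_take_nth_drop)
  then have "distinct (take i es @ es ! i # drop (Suc i) es)" using assms(1) by simp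
  then have n: "es ! i \<notin> set (take i es)" "es ! i \<notin> set (drop (Suc i) es)" by auto
  have "filter (\<lambda>e. e \<noteq> es ! i) es = filter (\<lambda>e. e \<noteq> es ! i) (take i es @ es ! i # drop (Suc i) es)"
    using s by simp
  also have "\<dots> = filter (\<lambda>e. e \<noteq> es ! i) (take i es) @ filter (\<lambda>e. e \<noteq> es ! i) (drop (Suc i) es)"
    by simp
  also have "filter (\<lambda>e. e \<noteq> es ! i) (take i es) = take i es" using n(1) by (intro filter_True) auto
  also have "filter (\<lambda>e. e \<noteq> es ! i) (drop (Suc i) es) = drop (Suc i) es" using n(2) by (intro filter_True) auto
  finally show ?thesis by simp
qed

context simple_system begin

text \<open>The coordinates in which the orbit point has dropped; for a product of distinct simple
  reflections these are the letters.\<close>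

definition supp :: "'w \<Rightarrow> 'v set" where
  "supp u = {d \<in> \<Delta>. 0 < \<omega> d \<bullet> (y - \<rho> u y)}"

text \<open>A letter \<open>e\<close> lowers its own coordinate strictly: the inverse of the later
  letters, which do not include \<open>e\<close>, sends \<open>e\<close> to a positive root.\<close>

lemma supp_simple_prod:
  assumes "distinct es" "set es \<subseteq> \<Delta>"
  shows "supp (simple_prod es) = set es"
proof -
  have "\<omega> d \<bullet> \<rho> (simple_prod es) y < \<omega> d \<bullet> y" if "d \<in> set es" for d
    using assms that
  proof (induction es)
    case (Cons e es)
    have e: "e \<in> \<Delta>" "set es \<subseteq> \<Delta>" "e \<notin> set es" using Cons.prems by auto
    let ?z = "\<rho> (simple_prod es) y"
    have z: "\<rho> (simple_prod (e # es)) y = ?z - (2 * (e \<bullet> ?z)) *\<^sub>R e"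
      using e rfl[OF simple_root[OF e(1)]] norm_root[OF simple_root[OF e(1)]]
      by (simp add: act_mult reflect_unit)
    have "e \<bullet> ?z = \<rho> (inv (simple_prod es)) e \<bullet> y"
      using act_inner[of "simple_prod es" "\<rho> (inv (simple_prod es)) e" y] e by (simp add: act_inv2)
    then have pos: "0 < e \<bullet> ?z"
      using simple_image_pos[of "rev es" e] e by (simp add: inv_simple_prod pos_inner)
    show ?case
    proof (cases "d = e")
      case True
      then show ?thesis unfolding z
        using coeff_simple_prod[OF e(2,1,3), of y] dual[OF e(1,1)] pos by (simp add: inner_diff_right)
    next
      case False
      then have "d \<in> set es" "d \<in> \<Delta>" using Cons.prems by auto
      then show ?thesis unfolding z
        using Cons.IH Cons.prems dual[OF \<open>d \<in> \<Delta>\<close> e(1)] False by (simp add: inner_diff_right)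
    qed
  qed simp
  moreover have "\<omega> d \<bullet> \<rho> (simple_prod es) y = \<omega> d \<bullet> y" if "d \<in> \<Delta>" "d \<notin> set es" for d
    using coeff_simple_prod[OF assms(2) that] .
  ultimately have "d \<in> supp (simple_prod es) \<longleftrightarrow> d \<in> set es" if "d \<in> \<Delta>" for d
    using that by (cases "d \<in> set es") (simp_all add: supp_def inner_diff_right)
  then show ?thesis using assms(2) by (auto simp: supp_def)
qed

text \<open>Going down is a strong exchange, and in a word with distinct letters the deleted
  position can be named by its letter.\<close>

lemma up_to_subword:
  assumes es: "distinct es" "set es \<subseteq> \<Delta>" and u: "up u (simple_prod es) a"
  obtains d where "d \<in> set es" "u = simple_prod (filter (\<lambda>e. e \<noteq> d) es)"
proof -
  obtain b where b: "b \<in> pos" "\<rho> u b = a" "simple_prod es = u \<otimes> rfl b" using up_right[OF u] .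
  have uc: "u \<in> carrier W" "a \<in> pos" using u by (auto simp: up_def)
  have rb: "rfl b \<in> carrier W" "b \<in> roots" "\<rho> (rfl b) = reflect b" using rfl b pos_root by auto
  have ueq: "simple_prod es \<otimes> rfl b = u" using b uc rb by (simp add: m_assoc rfl_rfl)
  have "\<rho> (simple_prod es) b = - a"
    using b uc rb root_nonzero[OF rb(2)] by (simp add: act_mult reflect_self linear_neg[OF act_linear])
  then have "\<rho> (simple_prod es) b \<notin> pos" using not_pos_and_neg[OF uc(2)] by simp
  then obtain i where "i < length es" "simple_prod es \<otimes> rfl b = simple_prod (take i es @ drop (Suc i) es)"
    using strong_exchange[OF es(2) b(1)] by blast
  then show ?thesis using that[of "es ! i"] distinct_delete_nth[OF es(1)] ueq by simp
qed

end

context coxeter_chains begin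

text \<open>Descending from \<open>g r = c\<close>, each step deletes one letter. The chain is thus
  a complete flag of letter sets, and each element is the subword of \<open>c\<close> on its
  set.\<close>

lemma chain_from_one:
  assumes g: "chain g" "g 0 = \<one>" and i: "i \<le> r"
  shows "card (supp (g i)) = i \<and> g i = simple_prod (filter (\<lambda>e. e \<in> supp (g i)) ds) \<and>
    (i < r \<longrightarrow> (\<exists>d\<in>supp (g (Suc i)). supp (g i) = supp (g (Suc i)) - {d}))"
  using i
proof (induction i rule: inc_induct)
  case base
  have "g r = simple_prod ds" using g by (simp add: chain_def c_eq[symmetric])
  moreover have "supp (simple_prod ds) = \<Delta>" using supp_simple_prod[OF distinct_ds] set_ds by simp
  moreover have "filter (\<lambda>e. e \<in> \<Delta>) ds = ds" using set_ds by (intro filter_True) auto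
  ultimately show ?case using card_simple length_ds by simp
next
  case (step n)
  let ?es = "filter (\<lambda>e. e \<in> supp (g (Suc n))) ds"
  have IH: "card (supp (g (Suc n))) = Suc n" "g (Suc n) = simple_prod ?es" using step.IH by auto
  have es: "distinct ?es" "set ?es \<subseteq> \<Delta>" using distinct_ds set_ds by auto
  have set_es: "set ?es = supp (g (Suc n))" using set_ds by (auto simp: supp_def)
  have "up (g n) (simple_prod ?es) (root_at g n)" using chain_up[OF g(1) step.hyps(2)] IH(2) by simp
  then obtain d where d: "d \<in> set ?es" "g n = simple_prod (filter (\<lambda>e. e \<noteq> d) ?es)"
    using up_to_subword[OF es] by blast
  have s: "supp (g n) = supp (g (Suc n)) - {d}"
  proof -
    have "supp (g n) = set (filter (\<lambda>e. e \<noteq> d) ?es)"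
      unfolding d(2) using distinct_ds es(2) by (intro supp_simple_prod distinct_filter) auto
    also have "\<dots> = set ?es - {d}" by auto
    finally show ?thesis using set_es by simp
  qed
  have dS: "d \<in> supp (g (Suc n))" using d(1) set_es by simp
  have "card (supp (g n)) = n"
    using s dS IH(1) by (metis card_Diff_singleton diff_Suc_1)
  moreover have "g n = simple_prod (filter (\<lambda>e. e \<in> supp (g n)) ds)"
    unfolding s using d(2) by (simp add: conj_commute)
  ultimately show ?case using s dS by blast
qed

lemma supp_mono:
  assumes g: "chain g" "g 0 = \<one>" and ij: "i \<le> j" "j \<le> r"
  shows "supp (g i) \<subseteq> supp (g j)"
  using ij
proof (induction j rule: dec_induct)
  case (step n)
  then have "supp (g n) \<subseteq> supp (g (Suc n))" using chain_from_one[OF g, of n] by auto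
  then show ?case using step by auto
qed simp

lemma cone_coeff:
  assumes g: "chain g" "g 0 = \<one>" and k: "k \<le> r" and d: "d \<in> \<Delta>"
  shows "0 \<le> \<omega> d \<bullet> (y - \<rho> (g k) y)"
    and "i \<le> k \<Longrightarrow> d \<notin> supp (g k) \<Longrightarrow> \<omega> d \<bullet> (y - \<rho> (g i) y) = 0"
proof -
  have *: "0 \<le> \<omega> d \<bullet> (y - \<rho> (g k) y)" if "k \<le> r" for k
    using coeff_act_le(1)[OF chain_closed[OF g(1) that] d] by (simp add: inner_diff_right)
  then show "0 \<le> \<omega> d \<bullet> (y - \<rho> (g k) y)" using k by blast
  assume i: "i \<le> k" "d \<notin> supp (g k)"
  then have "d \<notin> supp (g i)" using supp_mono[OF g i(1) k] by blast
  then show "\<omega> d \<bullet> (y - \<rho> (g i) y) = 0" using *[of i] i k d by (auto simp: supp_def)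
qed

text \<open>Comparing the coefficients of a simple root that occurs only in the last vertex forces the
  last weights to agree, so the two chains can be peeled off from the top.\<close>

lemma cone_unique:
  assumes f: "chain f" "f 0 = \<one>" and g: "chain g" "g 0 = \<one>"
    and p: "\<And>i. i \<le> r \<Longrightarrow> 0 < p i" and q: "\<And>i. i \<le> r \<Longrightarrow> 0 \<le> q i"
    and eq: "(\<Sum>i\<le>r. p i *\<^sub>R (y - \<rho> (f i) y)) = (\<Sum>i\<le>r. q i *\<^sub>R (y - \<rho> (g i) y))"
    and k: "k \<le> r"
  shows "f k = g k \<and> (\<Sum>i\<le>k. p i *\<^sub>R (y - \<rho> (f i) y)) = (\<Sum>i\<le>k. q i *\<^sub>R (y - \<rho> (g i) y))"
  using k
proof (induction k rule: inc_induct)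
  case base
  show ?case using eq f g by (simp add: chain_def)
next
  case (step k)
  let ?M = "\<lambda>h i. y - \<rho> (h i) y"
  let ?S = "supp (f (Suc k))"
  have kr: "Suc k \<le> r" "k < r" "k \<le> r" using step.hyps by auto
  have fg: "f (Suc k) = g (Suc k)" using step.IH by blast
  obtain d where d: "d \<in> ?S" "supp (f k) = ?S - {d}" using chain_from_one[OF f kr(3)] kr by blast
  obtain d' where d': "d' \<in> ?S" "supp (g k) = ?S - {d'}" using chain_from_one[OF g kr(3)] kr fg by auto
  have D: "d \<in> \<Delta>" "d' \<in> \<Delta>" using d d' by (auto simp: supp_def)
  have e: "(\<Sum>i\<le>k. p i *\<^sub>R ?M f i) + p (Suc k) *\<^sub>R ?M f (Suc k)
      = (\<Sum>i\<le>k. q i *\<^sub>R ?M g i) + q (Suc k) *\<^sub>R ?M f (Suc k)"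
    using step.IH fg by (simp add: atMost_Suc add.commute)
  have ce: "(\<Sum>i\<le>k. p i * (\<omega> b \<bullet> ?M f i)) + p (Suc k) * (\<omega> b \<bullet> ?M f (Suc k))
      = (\<Sum>i\<le>k. q i * (\<omega> b \<bullet> ?M g i)) + q (Suc k) * (\<omega> b \<bullet> ?M f (Suc k))" for b
    using arg_cong[OF e, of "\<lambda>v. \<omega> b \<bullet> v"] by (simp add: inner_add_right inner_sum_right)
  have f0: "(\<Sum>i\<le>k. p i * (\<omega> d \<bullet> ?M f i)) = 0"
    using cone_coeff(2)[OF f kr(3) D(1)] d(2) by (intro sum.neutral) auto
  have g0: "(\<Sum>i\<le>k. q i * (\<omega> d' \<bullet> ?M g i)) = 0"
    using cone_coeff(2)[OF g kr(3) D(2)] d'(2) by (intro sum.neutral) auto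
  have "0 \<le> (\<Sum>i\<le>k. q i * (\<omega> d \<bullet> ?M g i))"
    using cone_coeff(1)[OF g _ D(1)] q kr by (intro sum_nonneg mult_nonneg_nonneg) auto
  then have "q (Suc k) * (\<omega> d \<bullet> ?M f (Suc k)) \<le> p (Suc k) * (\<omega> d \<bullet> ?M f (Suc k))"
    using ce[of d] f0 by linarith
  then have 1: "q (Suc k) \<le> p (Suc k)" using d(1) by (simp add: supp_def)
  have nn: "0 \<le> p i * (\<omega> d' \<bullet> ?M f i)" if "i \<le> k" for i
    using cone_coeff(1)[OF f _ D(2), of i] p[of i] that kr by simp
  then have "0 \<le> (\<Sum>i\<le>k. p i * (\<omega> d' \<bullet> ?M f i))" by (intro sum_nonneg) auto
  then have "p (Suc k) * (\<omega> d' \<bullet> ?M f (Suc k)) \<le> q (Suc k) * (\<omega> d' \<bullet> ?M f (Suc k))"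
    using ce[of d'] g0 by linarith
  then have "p (Suc k) \<le> q (Suc k)" using d'(1) by (simp add: supp_def)
  with 1 have pq: "p (Suc k) = q (Suc k)" by simp
  \<comment> \<open>Each summand is now zero. As \<open>p k\<close> is positive, \<open>f k\<close>
    lacks the letter \<open>d'\<close>, and the only letter of \<open>?S\<close> that it lacks is
    \<open>d\<close>.\<close>
  have "(\<Sum>i\<le>k. p i * (\<omega> d' \<bullet> ?M f i)) = 0" using ce[of d'] g0 pq by simp
  then have "p k * (\<omega> d' \<bullet> ?M f k) = 0"
    using sum_nonneg_eq_0_iff[of "{..k}" "\<lambda>i. p i * (\<omega> d' \<bullet> ?M f i)"] nn by auto
  then have "d' \<notin> supp (f k)" using p[OF kr(3)] by (auto simp: supp_def)
  then have "d' = d" using d(2) d'(1) by blast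
  then have "supp (f k) = supp (g k)" using d(2) d'(2) by simp
  then have "f k = g k" using chain_from_one[OF f kr(3)] chain_from_one[OF g kr(3)] by metis
  then show ?case using e pq by simp
qed

section \<open>A point lying in exactly one simplex\<close>

definition std_chain :: "nat \<Rightarrow> 'w" where
  "std_chain i = simple_prod (take i ds)"

text \<open>Each new letter is absent from the preceding prefix and so leads upwards. With
  \<open>i\<close> upward steps and a word of \<open>i\<close> letters, the length is exactly
  \<open>i\<close>.\<close>

lemma chain_std_chain: "chain std_chain" and std_chain_0: "std_chain 0 = \<one>"
proof -
  have sub: "set (take i ds) \<subseteq> \<Delta>" for i using set_ds set_take_subset by fastforce
  have up: "\<exists>a. up (std_chain i) (std_chain (Suc i)) a" if i: "i < r" for i
  proof -
    let ?d = "ds ! i"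
    have d: "?d \<in> \<Delta>" using i set_ds by auto
    have t: "take (Suc i) ds = take i ds @ [?d]" using i by (rule take_Suc_conv_app_nth)
    have "distinct (take (Suc i) ds)" using distinct_ds by (rule distinct_take)
    then have "?d \<notin> set (take i ds)" unfolding t by simp
    then have "\<rho> (simple_prod (take i ds)) ?d \<in> pos" using simple_image_pos[OF sub d] by blast
    moreover have "std_chain (Suc i) = simple_prod (take i ds) \<otimes> rfl ?d"
      unfolding std_chain_def t using sub[of i] d rfl(1)[OF simple_root[OF d]] by (simp add: simple_prod_append)
    ultimately show ?thesis
      using up_iff_right[of "simple_prod (take i ds)" ?d] sub[of i] d simple_pos unfolding std_chain_def[of i] by auto
  qed
  have "i \<le> len (std_chain i)" if "i \<le> r" for i
    using that
  proof (induction i)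
    case (Suc i)
    then obtain a where "up (std_chain i) (std_chain (Suc i)) a" using up[of i] by auto
    then show ?case using Suc up_len[of "std_chain i" "std_chain (Suc i)" a] by simp
  qed simp
  moreover have "len (std_chain i) \<le> i" if "i \<le> r" for i
    using len_le[OF sub, of i] that by (simp add: std_chain_def)
  ultimately have len: "len (std_chain i) = i" if "i \<le> r" for i using that by (simp add: le_antisym)
  then have "cover (std_chain i) (std_chain (Suc i))" if "i < r" for i
    using up[OF that] that by (simp add: cover_def)
  then show "chain std_chain" by (simp add: chain_def std_chain_def c_eq[symmetric])
  show "std_chain 0 = \<one>" by (simp add: std_chain_def)
qed

text \<open>Barycentric coordinates become weights of vectors from the apex \<open>y\<close>; for a
  chain starting at the identity the term of index 0 is zero.\<close>

lemma pts_combination: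
  assumes f: "chain f"
  shows "(\<Sum>i\<le>r. bary (pts f) z (\<rho> (f i) y)) = 1"
    and "y - z = (\<Sum>i\<le>r. bary (pts f) z (\<rho> (f i) y) *\<^sub>R (y - \<rho> (f i) y))"
proof -
  let ?b = "bary (pts f) z"
  have nd: "nondegenerate (pts f)" by (rule nondegenerate_pts[OF f])
  have inj: "inj_on (\<lambda>i. \<rho> (f i) y) {..r}" using chain_pt_inj_on[OF f] by (simp add: atLeast0AtMost)
  have pts: "pts f = (\<lambda>i. \<rho> (f i) y) ` {..r}" by (simp add: pts_def atLeast0AtMost)
  show 1: "(\<Sum>i\<le>r. ?b (\<rho> (f i) y)) = 1"
    using bary_sum[OF nd, of z] unfolding pts by (simp add: sum.reindex[OF inj])
  have "(\<Sum>i\<le>r. ?b (\<rho> (f i) y) *\<^sub>R \<rho> (f i) y) = z"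
    using bary_combination[OF nd, of z] unfolding pts by (simp add: sum.reindex[OF inj])
  moreover have "(\<Sum>i\<le>r. ?b (\<rho> (f i) y) *\<^sub>R y) = y" using 1 by (simp add: scaleR_sum_left[symmetric])
  ultimately show "y - z = (\<Sum>i\<le>r. ?b (\<rho> (f i) y) *\<^sub>R (y - \<rho> (f i) y))"
    by (simp add: scaleR_diff_right sum_subtractf)
qed

text \<open>Over the orbit, \<open>y \<bullet> z\<close> is largest only at \<open>y\<close>, so a
  hull of orbit points contains \<open>y\<close> only as a vertex. The identity has length 0 and
  therefore comes first.\<close>

lemma vertex_y:
  assumes g: "chain g" and y: "y \<in> convex hull (pts g)"
  shows "g 0 = \<one>"
proof -
  have "\<exists>j\<le>r. g j = \<one>"
  proof (rule ccontr)
    assume n: "\<not> ?thesis"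
    have "pts g \<subseteq> {z. y \<bullet> z < y \<bullet> y}"
      unfolding pts_def using inner_orbit_less chain_closed[OF g] n by auto
    then have "convex hull (pts g) \<subseteq> {z. y \<bullet> z < y \<bullet> y}"
      by (intro hull_minimal convex_halfspace_lt)
    then show False using y by auto
  qed
  then obtain j where j: "j \<le> r" "g j = \<one>" by blast
  then have "len (g 0) = 0" using chain_len[OF g j(1)] len_one by simp
  then show ?thesis using len_eq_0 chain_closed[OF g le0] by blast
qed

lemma finite_simplices: "finite simplices"
proof -
  have "simplices \<subseteq> Pow ((\<lambda>w. \<rho> w y) ` carrier W)"
    using chain_closed by (auto simp: simplices_def pts_def)
  then show ?thesis using finite_W by (auto intro: finite_subset)
qed

lemma pts_subset_Perm: "chain f \<Longrightarrow> convex hull (pts f) \<subseteq> Perm W \<rho> y"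
  unfolding Perm_def by (intro hull_mono) (auto simp: pts_def intro!: imageI chain_closed)

text \<open>The point lies inside the standard simplex and close to \<open>y\<close>. Simplices
  missing \<open>y\<close> are closed and stay away from it; those containing \<open>y\<close> start
  at the identity, and \<open>cone_unique\<close> identifies them.\<close>

lemma start_point:
  obtains z where "z \<in> interior (convex hull (pts std_chain))"
    "\<And>X. X \<in> simplices \<Longrightarrow> z \<in> convex hull X \<Longrightarrow> X = pts std_chain"
proof -
  let ?X = "pts std_chain"
  have nd: "nondegenerate ?X" by (rule nondegenerate_pts[OF chain_std_chain])
  have fX: "finite ?X" "?X \<noteq> {}" "y \<in> ?X"
    using std_chain_0 by (auto simp: pts_def act_one intro!: image_eqI[of _ _ 0])
  let ?K = "\<Union>X\<in>{X \<in> simplices. y \<notin> convex hull X}. convex hull X"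
  have cl: "closed ?K"
    using finite_simplices by (intro closed_UN)
      (auto simp: simplices_def pts_def intro!: compact_imp_closed finite_imp_compact_convex_hull)
  have "open (- ?K)" "y \<in> - ?K" using cl open_Compl by blast+
  then obtain e where e: "e > 0" "ball y e \<subseteq> - ?K" using openE by blast
  define p where "p = (\<Sum>x\<in>?X. (1 / real (card ?X)) *\<^sub>R x)"
  have card: "real (card ?X) > 0" using fX by (simp add: card_gt_0_iff)
  have bp: "bary ?X p x = 1 / real (card ?X)" if "x \<in> ?X" for x
    using card that by (intro bary_unique[OF nd]) (auto simp: p_def)
  \<comment> \<open>Small enough to keep \<open>z\<close> within \<open>e\<close> of
    \<open>y\<close>; the summand 1 prevents a zero denominator, and the bound 1/2 keeps
    \<open>t\<close> below 1.\<close>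
  define t where "t = min (1 / 2) (e / (2 * (norm (p - y) + 1)))"
  have n1: "norm (p - y) + 1 > 0" by (simp add: add_nonneg_pos)
  have t: "0 < t" "t < 1" "t \<le> e / (2 * (norm (p - y) + 1))" using e n1 by (auto simp: t_def)
  define z where "z = (1 - t) *\<^sub>R y + t *\<^sub>R p"
  have zpos: "0 < bary ?X z x" if "x \<in> ?X" for x
    unfolding z_def bary_segment[OF nd that] bp[OF that] bary_vertex[OF nd fX(3) that]
    using t card by (auto simp: add_nonneg_pos)
  have "dist y z = t * norm (p - y)"
  proof -
    have "z - y = t *\<^sub>R (p - y)" by (simp add: z_def algebra_simps)
    then show ?thesis using t norm_minus_commute[of y z] by (simp add: dist_norm)
  qed
  also have "\<dots> < t * (2 * (norm (p - y) + 1))" using t by (intro mult_strict_left_mono) (auto simp: add_nonneg_pos)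
  also have "\<dots> \<le> e" using t(3) n1 by (simp add: pos_le_divide_eq)
  finally have zK: "z \<notin> ?K" using e(2) by auto
  have "X = ?X" if X: "X \<in> simplices" "z \<in> convex hull X" for X
  proof -
    obtain g where g: "chain g" "X = pts g" using X(1) by (auto simp: simplices_def)
    have "y \<in> convex hull X" using zK X by blast
    then have g0: "g 0 = \<one>" using vertex_y[OF g(1)] g(2) by simp
    have eq: "(\<Sum>i\<le>r. bary ?X z (\<rho> (std_chain i) y) *\<^sub>R (y - \<rho> (std_chain i) y))
        = (\<Sum>i\<le>r. bary (pts g) z (\<rho> (g i) y) *\<^sub>R (y - \<rho> (g i) y))"
      using pts_combination(2)[OF chain_std_chain, of z] pts_combination(2)[OF g(1), of z] by simp
    have p: "0 < bary ?X z (\<rho> (std_chain i) y)" if "i \<le> r" for i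
      using zpos that by (auto simp: pts_def)
    have q: "0 \<le> bary (pts g) z (\<rho> (g i) y)" if "i \<le> r" for i
      using X(2) in_convex_hull_bary[OF nondegenerate_pts[OF g(1)] order_refl, of z] g(2) that
      by (auto simp: pts_def)
    have "std_chain i = g i" if "i \<le> r" for i
      using cone_unique[OF chain_std_chain std_chain_0 g(1) g0 p q eq that] by blast
    then show ?thesis unfolding g(2) pts_def by (intro image_cong) auto
  qed
  then show ?thesis using that bary_pos_interior[OF nd zpos] by blast
qed

section \<open>Assembling the triangulation\<close>

lemma triangulation_simplices: "triangulation_of DIM('v) ((hull) convex ` simplices) (Perm W \<rho> y)"
proof -
  obtain z where z: "z \<in> interior (convex hull (pts std_chain))"
    "\<And>X. X \<in> simplices \<Longrightarrow> z \<in> convex hull X \<Longrightarrow> X = pts std_chain" by (rule start_point) blast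
  interpret matched_simplices simplices "Perm W \<rho> y" "pts std_chain" z
  proof
    show "finite simplices" by (rule finite_simplices)
    show "\<forall>X\<in>simplices. nondegenerate X" using nondegenerate_pts by (auto simp: simplices_def)
    show "compact (Perm W \<rho> y)"
      unfolding Perm_def using finite_W by (intro finite_imp_compact_convex_hull) simp
    show "convex (Perm W \<rho> y)" by (simp add: Perm_def)
    show "convex hull X \<subseteq> Perm W \<rho> y" if "X \<in> simplices" for X
      using that pts_subset_Perm by (auto simp: simplices_def)
    show "matched simplices (interior (Perm W \<rho> y))" by (rule matched_simplices_Perm)
    show "pts std_chain \<in> simplices" using chain_std_chain by (auto simp: simplices_def)
  qed (use z in auto)
  have "polytope (Perm W \<rho> y)" unfolding polytope_def Perm_def using finite_W by blast
  moreover have "interior (Perm W \<rho> y) \<noteq> {}"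
    using z(1) interior_mono[OF pts_subset_Perm[OF chain_std_chain]] by blast
  then have "aff_dim (Perm W \<rho> y) = int DIM('v)" by (rule aff_dim_nonempty_interior)
  moreover have "int DIM('v) simplex T" if "T \<in> (hull) convex ` simplices" for T
  proof -
    obtain f where f: "chain f" "T = convex hull (pts f)" using \<open>T \<in> _\<close> by (auto simp: simplices_def)
    then show ?thesis using nondegenerate_pts[OF f(1)] unfolding simplex_def nondegenerate_def
      by (intro exI[of _ "pts f"]) simp
  qed
  ultimately show ?thesis using triangulates covers by (auto simp: triangulation_of_def)
qed

text \<open>The \<open>r\<close> covers of a chain raise the length by \<open>r\<close>, which is
  the condition defining \<open>W_plus\<close>.\<close>

lemma SBDW_eq:
  assumes B: "B \<in> regions W \<rho>" "y \<in> B"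
  shows "SBDW W \<rho> B c y = (hull) convex ` simplices"
proof -
  have "f 0 \<in> W_plus W \<rho> B c \<and> f DIM('v) = f 0 \<otimes> c \<and> (\<forall>i<DIM('v). bruhat_cover W \<rho> B (f i) (f (Suc i)))
     \<longleftrightarrow> chain f" for f
    using chain_len[of f r] length_ds
    by (auto simp: chain_def W_plus_def word_length_eq[OF B] bruhat_cover_iff[OF B])
  then show ?thesis unfolding SBDW_def simplices_def pts_def length_ds[symmetric] by auto
qed

end

theorem theorem1p5:
  fixes W :: "('w, 'm) monoid_scheme"
    and R :: "'w set"
    and \<rho> :: "'w \<Rightarrow> 'v::euclidean_space \<Rightarrow> 'v"
    and B :: "'v set"
    and c :: 'w
    and y :: 'v
  assumes "coxeter_system W R"
    and "finite (carrier W)"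
    and "reflection_representation W R \<rho>"
    and "B \<in> regions W \<rho>"
    and "c \<in> standard_coxeter_elements W \<rho> B"
    and "y \<in> B"
  shows "triangulation_of DIM('v) (SBDW W \<rho> B c y) (Perm W \<rho> y)"
proof -
  have W: "group W" and R: "R \<subseteq> carrier W" "generate W R = carrier W"
    and invol: "\<And>s. s \<in> R \<Longrightarrow> s \<otimes>\<^bsub>W\<^esub> s = \<one>\<^bsub>W\<^esub>"
    using assms(1) by (auto simp: coxeter_system_def)
  interpret group W by (rule W)
  obtain \<alpha> where \<alpha>: "independent (\<alpha> ` R)" "span (\<alpha> ` R) = UNIV" "\<And>s. s \<in> R \<Longrightarrow> \<rho> s = reflect (\<alpha> s)"
    using assms(3) by (auto simp: reflection_representation_def)
  have fa: "faithful_action W UNIV \<rho>" using assms(3) by (simp add: reflection_representation_def)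
  interpret act: faithful_action W UNIV \<rho> by (rule fa)
  interpret hom: group_hom W "BijGroup UNIV" \<rho> by (rule act.group_hom)
  have mult: "\<rho> (u \<otimes>\<^bsub>W\<^esub> v) x = \<rho> u (\<rho> v x)" if "u \<in> carrier W" "v \<in> carrier W" for u v x
    using hom.hom_mult[OF that] act.bij_prop0[OF that(1)] act.bij_prop0[OF that(2)]
    by (simp add: BijGroup_def compose_def)
  have one: "\<rho> \<one>\<^bsub>W\<^esub> x = x" for x
    using act.id_eq_one by (metis UNIV_I restrict_apply')
  have \<alpha>0: "\<alpha> s \<noteq> 0" if "s \<in> R" for s
    using \<alpha>(1) that dependent_zero[of "\<alpha> ` R"] by (metis imageI)
  have refl_R: "R \<subseteq> reflections W \<rho>"
    using R(1) \<alpha>(3) \<alpha>0 by (auto simp: reflections_def is_reflection_def)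
  have orth: "orthogonal_transformation (\<rho> u)" if "u \<in> carrier W" for u
  proof -
    have "u \<in> generate W R" using that R(2) by simp
    then show ?thesis
    proof induction
      case one
      have "\<rho> \<one>\<^bsub>W\<^esub> = (\<lambda>x. x)" using \<open>\<And>x. \<rho> \<one>\<^bsub>W\<^esub> x = x\<close> by blast
      then show ?case by (simp add: orthogonal_transformation_id)
    next
      case (incl h)
      then show ?case using \<alpha>(3) orthogonal_transformation_reflect by simp
    next
      case (inv h)
      then have "inv\<^bsub>W\<^esub> h = h" using invol R(1) by (auto intro: inv_equality)
      then show ?case using inv \<alpha>(3) orthogonal_transformation_reflect by simp
    next
      case (eng h1 h2)
      then have "\<rho> (h1 \<otimes>\<^bsub>W\<^esub> h2) = \<rho> h1 \<circ> \<rho> h2" using mult R(2) by (auto simp: fun_eq_iff)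
      then show ?case using eng orthogonal_transformation_compose by metis
    qed
  qed
  interpret reflection_group W \<rho> y
  proof
    show "finite (carrier W)" by (rule assms(2))
    show "inj_on \<rho> (carrier W)" by (rule act.faithful)
    have "reflections W \<rho> \<subseteq> carrier W" by (auto simp: reflections_def)
    then show "generate W (reflections W \<rho>) = carrier W"
      using mono_generate[OF refl_R] R(2) generate_incl[of "reflections W \<rho>"] by auto
    show "x = 0" if h: "\<And>t. t \<in> reflections W \<rho> \<Longrightarrow> \<rho> t x = x" for x
    proof -
      have "\<alpha> s \<bullet> x = 0" if "s \<in> R" for s
        using h[of s] refl_R that \<alpha>(3)[OF that] reflect_fixed_iff[OF \<alpha>0[OF that]] by auto
      then have "orthogonal x v" if "v \<in> span (\<alpha> ` R)" for v
        using that by (intro orthogonal_to_span[of v "\<alpha> ` R"]) (auto simp: orthogonal_def inner_commute)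
      then have "orthogonal x x" using \<alpha>(2) by simp
      then show "x = 0" by (simp add: orthogonal_def)
    qed
    show "\<rho> t y \<noteq> y" if "t \<in> reflections W \<rho>" for t
    proof -
      have "B \<subseteq> UNIV - \<Union> (hyperplanes W \<rho>)"
        using assms(4) in_components_subset by (auto simp: regions_def)
      then show ?thesis using assms(6) that by (auto simp: hyperplanes_def reflecting_hyperplane_def)
    qed
  qed (use mult orth in auto)
  obtain \<Delta> \<omega> where \<Delta>: "\<Delta> \<subseteq> pos" "card \<Delta> = DIM('v)"
    "\<And>d e. d \<in> \<Delta> \<Longrightarrow> e \<in> \<Delta> \<Longrightarrow> \<omega> d \<bullet> e = (if d = e then 1 else 0)"
    "\<And>v. v = (\<Sum>d\<in>\<Delta>. (\<omega> d \<bullet> v) *\<^sub>R d)"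
    "\<And>a d. a \<in> pos \<Longrightarrow> d \<in> \<Delta> \<Longrightarrow> 0 \<le> \<omega> d \<bullet> a"
    by (rule simple_system) (rule that; assumption)
  interpret simple_system W \<rho> y \<Delta> \<omega>
    by unfold_locales (fact \<Delta>)+
  obtain ds where ds: "distinct ds" "set ds = \<Delta>" "c = simple_prod ds"
    using standard_coxeter_element_word[OF assms(4,6,5)] .
  interpret coxeter_chains W \<rho> y \<Delta> \<omega> ds c
    by unfold_locales (fact ds)+
  show ?thesis unfolding SBDW_eq[OF assms(4,6)] by (rule triangulation_simplices)
qed

end
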